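(* Let $X$ be a diffeological space and $A$ an abelian diffeological group. The map $\varphi:\check H^1_{KWW}(X,A)\to\check H^1_\infty(X,A)$, given on $1$-cocycles $\tau:B\times_XB\to A$ by $(\varphi\tau)(x_{p_1},f_0)=\tau(x_{p_1},f_0(x_{p_1}))$, is an isomorphism.
   Context: Diffeology. A cartesian space is a smooth manifold diffeomorphic to $\mathbb{R}^n$ for some $n\ge 0$; $\mathsf{Cart}$ is the category of cartesian spaces and smooth maps, regarded as small. A good open cover of a manifold is an open cover $\{U_i\}$ by cartesian spaces all of whose finite non-empty intersections are cartesian spaces. A diffeological space is a set $X$ with a collection of functions $p:U\to X$, $U\in\mathsf{Cart}$, called plots, such that (1) every map $\mathbb{R}^0\to X$ is a plot; (2) if $p:U\to X$ is a plot and $f:V\to U$ is smooth, then $pf$ is a plot; (3) if $p:U\to X$ is a function and $p|_{U_i}$ is a plot for every member of some good open cover $\{U_i\subseteq U\}$, then $p$ is a plot. A function $f:X\to Y$ is smooth if $fp$ is a plot of $Y$ for every plot $p$ of $X$. Limits and colimits are formed on underlying sets: a function into a limit is a plot iff all its components are; a function $U\to\mathrm{colim}\,F$ is a plot iff on the members of some good open cover of $U$ it lifts to plots of the terms of the diagram. An abelian diffeological group is an abelian group with a diffeology for which addition and inversion are smooth. Maps of plots $f_0:U_{p_1}\to U_{p_0}$ of $X$ are smooth maps with $p_0f_0=p_1$. Let $B=\coprod_pU_p$, over all plots $p:U_p\to X$, and $\pi:B\to X$, $\pi(x_p)=p(x_p)$. $QX$ is the simplicial diffeological space $QX_k=\coprod_{U_{p_k}\xrightarrow{f_{k-1}}\cdots\xrightarrow{f_0}U_{p_0}}U_{p_k}$,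 over chains of $k$ composable maps of plots, with $d_0(x_{p_k},f_{k-1},\dots,f_0)=(f_{k-1}(x_{p_k}),f_{k-2},\dots,f_0)$, inner faces composing consecutive maps, $d_k$ dropping $f_0$, degeneracies inserting identities; so $QX_0=B$. $N\check C(X)$ is the nerve of the diffeological groupoid $\check C(X)$ with objects $B$ and morphisms $B\times_XB$, source and target the two projections; $N\check C(X)_k$ is the $(k+1)$-fold fiber product of $B$ over $X$. For a simplicial diffeological space $S$, $[k]\mapsto C^\infty(S_k,A)$ is a cosimplicial abelian group, with associated cochain complex with differential $d=\sum_{i=0}^{n+1}(-1)^id^i$ in degree $n$. $\check H^k_{KWW}(X,A)$ is the $k$th cohomology of this complex for $S=N\check C(X)$, and $\check H^k_\infty(X,A)$ is (computed as) the $k$th cohomology of this complex for $S=QX$. The map $\varphi$ is induced by the functor $QX\to\check C(X)$ that is the identity on objects and sends the morphism $(x_{p_1},f_0)$ to $(x_{p_1},f_0(x_{p_1}))$. *)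

theory Defs
  imports "HOL-Analysis.Analysis" "HOL-Algebra.Coset" "HOL-Algebra.FiniteProduct"
begin

section \<open>Smooth maps between open subsets of Euclidean spaces\<close>

text \<open>
  \<open>\<real>\<^sup>n\<close> is the library's \<open>Euclidean_space n\<close>: the sequences of reals that vanish from index \<open>n\<close> on.
\<close>

type_synonym pt = "nat \<Rightarrow> real"

text \<open>
  \<open>times_diff k n W f\<close>: the real function \<open>f\<close> is of class \<open>C\<^sup>k\<close> on the open set \<open>W\<close> of \<open>\<real>\<^sup>n\<close>, i.e. all
  its iterated partial derivatives of order at most \<open>k\<close> exist and are continuous. As \<open>W\<close> is open,
  only the values of \<open>f\<close> on \<open>W\<close> matter.
\<close>

primrec times_diff :: "nat \<Rightarrow> nat \<Rightarrow> pt set \<Rightarrow> (pt \<Rightarrow> real) \<Rightarrow> bool" where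
  "times_diff 0 n W f \<longleftrightarrow> continuous_map (subtopology (Euclidean_space n) W) euclideanreal f"
| "times_diff (Suc k) n W f \<longleftrightarrow>
     continuous_map (subtopology (Euclidean_space n) W) euclideanreal f \<and>
     (\<forall>i<n. \<exists>g. (\<forall>x\<in>W. ((\<lambda>t. f (x(i := t))) has_real_derivative g x) (at (x i))) \<and>
                times_diff k n W g)"

definition smooth_euclidean :: "nat \<Rightarrow> pt set \<Rightarrow> nat \<Rightarrow> (pt \<Rightarrow> pt) \<Rightarrow> bool" where
  "smooth_euclidean m W n F \<longleftrightarrow>
     openin (Euclidean_space m) W \<and> F ` W \<subseteq> topspace (Euclidean_space n) \<and>
     (\<forall>j<n. \<forall>k. times_diff k m W (\<lambda>x. F x j))"


section \<open>Smooth manifolds and cartesian spaces\<close>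

text \<open>
  The category \<open>Cart\<close> is made small by requiring the points of a manifold to be elements of the
  fixed type \<^typ>\<open>pt\<close>, with no relation between the smooth structure and the topology
  of \<^typ>\<open>pt\<close>. Every cartesian space is diffeomorphic to one of these, since all \<open>\<real>\<^sup>n\<close> are among them.
  Throughout, functions defined on a set are \<^const>\<open>extensional\<close>, so that two of them are equal
  exactly if they agree on that set.
\<close>

type_synonym chart = "pt set \<times> (pt \<Rightarrow> pt)"

record manifold =
  points :: "pt set"
  mdim :: nat
  atlas :: "chart set"

definition is_chart :: "pt set \<Rightarrow> nat \<Rightarrow> chart \<Rightarrow> bool" where
  "is_chart M n = (\<lambda>(D, \<phi>). D \<subseteq> M \<and> \<phi> \<in> extensional D \<and> inj_on \<phi> D \<and>
     openin (Euclidean_space n) (\<phi> ` D))"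

definition compatible :: "nat \<Rightarrow> chart \<Rightarrow> chart \<Rightarrow> bool" where
  "compatible n = (\<lambda>(D, \<phi>) (E, \<psi>).
     smooth_euclidean n (\<phi> ` (D \<inter> E)) n (\<psi> \<circ> inv_into D \<phi>) \<and>
     smooth_euclidean n (\<psi> ` (D \<inter> E)) n (\<phi> \<circ> inv_into E \<psi>))"

text \<open>The chart domains of a maximal atlas form a base of the manifold topology.\<close>

definition mtop :: "manifold \<Rightarrow> pt topology" where
  "mtop M = topology_generated_by (fst ` atlas M)"

definition smooth_manifold :: "manifold \<Rightarrow> bool" where
  "smooth_manifold M \<longleftrightarrow>
     (\<forall>c\<in>atlas M. is_chart (points M) (mdim M) c) \<and>
     \<Union>(fst ` atlas M) = points M \<and>
     (\<forall>c\<in>atlas M. \<forall>c'\<in>atlas M. compatible (mdim M) c c') \<and>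
     (\<forall>c. is_chart (points M) (mdim M) c \<longrightarrow>
          (\<forall>c'\<in>atlas M. compatible (mdim M) c c') \<longrightarrow> c \<in> atlas M) \<and>
     Hausdorff_space (mtop M) \<and> second_countable (mtop M)"

definition smooth_maps :: "manifold \<Rightarrow> manifold \<Rightarrow> (pt \<Rightarrow> pt) set" where
  "smooth_maps M N = {f \<in> points M \<rightarrow>\<^sub>E points N.
     continuous_map (mtop M) (mtop N) f \<and>
     (\<forall>(D, \<phi>)\<in>atlas M. \<forall>(E, \<psi>)\<in>atlas N.
        smooth_euclidean (mdim M) (\<phi> ` {x \<in> D. f x \<in> E}) (mdim N) (\<psi> \<circ> f \<circ> inv_into D \<phi>))}"

definition diffeomorphisms :: "manifold \<Rightarrow> manifold \<Rightarrow> (pt \<Rightarrow> pt) set" where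
  "diffeomorphisms M N = {f \<in> smooth_maps M N. bij_betw f (points M) (points N) \<and>
     restrict (inv_into (points M) f) (points N) \<in> smooth_maps N M}"

text \<open>\<open>\<real>\<^sup>n\<close> with its standard (maximal) smooth structure.\<close>

definition euclid :: "nat \<Rightarrow> manifold" where
  "euclid n = \<lparr>points = topspace (Euclidean_space n), mdim = n,
     atlas = {(D, \<phi>). is_chart (topspace (Euclidean_space n)) n (D, \<phi>) \<and>
                smooth_euclidean n D n \<phi> \<and>
                smooth_euclidean n (\<phi> ` D) n (inv_into D \<phi>)}\<rparr>"

definition open_submanifold :: "manifold \<Rightarrow> pt set \<Rightarrow> manifold" where
  "open_submanifold M V = \<lparr>points = V, mdim = mdim M, atlas = {(D, \<phi>) \<in> atlas M. D \<subseteq> V}\<rparr>"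

definition cartesian :: "manifold \<Rightarrow> bool" where
  "cartesian M \<longleftrightarrow> smooth_manifold M \<and> (\<exists>n. diffeomorphisms M (euclid n) \<noteq> {})"

definition good_open_cover :: "manifold \<Rightarrow> pt set set \<Rightarrow> bool" where
  "good_open_cover M \<C> \<longleftrightarrow>
     (\<forall>V\<in>\<C>. openin (mtop M) V \<and> cartesian (open_submanifold M V)) \<and> \<Union>\<C> = points M \<and>
     (\<forall>\<F>\<subseteq>\<C>. finite \<F> \<longrightarrow> \<F> \<noteq> {} \<longrightarrow> \<Inter>\<F> \<noteq> {} \<longrightarrow> cartesian (open_submanifold M (\<Inter>\<F>)))"


section \<open>Diffeological spaces\<close>

text \<open>A plot \<open>p : U \<rightarrow> X\<close> is the pair of its domain \<open>U\<close> and the function.\<close>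

type_synonym 'x plot = "manifold \<times> (pt \<Rightarrow> 'x)"

record 'x diffeological = "'x partial_object" +
  plots :: "'x plot set"

definition diffeological_space :: "'x diffeological \<Rightarrow> bool" where
  "diffeological_space X \<longleftrightarrow>
     (\<forall>(U, p)\<in>plots X. cartesian U \<and> p \<in> points U \<rightarrow>\<^sub>E carrier X) \<and>
     (\<forall>p \<in> points (euclid 0) \<rightarrow>\<^sub>E carrier X. (euclid 0, p) \<in> plots X) \<and>
     (\<forall>U p V f. (U, p) \<in> plots X \<longrightarrow> cartesian V \<longrightarrow> f \<in> smooth_maps V U \<longrightarrow>
        (V, compose (points V) p f) \<in> plots X) \<and>
     (\<forall>U p \<C>. cartesian U \<longrightarrow> p \<in> points U \<rightarrow>\<^sub>E carrier X \<longrightarrow> good_open_cover U \<C> \<longrightarrow>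
        (\<forall>V\<in>\<C>. (open_submanifold U V, restrict p V) \<in> plots X) \<longrightarrow> (U, p) \<in> plots X)"

definition smooth_functions :: "'x diffeological \<Rightarrow> 'y diffeological \<Rightarrow> ('x \<Rightarrow> 'y) set" where
  "smooth_functions X Y = {f \<in> carrier X \<rightarrow>\<^sub>E carrier Y.
     \<forall>(U, p)\<in>plots X. (U, compose (points U) f p) \<in> plots Y}"

definition manifold_space :: "manifold \<Rightarrow> pt diffeological" where
  "manifold_space M = \<lparr>carrier = points M,
     plots = {(U, f). cartesian U \<and> f \<in> smooth_maps U M}\<rparr>"

definition product_space :: "'x diffeological \<Rightarrow> 'y diffeological \<Rightarrow> ('x \<times> 'y) diffeological" where
  "product_space X Y = \<lparr>carrier = carrier X \<times> carrier Y,
     plots = {(U, p). cartesian U \<and> p \<in> points U \<rightarrow>\<^sub>E carrier X \<times> carrier Y \<and>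
                (U, compose (points U) fst p) \<in> plots X \<and>
                (U, compose (points U) snd p) \<in> plots Y}\<rparr>"

definition coproduct_space ::
  "'i set \<Rightarrow> ('i \<Rightarrow> 'x diffeological) \<Rightarrow> ('i \<times> 'x) diffeological" where
  "coproduct_space I F = \<lparr>carrier = (SIGMA i:I. carrier (F i)),
     plots = {(U, p). cartesian U \<and> p \<in> points U \<rightarrow>\<^sub>E (SIGMA i:I. carrier (F i)) \<and>
                (\<exists>\<C>. good_open_cover U \<C> \<and>
                   (\<forall>V\<in>\<C>. \<exists>i\<in>I. \<exists>q. (open_submanifold U V, q) \<in> plots (F i) \<and>
                              (\<forall>x\<in>V. p x = (i, q x))))}\<rparr>"

record 'a diffeological_group = "'a monoid" +
  group_plots :: "'a plot set"

definition group_space :: "'a diffeological_group \<Rightarrow> 'a diffeological" where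
  "group_space A = \<lparr>carrier = carrier A, plots = group_plots A\<rparr>"

text \<open>
  The group structure is written multiplicatively, as everywhere in \<open>HOL-Algebra\<close>.
\<close>

definition abelian_diffeological_group :: "'a diffeological_group \<Rightarrow> bool" where
  "abelian_diffeological_group A \<longleftrightarrow>
     comm_group A \<and> diffeological_space (group_space A) \<and>
     (\<lambda>(a, b)\<in>carrier A \<times> carrier A. a \<otimes>\<^bsub>A\<^esub> b)
       \<in> smooth_functions (product_space (group_space A) (group_space A)) (group_space A) \<and>
     (\<lambda>a\<in>carrier A. inv\<^bsub>A\<^esub> a) \<in> smooth_functions (group_space A) (group_space A)"


section \<open>Cohomology of simplicial diffeological spaces\<close>

text \<open>
  \<open>face S k i\<close> is the face map \<open>d\<^sub>i : S\<^sub>k \<rightarrow> S\<^sub>k\<^sub>-\<^sub>1\<close>. Degeneracies are not recorded, since the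
  (unnormalized) cochain complex does not involve them.
\<close>

record 's simplicial_space =
  level :: "nat \<Rightarrow> 's diffeological"
  face :: "nat \<Rightarrow> nat \<Rightarrow> 's \<Rightarrow> 's"

definition cochains ::
  "'s simplicial_space \<Rightarrow> 'a diffeological_group \<Rightarrow> nat \<Rightarrow> ('s \<Rightarrow> 'a) monoid" where
  "cochains S A n = \<lparr>carrier = smooth_functions (level S n) (group_space A),
     mult = (\<lambda>\<sigma> \<tau>. \<lambda>s\<in>carrier (level S n). \<sigma> s \<otimes>\<^bsub>A\<^esub> \<tau> s),
     one = (\<lambda>s\<in>carrier (level S n). \<one>\<^bsub>A\<^esub>)\<rparr>"

text \<open>The alternating sum \<open>\<Sum>\<^sub>i (-1)\<^sup>i d\<^sup>i\<close> with \<open>i\<close> from \<open>0\<close> to \<open>n + 1\<close>, in multiplicative notation.\<close>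

definition differential ::
  "'s simplicial_space \<Rightarrow> 'a diffeological_group \<Rightarrow> nat \<Rightarrow> ('s \<Rightarrow> 'a) \<Rightarrow> 's \<Rightarrow> 'a" where
  "differential S A n \<tau> = (\<lambda>s\<in>carrier (level S (Suc n)).
     finprod A (\<lambda>i. \<tau> (face S (Suc n) i s) [^]\<^bsub>A\<^esub> ((- 1) ^ i :: int)) {..Suc n})"

definition cocycles ::
  "'s simplicial_space \<Rightarrow> 'a diffeological_group \<Rightarrow> nat \<Rightarrow> ('s \<Rightarrow> 'a) monoid" where
  "cocycles S A n = (cochains S A n)
     \<lparr>carrier := kernel (cochains S A n) (cochains S A (Suc n)) (differential S A n)\<rparr>"

definition coboundaries ::
  "'s simplicial_space \<Rightarrow> 'a diffeological_group \<Rightarrow> nat \<Rightarrow> ('s \<Rightarrow> 'a) set" where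
  "coboundaries S A n = (case n of
       0 \<Rightarrow> {\<one>\<^bsub>cochains S A 0\<^esub>}
     | Suc m \<Rightarrow> differential S A m ` carrier (cochains S A m))"

definition cohomology ::
  "'s simplicial_space \<Rightarrow> 'a diffeological_group \<Rightarrow> nat \<Rightarrow> ('s \<Rightarrow> 'a) set monoid" where
  "cohomology S A n = cocycles S A n Mod coboundaries S A n"

definition cohomology_class ::
  "'s simplicial_space \<Rightarrow> 'a diffeological_group \<Rightarrow> nat \<Rightarrow> ('s \<Rightarrow> 'a) \<Rightarrow> ('s \<Rightarrow> 'a) set" where
  "cohomology_class S A n \<tau> = coboundaries S A n #>\<^bsub>cocycles S A n\<^esub> \<tau>"


section \<open>The simplicial diffeological space \<open>QX\<close> and the nerve of the Cech groupoid\<close>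

text \<open>
  A chain of \<open>k\<close> composable maps of plots is encoded as \<open>([p\<^sub>k, \<dots>, p\<^sub>0], [f\<^sub>k\<^sub>-\<^sub>1, \<dots>, f\<^sub>0])\<close>,
  so that \<open>fs ! i\<close> is a map from \<open>ps ! i\<close> to \<open>ps ! Suc i\<close>.
\<close>

type_synonym 'x chain = "'x plot list \<times> (pt \<Rightarrow> pt) list"

definition plot_maps :: "'x plot \<Rightarrow> 'x plot \<Rightarrow> (pt \<Rightarrow> pt) set" where
  "plot_maps p q = {f \<in> smooth_maps (fst p) (fst q).
     compose (points (fst p)) (snd q) f = snd p}"

definition plot_chains :: "'x diffeological \<Rightarrow> nat \<Rightarrow> 'x chain set" where
  "plot_chains X k = {(ps, fs). length ps = Suc k \<and> length fs = k \<and> set ps \<subseteq> plots X \<and>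
     (\<forall>i<k. fs ! i \<in> plot_maps (ps ! i) (ps ! Suc i))}"

definition omit :: "nat \<Rightarrow> 'b list \<Rightarrow> 'b list" where
  "omit i xs = take i xs @ drop (Suc i) xs"

definition Q_face :: "nat \<Rightarrow> nat \<Rightarrow> 'x chain \<times> pt \<Rightarrow> 'x chain \<times> pt" where
  "Q_face k i = (\<lambda>((ps, fs), x).
     ((omit i ps,
       if i = 0 then tl fs
       else if i = k then butlast fs
       else take (i - 1) fs
            @ [compose (points (fst (ps ! (i - 1)))) (fs ! i) (fs ! (i - 1))]
            @ drop (Suc i) fs),
      if i = 0 then hd fs x else x))"

definition Q :: "'x diffeological \<Rightarrow> ('x chain \<times> pt) simplicial_space" where
  "Q X = \<lparr>level = (\<lambda>k. coproduct_space (plot_chains X k)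
                       (\<lambda>(ps, fs). manifold_space (fst (hd ps)))),
          face = Q_face\<rparr>"

definition B_space :: "'x diffeological \<Rightarrow> ('x plot \<times> pt) diffeological" where
  "B_space X = coproduct_space (plots X) (\<lambda>p. manifold_space (fst p))"

definition B_proj :: "'x plot \<times> pt \<Rightarrow> 'x" where
  "B_proj = (\<lambda>(p, x). snd p x)"

text \<open>
  A point of the \<open>(k + 1)\<close>-fold fiber product of \<open>B\<close> over \<open>X\<close> is the list of its \<open>k + 1\<close> components.
  In degree 1 the list \<open>[b, b']\<close> is the morphism from \<open>b\<close> to \<open>b'\<close>; the face \<open>d\<^sub>i\<close> of the nerve
  omits the \<open>i\<close>-th object.
\<close>

definition fiber_product :: "'x diffeological \<Rightarrow> nat \<Rightarrow> ('x plot \<times> pt) list diffeological" where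
  "fiber_product X k =
     (let S = {bs. length bs = Suc k \<and> set bs \<subseteq> carrier (B_space X) \<and>
                   (\<forall>b\<in>set bs. \<forall>b'\<in>set bs. B_proj b = B_proj b')}
      in \<lparr>carrier = S,
          plots = {(U, p). cartesian U \<and> p \<in> points U \<rightarrow>\<^sub>E S \<and>
                     (\<forall>i\<le>k. (U, compose (points U) (\<lambda>bs. bs ! i) p) \<in> plots (B_space X))}\<rparr>)"

definition Cech_nerve :: "'x diffeological \<Rightarrow> ('x plot \<times> pt) list simplicial_space" where
  "Cech_nerve X = \<lparr>level = fiber_product X, face = (\<lambda>k i. omit i)\<rparr>"

definition H_KWW ::
  "'x diffeological \<Rightarrow> 'a diffeological_group \<Rightarrow> nat \<Rightarrow> (('x plot \<times> pt) list \<Rightarrow> 'a) set monoid" where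
  "H_KWW X A n = cohomology (Cech_nerve X) A n"

definition H_infinity ::
  "'x diffeological \<Rightarrow> 'a diffeological_group \<Rightarrow> nat \<Rightarrow> ('x chain \<times> pt \<Rightarrow> 'a) set monoid" where
  "H_infinity X A n = cohomology (Q X) A n"


section \<open>The comparison map\<close>

text \<open>
  On nerves, the functor from \<open>QX\<close> to the Cech groupoid sends \<open>(x, f\<^sub>k\<^sub>-\<^sub>1, \<dots>, f\<^sub>0)\<close> to the list of the successive
  images of \<open>x\<close> under the maps of the chain, each labelled with its plot. For \<open>k = 1\<close> this is
  \<open>[(p\<^sub>1, x), (p\<^sub>0, f\<^sub>0 x)]\<close>.
\<close>

primrec orbit :: "(pt \<Rightarrow> pt) list \<Rightarrow> pt \<Rightarrow> pt list" where
  "orbit [] x = [x]"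
| "orbit (f # fs) x = x # orbit fs (f x)"

definition Q_to_Cech :: "'x chain \<times> pt \<Rightarrow> ('x plot \<times> pt) list" where
  "Q_to_Cech = (\<lambda>((ps, fs), x). zip ps (orbit fs x))"

definition phi_cochain ::
  "'x diffeological \<Rightarrow> nat \<Rightarrow> (('x plot \<times> pt) list \<Rightarrow> 'a) \<Rightarrow> ('x chain \<times> pt \<Rightarrow> 'a)" where
  "phi_cochain X n \<tau> = compose (carrier (level (Q X) n)) \<tau> Q_to_Cech"

text \<open>
  A cohomology class \<open>c\<close> is a coset of cocycles. Its image is the union of the classes of
  \<open>\<phi>\<tau>\<close> for \<open>\<tau> \<in> c\<close>; this is a single cohomology class exactly if all of them coincide.
\<close>

definition phi ::
  "'x diffeological \<Rightarrow> 'a diffeological_group \<Rightarrow> nat \<Rightarrow>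
   (('x plot \<times> pt) list \<Rightarrow> 'a) set \<Rightarrow> ('x chain \<times> pt \<Rightarrow> 'a) set" where
  "phi X A n c = (\<Union>\<tau>\<in>c. cohomology_class (Q X) A n (phi_cochain X n \<tau>))"

end

theory Submission
  imports Defs
begin

text \<open>
  A 1-cocycle on \<open>QX\<close> is determined by its values on the maps out of constant plots \<open>\<real>\<^sup>0 \<rightarrow> X\<close>: writing
  \<open>\<rho>(b)\<close> for the value of \<open>\<rho>\<close> on the map that picks out \<open>b \<in> B\<close> from the constant plot below \<open>b\<close>,
  the cocycle condition says \<open>\<rho>(x, f) = \<rho>(f x) - \<rho>(x)\<close>. Hence \<open>\<tau>(b, b') = \<rho>(b') - \<rho>(b)\<close> is the
  unique Cech cocycle with \<open>\<phi>\<tau> = \<rho>\<close>, and \<open>\<phi>\<close> is bijective already on 1-cocycles. That \<open>\<tau>\<close> is smooth is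
  a local question: for smooth \<open>g : V \<rightarrow> U\<^sub>p\<close> and \<open>h : V \<rightarrow> U\<^sub>q\<close> with \<open>p g = q h =: r\<close>, the maps \<open>g\<close> and \<open>h\<close>
  are maps of plots out of \<open>r\<close>, so that \<open>\<tau>(g x, h x) = \<rho>(x, h) - \<rho>(x, g)\<close>. Both complexes have the same
  0-cochains, so the coboundaries correspond as well.

  The geometric input is that any two good open covers of a cartesian space have a common good
  refinement, by preimages of coordinate boxes under a diffeomorphism to \<open>\<real>\<^sup>n\<close>.
\<close>

section \<open>Differential calculus on open subsets of Euclidean spaces\<close>

text \<open>The function b |-> \<rho>(b) is only a map of sets: every base arrow is the single point
  of its own summand in degree 1 of QX, so nothing relates the values at different b smoothly. When
  it happens to be smooth on B, \<tau> is a coboundary; in general only the differences \<rho>(b') -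
  \<rho>(b) over a common point of X are smooth. To see this, both points must vary through one
  plot, which is why smoothness of \<tau> is tested on pairs (g, h) lying over X.

  A plot of the fibre product reduces to such pairs only locally, and its two components lift on two
  unrelated good covers. Intersections of members of different covers may fail to be cartesian, and
  then the gluing axiom for plots says nothing about them; this forces the common good refinement.
  Boxes serve because they are closed under intersection.

  Smoothness is defined by iterated partial derivatives, whereas pulling back plots composes maps
  between manifolds. Hence the calculus has to be developed as far as the chain rule for all
  orders.\<close>

lemma Euclidean_space_top_of_set: "Euclidean_space n = top_of_set {x. \<forall>i\<ge>n. x i = 0}"
  by (simp add: Euclidean_space_def euclidean_product_topology)

section \<open>Coordinate cubes, total differentiability and the chain rule along curves\<close>

lemma openin_Euclidean_space_box:
  "openin (Euclidean_space n) {y \<in> topspace (Euclidean_space n). \<forall>j<n. a j < y j \<and> y j < b j}"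
proof -
  have "open {y::pt. a j < y j \<and> y j < b j}" for j
    by (intro open_Collect_conj open_Collect_less continuous_intros continuous_on_product_coordinates)
  then have "open (\<Inter>j<n. {y. a j < y j \<and> y j < b j})"
    by auto
  moreover have "{y \<in> topspace (Euclidean_space n). \<forall>j<n. a j < y j \<and> y j < b j}
     = {x. \<forall>i\<ge>n. x i = 0} \<inter> (\<Inter>j<n. {y. a j < y j \<and> y j < b j})"
    by (auto simp: topspace_Euclidean_space)
  ultimately show ?thesis
    unfolding Euclidean_space_top_of_set openin_open by blast
qed

text \<open>A basic open set of the product topology restricts finitely many coordinates only, and
  the coordinates from \<open>n\<close> on vanish at all points concerned. A minimum of finitely
  many radii therefore gives a cube, the form of openness that the estimates below work
  with.\<close>

lemma openin_Euclidean_space_iff: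
  "openin (Euclidean_space n) W \<longleftrightarrow> W \<subseteq> topspace (Euclidean_space n) \<and>
     (\<forall>x\<in>W. \<exists>d>0. \<forall>y\<in>topspace (Euclidean_space n). (\<forall>j<n. \<bar>y j - x j\<bar> < d) \<longrightarrow> y \<in> W)"
  (is "?l \<longleftrightarrow> ?r")
proof
  assume l: ?l
  then obtain T where T: "openin (powertop_real UNIV) T" and W: "W = T \<inter> {x. \<forall>i\<ge>n. x i = 0}"
    unfolding Euclidean_space_def by (auto simp: openin_subtopology)
  have "\<exists>d>0. \<forall>y\<in>topspace (Euclidean_space n). (\<forall>j<n. \<bar>y j - x j\<bar> < d) \<longrightarrow> y \<in> W" if "x \<in> W" for x
  proof -
    obtain U where U: "finite {i. U i \<noteq> (UNIV::real set)}" "\<And>i. open (U i)" "\<And>i. x i \<in> U i" "Pi\<^sub>E UNIV U \<subseteq> T"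
      using T \<open>x \<in> W\<close> unfolding W openin_product_topology_alt
      by (simp add: PiE_UNIV_domain Pi_iff) blast
    have "\<exists>d>0. \<forall>t. \<bar>t - x i\<bar> < d \<longrightarrow> t \<in> U i" for i
      using U(2)[of i] U(3)[of i] unfolding open_dist dist_real_def by blast
    then obtain d where d: "\<And>i. d i > 0" "\<And>i t. \<bar>t - x i\<bar> < d i \<Longrightarrow> t \<in> U i"
      by metis
    \<comment> \<open>The inserted 1 keeps the set non-empty when no coordinate is
      restricted.\<close>
    define e where "e = Min (insert 1 (d ` {i. U i \<noteq> UNIV}))"
    have "e > 0"
      unfolding e_def using U(1) d(1) by (subst Min_gr_iff) auto
    moreover have "y \<in> W" if y: "y \<in> topspace (Euclidean_space n)" "\<forall>j<n. \<bar>y j - x j\<bar> < e" for y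
    proof -
      have "y i \<in> U i" for i
      proof (cases "U i = UNIV")
        case False
        then have "e \<le> d i"
          unfolding e_def using U(1) by (intro Min_le) auto
        show ?thesis
        proof (cases "i < n")
          case True
          then show ?thesis
            using y(2) \<open>e \<le> d i\<close> by (intro d(2)) force
        next
          case False
          then have "y i = x i"
            using y(1) \<open>x \<in> W\<close> by (simp add: W topspace_Euclidean_space)
          then show ?thesis
            using U(3) by simp
        qed
      qed simp
      then show ?thesis
        using U(4) y(1) by (auto simp: W topspace_Euclidean_space)
    qed
    ultimately show ?thesis by blast
  qed
  then show ?r
    using openin_subset[OF l] by blast
next
  assume r: ?r
  show ?l
  proof (subst openin_subopen, intro ballI)
    fix x assume "x \<in> W"
    then obtain d where d: "d > 0" "\<And>y. y \<in> topspace (Euclidean_space n) \<Longrightarrow> (\<forall>j<n. \<bar>y j - x j\<bar> < d) \<Longrightarrow> y \<in> W"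
      using r by blast
    let ?C = "{y \<in> topspace (Euclidean_space n). \<forall>j<n. x j - d < y j \<and> y j < x j + d}"
    have "?C \<subseteq> W"
      by (rule subsetI, rule d(2)) (auto simp: abs_less_iff algebra_simps)
    moreover have "x \<in> ?C"
      using \<open>x \<in> W\<close> r d(1) by auto
    ultimately show "\<exists>T. openin (Euclidean_space n) T \<and> x \<in> T \<and> T \<subseteq> W"
      using openin_Euclidean_space_box[of n "\<lambda>j. x j - d" "\<lambda>j. x j + d"] by blast
  qed
qed

text \<open>Continuity in epsilon-delta form. Membership in \<open>W\<close> is part of the
  conclusion, so that one radius both keeps points inside the domain and controls
  \<open>f\<close>.\<close>

lemma continuous_map_cube:
  assumes "openin (Euclidean_space n) W"
    and "continuous_map (subtopology (Euclidean_space n) W) euclideanreal f"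
    and "x \<in> W" "e > 0"
  obtains d where "d > 0" "\<And>y. y \<in> topspace (Euclidean_space n) \<Longrightarrow> (\<forall>j<n. \<bar>y j - x j\<bar> < d) \<Longrightarrow>
    y \<in> W \<and> \<bar>f y - f x\<bar> < e"
proof -
  have top: "topspace (subtopology (Euclidean_space n) W) = W"
    using openin_subset[OF assms(1)] by (simp add: inf.absorb2)
  have "openin (subtopology (Euclidean_space n) W) {y \<in> W. f y \<in> ball (f x) e}"
    using openin_continuous_map_preimage[OF assms(2), of "ball (f x) e"] unfolding top by simp
  then have "openin (Euclidean_space n) {y \<in> W. f y \<in> ball (f x) e}"
    by (simp add: openin_open_subtopology[OF assms(1)])
  moreover have "x \<in> {y \<in> W. f y \<in> ball (f x) e}"
    using assms by auto
  ultimately obtain d where "d > 0" "\<forall>y\<in>topspace (Euclidean_space n). (\<forall>j<n. \<bar>y j - x j\<bar> < d) \<longrightarrow>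
      y \<in> {y \<in> W. f y \<in> ball (f x) e}"
    unfolding openin_Euclidean_space_iff by blast
  then show thesis
    by (intro that[of d]) (auto simp: dist_real_def abs_minus_commute)
qed

text \<open>The classical reason why continuous partial derivatives give total differentiability:
  \<open>x\<close> is moved to \<open>y\<close> one coordinate at a time, and on each move the mean
  value inequality applies, because the partial derivative in question stays within \<open>e\<close>
  of its value at \<open>x\<close>.\<close>

lemma linear_approximation:
  assumes W: "openin (Euclidean_space n) W" and "x \<in> W"
    and deriv: "\<And>j y. j < n \<Longrightarrow> y \<in> W \<Longrightarrow> ((\<lambda>t. f (y(j := t))) has_real_derivative g j y) (at (y j))"
    and cont: "\<And>j. j < n \<Longrightarrow> continuous_map (subtopology (Euclidean_space n) W) euclideanreal (g j)"
    and "e > 0"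
  obtains d where "d > 0" "\<And>y. y \<in> topspace (Euclidean_space n) \<Longrightarrow> (\<forall>j<n. \<bar>y j - x j\<bar> < d) \<Longrightarrow>
     \<bar>f y - f x - (\<Sum>j<n. g j x * (y j - x j))\<bar> \<le> e * (\<Sum>j<n. \<bar>y j - x j\<bar>)"
proof -
  have "\<exists>d>0. \<forall>y\<in>topspace (Euclidean_space n). (\<forall>j<n. \<bar>y j - x j\<bar> < d) \<longrightarrow> y \<in> W \<and> \<bar>g j y - g j x\<bar> < e" if "j < n" for j
    by (rule continuous_map_cube[OF W cont[OF that] assms(2) \<open>e > 0\<close>]) blast
  then obtain D where D: "\<And>j. j < n \<Longrightarrow> D j > 0"
    "\<And>j y. j < n \<Longrightarrow> y\<in>topspace (Euclidean_space n) \<Longrightarrow> (\<forall>i<n. \<bar>y i - x i\<bar> < D j) \<Longrightarrow> y \<in> W \<and> \<bar>g j y - g j x\<bar> < e"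
    by metis
  define d where "d = Min (insert 1 (D ` {..<n}))"
  have "d > 0"
    unfolding d_def using D(1) by (subst Min_gr_iff) auto
  have dD: "d \<le> D j" if "j < n" for j
    unfolding d_def using that by (intro Min_le) auto
  have near: "y \<in> W \<and> \<bar>g j y - g j x\<bar> < e"
    if "j < n" "y\<in>topspace (Euclidean_space n)" "\<forall>i<n. \<bar>y i - x i\<bar> < d" for y j
    using D(2)[OF that(1,2)] dD[OF that(1)] that(3) by force
  \<comment> \<open>Induction on the number \<open>k\<close> of leading coordinates in which
    \<open>y\<close> may differ from \<open>x\<close>. Resetting coordinate \<open>k\<close> to
    \<open>x k\<close> yields a point covered by the induction hypothesis.\<close>
  have step: "\<bar>f y - f x - (\<Sum>j<k. g j x * (y j - x j))\<bar> \<le> e * (\<Sum>j<k. \<bar>y j - x j\<bar>)"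
    if "k \<le> n" "y \<in> topspace (Euclidean_space n)" "\<forall>j<n. \<bar>y j - x j\<bar> < d" "\<forall>j\<ge>k. y j = x j" for k y
    using that
  proof (induction k arbitrary: y)
    case 0
    then have "y = x" by auto
    then show ?case by simp
  next
    case (Suc k)
    let ?y = "\<lambda>t. y(k := t)"
    let ?S = "closed_segment (x k) (y k)"
    have k: "k < n" using Suc.prems by simp
    have yt: "?y t \<in> topspace (Euclidean_space n)" for t
      using Suc.prems(2) k by (auto simp: topspace_Euclidean_space)
    have nearS: "\<forall>i<n. \<bar>?y t i - x i\<bar> < d" if "t \<in> ?S" for t
      using Suc.prems(3) k that segment_bound1[OF that] by (fastforce simp: abs_minus_commute)
    have IH: "\<bar>f (?y (x k)) - f x - (\<Sum>j<k. g j x * (?y (x k) j - x j))\<bar> \<le> e * (\<Sum>j<k. \<bar>?y (x k) j - x j\<bar>)"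
      using Suc.prems \<open>d > 0\<close> by (intro Suc.IH yt) (auto simp: not_less_eq_eq)
    \<comment> \<open>Subtracting the linear term leaves a function of \<open>t\<close> whose
      derivative is the small difference \<open>g k (?y t) - g k x\<close>; its increment along the
      segment is then at most \<open>e\<close> times the length.\<close>
    have "norm ((f (?y (y k)) - g k x * y k) - (f (?y (x k)) - g k x * x k)) \<le> e * norm (y k - x k)"
    proof (rule field_differentiable_bound[of ?S "\<lambda>t. f (?y t) - g k x * t" "\<lambda>t. g k (?y t) - g k x"])
      fix t assume t: "t \<in> ?S"
      note nt = near[OF k yt nearS[OF t]]
      have "((\<lambda>t. f (?y t)) has_real_derivative g k (?y t)) (at t)"
        using deriv[OF k, of "?y t"] nt by simp
      from has_field_derivative_at_within[OF this]
      show "((\<lambda>t. f (?y t) - g k x * t) has_real_derivative g k (?y t) - g k x) (at t within ?S)"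
        by (auto intro!: derivative_eq_intros)
      show "norm (g k (?y t) - g k x) \<le> e"
        using conjunct2[OF nt] by (simp add: fun_upd_def)
    qed auto
    then have "\<bar>f y - f (?y (x k)) - g k x * (y k - x k)\<bar> \<le> e * \<bar>y k - x k\<bar>"
      by (simp add: algebra_simps)
    moreover have "(\<Sum>j<k. g j x * (?y (x k) j - x j)) = (\<Sum>j<k. g j x * (y j - x j))"
      "(\<Sum>j<k. \<bar>?y (x k) j - x j\<bar>) = (\<Sum>j<k. \<bar>y j - x j\<bar>)"
      by (auto intro!: sum.cong)
    ultimately show ?case
      using IH by (simp add: distrib_left)
  qed
  show thesis
    using \<open>d > 0\<close> \<open>x \<in> W\<close> openin_subset[OF W]
    by (intro that[of d] step) (auto simp: topspace_Euclidean_space subset_iff)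
qed

text \<open>The difference quotient of \<open>f\<close> along the curve is the linear form in the
  slopes of the coordinates plus an error, and \<open>linear_approximation\<close> bounds the error
  by a small multiple of the sum of the absolute slopes. The hypothesis \<open>ev\<close> keeps the
  curve among the sequences that vanish from \<open>n\<close> on, since the approximation says
  nothing about other elements of the type \<open>pt\<close>.\<close>

lemma has_real_derivative_partials_compose:
  assumes W: "openin (Euclidean_space n) W" and "\<gamma> t\<^sub>0 \<in> W"
    and deriv: "\<And>j y. j < n \<Longrightarrow> y \<in> W \<Longrightarrow> ((\<lambda>t. f (y(j := t))) has_real_derivative g j y) (at (y j))"
    and cont: "\<And>j. j < n \<Longrightarrow> continuous_map (subtopology (Euclidean_space n) W) euclideanreal (g j)"
    and \<gamma>: "\<And>j. j < n \<Longrightarrow> ((\<lambda>t. \<gamma> t j) has_real_derivative c j) (at t\<^sub>0)"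
    and ev: "\<forall>\<^sub>F t in at t\<^sub>0. \<gamma> t \<in> topspace (Euclidean_space n)"
  shows "((\<lambda>t. f (\<gamma> t)) has_real_derivative (\<Sum>j<n. g j (\<gamma> t\<^sub>0) * c j)) (at t\<^sub>0)"
proof -
  define x where "x = \<gamma> t\<^sub>0"
  define slope where "slope j t = (\<gamma> t j - x j) / (t - t\<^sub>0)" for j t
  have slope: "(slope j \<longlongrightarrow> c j) (at t\<^sub>0)" if "j < n" for j
    using \<gamma>[OF that] unfolding has_field_derivative_iff slope_def x_def by simp
  define err where "err t = (f (\<gamma> t) - f x) / (t - t\<^sub>0) - (\<Sum>j<n. g j x * slope j t)" for t
  have "(err \<longlongrightarrow> 0) (at t\<^sub>0)"
  proof (rule tendstoI)
    fix e :: real assume "e > 0"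
    \<comment> \<open>\<open>M\<close> exceeds the limit of the sum of the absolute slopes by 1, so
      it is positive and eventually a strict bound. The approximation is used with tolerance
      \<open>e / M\<close>, and the factor \<open>M\<close> cancels at the end.\<close>
    define M where "M = (\<Sum>j<n. \<bar>c j\<bar>) + 1"
    have "M > 0" unfolding M_def by (smt (verit) abs_ge_zero sum_nonneg)
    have "((\<lambda>t. \<Sum>j<n. \<bar>slope j t\<bar>) \<longlongrightarrow> (\<Sum>j<n. \<bar>c j\<bar>)) (at t\<^sub>0)"
      using slope by (intro tendsto_intros) auto
    then have evM: "\<forall>\<^sub>F t in at t\<^sub>0. (\<Sum>j<n. \<bar>slope j t\<bar>) < M"
      by (rule order_tendstoD) (simp add: M_def)
    obtain d where d: "d > 0" "\<And>y. y \<in> topspace (Euclidean_space n) \<Longrightarrow> (\<forall>j<n. \<bar>y j - x j\<bar> < d) \<Longrightarrow>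
       \<bar>f y - f x - (\<Sum>j<n. g j x * (y j - x j))\<bar> \<le> e / M * (\<Sum>j<n. \<bar>y j - x j\<bar>)"
      using linear_approximation[OF W _ deriv cont, of x "e / M"] assms(2) \<open>e > 0\<close> \<open>M > 0\<close>
      unfolding x_def by auto
    have "\<forall>\<^sub>F t in at t\<^sub>0. \<bar>\<gamma> t j - x j\<bar> < d" if "j < n" for j
    proof -
      have "((\<lambda>t. \<gamma> t j) \<longlongrightarrow> x j) (at t\<^sub>0)"
        using DERIV_isCont[OF \<gamma>[OF that]] by (simp add: isCont_def x_def)
      from tendstoD[OF this d(1)] show ?thesis by (simp add: dist_real_def)
    qed
    then have "\<forall>\<^sub>F t in at t\<^sub>0. \<forall>j\<in>{..<n}. \<bar>\<gamma> t j - x j\<bar> < d"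
      by (intro eventually_ball_finite) auto
    then have "\<forall>\<^sub>F t in at t\<^sub>0. \<forall>j<n. \<bar>\<gamma> t j - x j\<bar> < d"
      by (simp only: lessThan_iff Ball_def)
    with ev evM have "\<forall>\<^sub>F t in at t\<^sub>0. \<gamma> t \<in> topspace (Euclidean_space n) \<and> (\<forall>j<n. \<bar>\<gamma> t j - x j\<bar> < d) \<and>
        (\<Sum>j<n. \<bar>slope j t\<bar>) < M \<and> t \<noteq> t\<^sub>0"
      by (intro eventually_conj) (simp_all add: eventually_at_filter)
    then show "\<forall>\<^sub>F t in at t\<^sub>0. dist (err t) 0 < e"
    proof (rule eventually_mono)
      fix t assume t: "\<gamma> t \<in> topspace (Euclidean_space n) \<and> (\<forall>j<n. \<bar>\<gamma> t j - x j\<bar> < d) \<and>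
        (\<Sum>j<n. \<bar>slope j t\<bar>) < M \<and> t \<noteq> t\<^sub>0"
      have "err t = (f (\<gamma> t) - f x - (\<Sum>j<n. g j x * (\<gamma> t j - x j))) / (t - t\<^sub>0)"
        unfolding err_def slope_def by (simp add: diff_divide_distrib sum_divide_distrib right_diff_distrib)
      then have "\<bar>err t\<bar> = \<bar>f (\<gamma> t) - f x - (\<Sum>j<n. g j x * (\<gamma> t j - x j))\<bar> / \<bar>t - t\<^sub>0\<bar>"
        by (simp only: abs_divide)
      also have "\<dots> \<le> e / M * (\<Sum>j<n. \<bar>\<gamma> t j - x j\<bar>) / \<bar>t - t\<^sub>0\<bar>"
        using d(2)[of "\<gamma> t"] t by (intro divide_right_mono) auto
      also have "\<dots> = e / M * (\<Sum>j<n. \<bar>slope j t\<bar>)"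
        by (simp add: slope_def flip: sum_divide_distrib)
      also have "\<dots> < e / M * M"
        using t \<open>e > 0\<close> \<open>M > 0\<close> by (intro mult_strict_left_mono) auto
      finally show "dist (err t) 0 < e"
        using \<open>M > 0\<close> by simp
    qed
  qed
  then have "((\<lambda>t. err t + (\<Sum>j<n. g j x * slope j t)) \<longlongrightarrow> 0 + (\<Sum>j<n. g j x * c j)) (at t\<^sub>0)"
    using slope by (intro tendsto_intros) auto
  then show ?thesis
    unfolding has_field_derivative_iff err_def x_def by simp
qed

text \<open>A partial derivative looks along a coordinate line. Near the point this line runs inside
  \<open>W\<close>, so information available on \<open>W\<close> alone suffices for
  derivatives.\<close>

lemma eventually_fun_upd_in:
  assumes "openin (Euclidean_space n) W" "x \<in> W" "i < n"
  shows "\<forall>\<^sub>F t in nhds (x i). x(i := t) \<in> W"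
proof -
  obtain d where d: "d > 0" "\<And>y. y \<in> topspace (Euclidean_space n) \<Longrightarrow> (\<forall>j<n. \<bar>y j - x j\<bar> < d) \<Longrightarrow> y \<in> W"
    using assms(1,2) unfolding openin_Euclidean_space_iff by blast
  have "x \<in> topspace (Euclidean_space n)"
    using assms(1,2) openin_subset by blast
  then have "x(i := t) \<in> W" if "dist t (x i) < d" for t
    using that assms(3) d(1) by (intro d(2)) (auto simp: topspace_Euclidean_space dist_real_def)
  then show ?thesis
    unfolding eventually_nhds_metric using d(1) by blast
qed

section \<open>Functions of class \<open>C\<^sup>k\<close>: locality, closure properties and
  composition\<close>

lemma times_diff_continuous_map:
  "times_diff k n W f \<Longrightarrow> continuous_map (subtopology (Euclidean_space n) W) euclideanreal f"
  by (cases k) auto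

lemma times_diff_SucI:
  assumes "continuous_map (subtopology (Euclidean_space n) W) euclideanreal f"
    and "\<And>i x. i < n \<Longrightarrow> x \<in> W \<Longrightarrow> ((\<lambda>t. f (x(i := t))) has_real_derivative g i x) (at (x i))"
    and "\<And>i. i < n \<Longrightarrow> times_diff k n W (g i)"
  shows "times_diff (Suc k) n W f"
  using assms by fastforce

text \<open>The partial derivatives in all directions are chosen at once, so that later inductions
  handle one family \<open>g i\<close> in place of a separate existential for each
  direction.\<close>

lemma times_diff_SucD:
  assumes "times_diff (Suc k) n W f"
  shows "\<exists>g. (\<forall>i<n. \<forall>x\<in>W. ((\<lambda>t. f (x(i := t))) has_real_derivative g i x) (at (x i))) \<and>
    (\<forall>i<n. times_diff k n W (g i))"
  using assms by simp metis

declare times_diff.simps(2) [simp del]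

lemma times_diff_Suc_imp: "times_diff (Suc k) n W f \<Longrightarrow> times_diff k n W f"
proof (induction k arbitrary: f)
  case (Suc k)
  obtain g where "\<And>i x. i < n \<Longrightarrow> x \<in> W \<Longrightarrow> ((\<lambda>t. f (x(i := t))) has_real_derivative g i x) (at (x i))"
    and "\<And>i. i < n \<Longrightarrow> times_diff (Suc k) n W (g i)"
    using times_diff_SucD[OF Suc.prems] by metis
  then show ?case
    using times_diff_continuous_map[OF Suc.prems] Suc.IH
    by (intro times_diff_SucI[where g = g]) blast+
qed (auto dest: times_diff_continuous_map)

lemma times_diff_subset:
  assumes "times_diff k n W f" "W' \<subseteq> W"
  shows "times_diff k n W' f"
  using assms
proof (induction k arbitrary: f)
  case 0
  then show ?case
    using continuous_map_from_subtopology_mono by auto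
next
  case (Suc k)
  obtain g where g: "\<And>i x. i < n \<Longrightarrow> x \<in> W \<Longrightarrow> ((\<lambda>t. f (x(i := t))) has_real_derivative g i x) (at (x i))"
    and "\<And>i. i < n \<Longrightarrow> times_diff k n W (g i)"
    using times_diff_SucD[OF Suc.prems(1)] by metis
  with Suc show ?case
    using continuous_map_from_subtopology_mono[OF times_diff_continuous_map]
    by (intro times_diff_SucI[where g = g]) blast+
qed

lemma has_real_derivative_fun_upd_cong:
  assumes "openin (Euclidean_space n) W" "x \<in> W" "i < n" "\<And>x. x \<in> W \<Longrightarrow> f x = g x"
  shows "((\<lambda>t. f (x(i := t))) has_real_derivative D) (at (x i)) \<longleftrightarrow>
    ((\<lambda>t. g (x(i := t))) has_real_derivative D) (at (x i))"
proof (rule DERIV_cong_ev)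
  show "\<forall>\<^sub>F t in nhds (x i). f (x(i := t)) = g (x(i := t))"
    using eventually_fun_upd_in[OF assms(1-3)] by eventually_elim (rule assms(4))
qed auto

lemma continuous_map_Euclidean_cong:
  assumes "continuous_map (subtopology (Euclidean_space n) W) Y f" "\<And>x. x \<in> W \<Longrightarrow> f x = g x"
  shows "continuous_map (subtopology (Euclidean_space n) W) Y g"
  using continuous_map_eq[OF assms(1)] assms(2) by simp

text \<open>Openness of \<open>W\<close> is what makes this true: the derivative at a point of
  \<open>W\<close> depends on nearby values along a line, and these are taken inside
  \<open>W\<close>. Elsewhere the two functions may differ arbitrarily.\<close>

lemma times_diff_cong:
  assumes "openin (Euclidean_space n) W" "times_diff k n W f" "\<And>x. x \<in> W \<Longrightarrow> f x = g x"
  shows "times_diff k n W g"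
  using assms
proof (induction k arbitrary: f g)
  case 0
  then show ?case
    using continuous_map_Euclidean_cong by (metis times_diff.simps(1))
next
  case (Suc k)
  obtain D where D: "\<And>i x. i < n \<Longrightarrow> x \<in> W \<Longrightarrow> ((\<lambda>t. f (x(i := t))) has_real_derivative D i x) (at (x i))"
    and tD: "\<And>i. i < n \<Longrightarrow> times_diff k n W (D i)"
    using times_diff_SucD[OF Suc.prems(2)] by metis
  show ?case
  proof (rule times_diff_SucI[where g = D])
    show "continuous_map (subtopology (Euclidean_space n) W) euclideanreal g"
      using continuous_map_Euclidean_cong[OF times_diff_continuous_map[OF Suc.prems(2)]] Suc.prems(3) by blast
    fix i x assume ix: "i < n" "x \<in> W"
    show "((\<lambda>t. g (x(i := t))) has_real_derivative D i x) (at (x i))"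
      using has_real_derivative_fun_upd_cong[OF assms(1) ix(2,1), of f g] Suc.prems(3) D[OF ix] by simp
  qed (use tD in auto)
qed

lemma continuous_map_local:
  assumes "\<And>x. x \<in> W \<Longrightarrow> \<exists>V. openin X V \<and> x \<in> V \<and> V \<subseteq> W \<and> continuous_map (subtopology X V) Y f"
  shows "continuous_map (subtopology X W) Y f"
  unfolding continuous_map_def
proof (intro conjI allI impI)
  show "f \<in> topspace (subtopology X W) \<rightarrow> topspace Y"
    using assms by (fastforce simp: continuous_map_def Pi_iff dest: openin_subset)
  fix T assume T: "openin Y T"
  show "openin (subtopology X W) {x \<in> topspace (subtopology X W). f x \<in> T}"
  proof (subst openin_subopen, intro ballI)
    fix x assume x: "x \<in> {x \<in> topspace (subtopology X W). f x \<in> T}"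
    then obtain V where V: "openin X V" "x \<in> V" "V \<subseteq> W" "continuous_map (subtopology X V) Y f"
      using assms by auto
    have "openin (subtopology X V) {x \<in> topspace (subtopology X V). f x \<in> T}"
      by (rule openin_continuous_map_preimage[OF V(4) T])
    then have "openin X {x \<in> topspace (subtopology X V). f x \<in> T}"
      by (simp add: openin_open_subtopology[OF V(1)])
    then have "openin (subtopology X W) {x \<in> topspace (subtopology X V). f x \<in> T}"
      using V(3) unfolding openin_subtopology
      by (intro exI[of _ "{x \<in> topspace (subtopology X V). f x \<in> T}"]) auto
    then show "\<exists>U. openin (subtopology X W) U \<and> x \<in> U \<and> U \<subseteq> {x \<in> topspace (subtopology X W). f x \<in> T}"
      using x V(2,3) by (intro exI[of _ "{x \<in> topspace (subtopology X V). f x \<in> T}"]) auto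
  qed
qed

text \<open>Class \<open>C\<^sup>k\<close> is a local property. The partial derivatives supplied on
  the various neighbourhoods are glued by uniqueness of derivatives.\<close>

lemma times_diff_local:
  assumes "\<And>x. x \<in> W \<Longrightarrow> \<exists>V. openin (Euclidean_space n) V \<and> x \<in> V \<and> V \<subseteq> W \<and> times_diff k n V f"
  shows "times_diff k n W f"
  using assms
proof (induction k arbitrary: f)
  case (0 f)
  show ?case
    unfolding times_diff.simps(1) by (rule continuous_map_local) (rule 0[unfolded times_diff.simps(1)])
next
  case (Suc k)
  have cont: "continuous_map (subtopology (Euclidean_space n) W) euclideanreal f"
  proof (rule continuous_map_local)
    fix x assume "x \<in> W"
    then obtain V where "openin (Euclidean_space n) V" "x \<in> V" "V \<subseteq> W" "times_diff (Suc k) n V f"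
      using Suc.prems by blast
    then show "\<exists>V. openin (Euclidean_space n) V \<and> x \<in> V \<and> V \<subseteq> W \<and>
        continuous_map (subtopology (Euclidean_space n) V) euclideanreal f"
      by (intro exI[of _ V] conjI times_diff_continuous_map[of "Suc k"])
  qed
  \<comment> \<open>A choice of derivative that does not depend on the neighbourhood. On each
    \<open>V\<close> it agrees with the partials obtained there.\<close>
  define D where "D i x = deriv (\<lambda>t. f (x(i := t))) (x i)" for i x
  have D: "(\<forall>i<n. \<forall>y\<in>V. ((\<lambda>t. f (y(i := t))) has_real_derivative D i y) (at (y i))) \<and> (\<forall>i<n. times_diff k n V (D i))"
    if V: "openin (Euclidean_space n) V" "times_diff (Suc k) n V f" for V
  proof -
    obtain g where g: "\<And>i x. i < n \<Longrightarrow> x \<in> V \<Longrightarrow> ((\<lambda>t. f (x(i := t))) has_real_derivative g i x) (at (x i))"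
      and tg: "\<And>i. i < n \<Longrightarrow> times_diff k n V (g i)"
      using times_diff_SucD[OF V(2)] by metis
    have eq: "g i y = D i y" if "i < n" "y \<in> V" for i y
      using g[OF that] by (simp add: D_def DERIV_imp_deriv)
    then have "times_diff k n V (D i)" if "i < n" for i
      using times_diff_cong[OF V(1) tg] that by blast
    with g eq show ?thesis
      by simp
  qed
  show ?case
  proof (rule times_diff_SucI[where g = D])
    show "continuous_map (subtopology (Euclidean_space n) W) euclideanreal f" by fact
    fix i x assume "i < n" "x \<in> W"
    obtain V where "openin (Euclidean_space n) V" "x \<in> V" "times_diff (Suc k) n V f"
      using Suc.prems[OF \<open>x \<in> W\<close>] by blast
    then show "((\<lambda>t. f (x(i := t))) has_real_derivative D i x) (at (x i))"
      using D \<open>i < n\<close> by simp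
  next
    fix i assume "i < n"
    show "times_diff k n W (D i)"
    proof (rule Suc.IH)
      fix x assume "x \<in> W"
      then obtain V where "openin (Euclidean_space n) V" "x \<in> V" "V \<subseteq> W" "times_diff (Suc k) n V f"
        using Suc.prems by blast
      then show "\<exists>V. openin (Euclidean_space n) V \<and> x \<in> V \<and> V \<subseteq> W \<and> times_diff k n V (D i)"
        using D \<open>i < n\<close> by (intro exI[of _ V]) simp
    qed
  qed
qed

lemma times_diff_const: "times_diff k n W (\<lambda>x. c)"
proof (induction k arbitrary: c)
  case (Suc k)
  then show ?case
    by (intro times_diff_SucI[where g = "\<lambda>_ _. 0"]) auto
qed auto

lemma continuous_map_Euclidean_coordinate:
  "continuous_map (subtopology (Euclidean_space n) W) euclideanreal (\<lambda>x. x j)"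
  unfolding Euclidean_space_def
  by (intro continuous_map_from_subtopology continuous_map_product_coordinates) auto

lemma times_diff_coordinate: "times_diff k n W (\<lambda>x. x j)"
proof (cases k)
  case (Suc k')
  have "((\<lambda>t. (x(i := t)) j) has_real_derivative (if i = j then 1 else 0)) (at (x i))" for i and x :: pt
    by (auto intro!: derivative_eq_intros)
  then show ?thesis
    unfolding Suc
    by (intro times_diff_SucI[where g = "\<lambda>i _. if i = j then 1 else 0"] times_diff_const
      continuous_map_Euclidean_coordinate)
qed (simp add: continuous_map_Euclidean_coordinate)

lemma times_diff_add:
  assumes "times_diff k n W f" "times_diff k n W g"
  shows "times_diff k n W (\<lambda>x. f x + g x)"
  using assms
proof (induction k arbitrary: f g)
  case 0
  then show ?case by (auto intro: continuous_map_add)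
next
  case (Suc k)
  obtain f' where f': "\<And>i x. i < n \<Longrightarrow> x \<in> W \<Longrightarrow> ((\<lambda>t. f (x(i := t))) has_real_derivative f' i x) (at (x i))"
    "\<And>i. i < n \<Longrightarrow> times_diff k n W (f' i)"
    using times_diff_SucD[OF Suc.prems(1)] by metis
  obtain g' where g': "\<And>i x. i < n \<Longrightarrow> x \<in> W \<Longrightarrow> ((\<lambda>t. g (x(i := t))) has_real_derivative g' i x) (at (x i))"
    "\<And>i. i < n \<Longrightarrow> times_diff k n W (g' i)"
    using times_diff_SucD[OF Suc.prems(2)] by metis
  have "((\<lambda>t. f (x(i := t)) + g (x(i := t))) has_real_derivative f' i x + g' i x) (at (x i))"
    if "i < n" "x \<in> W" for i x
    by (rule DERIV_add[OF f'(1)[OF that] g'(1)[OF that]])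
  then show ?case
    by (intro times_diff_SucI[where g = "\<lambda>i x. f' i x + g' i x"] Suc.IH f'(2) g'(2)
      continuous_map_add times_diff_continuous_map[OF Suc.prems(1)] times_diff_continuous_map[OF Suc.prems(2)])
qed

lemma times_diff_mult:
  assumes "times_diff k n W f" "times_diff k n W g"
  shows "times_diff k n W (\<lambda>x. f x * g x)"
  using assms
proof (induction k arbitrary: f g)
  case 0
  then show ?case by (auto intro: continuous_map_real_mult)
next
  case (Suc k)
  obtain f' where f': "\<And>i x. i < n \<Longrightarrow> x \<in> W \<Longrightarrow> ((\<lambda>t. f (x(i := t))) has_real_derivative f' i x) (at (x i))"
    "\<And>i. i < n \<Longrightarrow> times_diff k n W (f' i)"
    using times_diff_SucD[OF Suc.prems(1)] by metis
  obtain g' where g': "\<And>i x. i < n \<Longrightarrow> x \<in> W \<Longrightarrow> ((\<lambda>t. g (x(i := t))) has_real_derivative g' i x) (at (x i))"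
    "\<And>i. i < n \<Longrightarrow> times_diff k n W (g' i)"
    using times_diff_SucD[OF Suc.prems(2)] by metis
  have "((\<lambda>t. f (x(i := t)) * g (x(i := t))) has_real_derivative f' i x * g x + g' i x * f x) (at (x i))"
    if "i < n" "x \<in> W" for i x
    using DERIV_mult[OF f'(1)[OF that] g'(1)[OF that]] by simp
  then show ?case
    by (intro times_diff_SucI[where g = "\<lambda>i x. f' i x * g x + g' i x * f x"] times_diff_add Suc.IH f'(2) g'(2)
      Suc.prems[THEN times_diff_Suc_imp] continuous_map_real_mult times_diff_continuous_map[OF Suc.prems(1)]
        times_diff_continuous_map[OF Suc.prems(2)])
qed

lemma times_diff_sum:
  "(\<And>i. i \<in> I \<Longrightarrow> times_diff k n W (f i)) \<Longrightarrow> times_diff k n W (\<lambda>x. \<Sum>i\<in>I. f i x)"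
  by (induction I rule: infinite_finite_induct) (auto intro: times_diff_const times_diff_add)

text \<open>The derivative of \<open>inverse f\<close> contains \<open>inverse f\<close> again, so
  the induction on \<open>k\<close> feeds the claim for \<open>k\<close> into the derivative at
  stage \<open>Suc k\<close>. The exponential is treated in the same way; inverse, exponential and
  logarithm are the ingredients of the diffeomorphism between a box and
  \<open>\<real>\<^sup>n\<close>.\<close>

lemma times_diff_inverse:
  assumes "times_diff k n W f" "\<And>x. x \<in> W \<Longrightarrow> f x \<noteq> 0"
  shows "times_diff k n W (\<lambda>x. inverse (f x))"
  using assms(1)
proof (induction k)
  case 0
  then show ?case
    using assms(2) by (auto intro!: continuous_map_real_inverse)
next
  case (Suc k)
  obtain f' where f': "\<And>i x. i < n \<Longrightarrow> x \<in> W \<Longrightarrow> ((\<lambda>t. f (x(i := t))) has_real_derivative f' i x) (at (x i))"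
    "\<And>i. i < n \<Longrightarrow> times_diff k n W (f' i)"
    using times_diff_SucD[OF Suc.prems(1)] by metis
  have D: "((\<lambda>t. inverse (f (x(i := t)))) has_real_derivative (- 1) * (inverse (f x) * f' i x * inverse (f x))) (at (x i))"
    if "i < n" "x \<in> W" for i x
    using DERIV_inverse'[OF f'(1)[OF that]] assms(2)[OF that(2)] by simp
  have "times_diff k n W (\<lambda>x. inverse (f x))"
    by (rule Suc.IH[OF times_diff_Suc_imp[OF Suc.prems]])
  then show ?case
    by (intro times_diff_SucI[where g = "\<lambda>i x. (- 1) * (inverse (f x) * f' i x * inverse (f x))"]
      times_diff_mult times_diff_const D f'(2) times_diff_continuous_map[of k])
qed

lemma times_diff_exp:
  assumes "times_diff k n W f"
  shows "times_diff k n W (\<lambda>x. exp (f x))"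
  using assms
proof (induction k)
  case 0
  then show ?case
    using continuous_map_compose[of _ euclideanreal f euclideanreal exp]
    by (simp add: o_def continuous_on_exp)
next
  case (Suc k)
  obtain f' where f': "\<And>i x. i < n \<Longrightarrow> x \<in> W \<Longrightarrow> ((\<lambda>t. f (x(i := t))) has_real_derivative f' i x) (at (x i))"
    "\<And>i. i < n \<Longrightarrow> times_diff k n W (f' i)"
    using times_diff_SucD[OF Suc.prems(1)] by metis
  have D: "((\<lambda>t. exp (f (x(i := t)))) has_real_derivative exp (f x) * f' i x) (at (x i))"
    if "i < n" "x \<in> W" for i x
    using DERIV_fun_exp[OF f'(1)[OF that]] by simp
  have "times_diff k n W (\<lambda>x. exp (f x))"
    by (rule Suc.IH[OF times_diff_Suc_imp[OF Suc.prems]])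
  then show ?case
    by (intro times_diff_SucI[where g = "\<lambda>i x. exp (f x) * f' i x"]
      times_diff_mult D f'(2) times_diff_continuous_map[of k])
qed

text \<open>A case split replaces induction here, because the derivative involves only
  \<open>inverse f\<close> and the derivatives of \<open>f\<close>, for which closure is already
  known.\<close>

lemma times_diff_ln:
  assumes "times_diff k n W f" "\<And>x. x \<in> W \<Longrightarrow> f x > 0"
  shows "times_diff k n W (\<lambda>x. ln (f x))"
proof -
  have cont: "continuous_map (subtopology (Euclidean_space n) W) euclideanreal (\<lambda>x. ln (f x))"
  proof -
    have "continuous_map (subtopology (Euclidean_space n) W) (top_of_set {0<..}) f"
      using times_diff_continuous_map[OF assms(1)] assms(2) by (auto simp: continuous_map_in_subtopology)
    moreover have "continuous_map (top_of_set {0<..}) euclideanreal ln"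
      by (auto intro!: continuous_intros)
    ultimately have "continuous_map (subtopology (Euclidean_space n) W) euclideanreal (ln \<circ> f)"
      by (rule continuous_map_compose)
    then show ?thesis by (simp add: o_def)
  qed
  show ?thesis
  proof (cases k)
    case (Suc k')
    obtain f' where f': "\<And>i x. i < n \<Longrightarrow> x \<in> W \<Longrightarrow> ((\<lambda>t. f (x(i := t))) has_real_derivative f' i x) (at (x i))"
      "\<And>i. i < n \<Longrightarrow> times_diff k' n W (f' i)"
      using times_diff_SucD[OF assms(1)[unfolded Suc]] by metis
    have D: "((\<lambda>t. ln (f (x(i := t)))) has_real_derivative inverse (f x) * f' i x) (at (x i))"
      if "i < n" "x \<in> W" for i x
      using DERIV_chain2[OF DERIV_ln, OF _ f'(1)[OF that]] assms(2)[OF that(2)] by simp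
    have "f x \<noteq> 0" if "x \<in> W" for x
      using assms(2)[OF that] by simp
    then show ?thesis
      unfolding Suc using cont times_diff_Suc_imp[OF assms(1)[unfolded Suc]]
      by (intro times_diff_SucI[where g = "\<lambda>i x. inverse (f x) * f' i x"] times_diff_mult D f'(2) times_diff_inverse) auto
  qed (use cont in simp)
qed

lemma continuous_map_Euclidean_components:
  assumes "\<And>j. j < n \<Longrightarrow> continuous_map X euclideanreal (\<lambda>x. F x j)"
    and "F ` topspace X \<subseteq> topspace (Euclidean_space n)"
  shows "continuous_map X (Euclidean_space n) F"
proof (rule continuous_map_eq)
  show "continuous_map X (Euclidean_space n) (\<lambda>x i. if i < n then F x i else 0)"
    using assms(1) continuous_map_componentwise_Euclidean_space[of X n F] by blast
qed (use assms(2) in \<open>fastforce simp: topspace_Euclidean_space fun_eq_iff\<close>)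

text \<open>By the chain rule, the partial in direction \<open>i\<close> is the sum over
  \<open>j\<close> of the \<open>j\<close>-th partial of \<open>f\<close> taken at
  \<open>F x\<close>, times the \<open>i\<close>-th partial of \<open>F j\<close>. The first factors
  are again composites with \<open>F\<close>, now of class \<open>C\<^sup>k\<close> by the induction
  hypothesis; for this reason \<open>f\<close> is generalized in the induction.\<close>

lemma times_diff_compose:
  assumes "openin (Euclidean_space m) V" "openin (Euclidean_space n) W" "F ` V \<subseteq> W"
    and "\<And>j. j < n \<Longrightarrow> times_diff k m V (\<lambda>x. F x j)" and "times_diff k n W f"
  shows "times_diff k m V (\<lambda>x. f (F x))"
  using assms(4,5)
proof (induction k arbitrary: f)
  have cont: "continuous_map (subtopology (Euclidean_space m) V) euclideanreal (\<lambda>x. f (F x))"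
    if "times_diff k n W f" "\<And>j. j < n \<Longrightarrow> times_diff k m V (\<lambda>x. F x j)" for k f
  proof -
    have "continuous_map (subtopology (Euclidean_space m) V) (Euclidean_space n) F"
      using assms(3) openin_subset[OF assms(2)]
      by (intro continuous_map_Euclidean_components times_diff_continuous_map[OF that(2)]) auto
    then have "continuous_map (subtopology (Euclidean_space m) V) (subtopology (Euclidean_space n) W) F"
      unfolding continuous_map_in_subtopology using assms(3) by auto
    from continuous_map_compose[OF this times_diff_continuous_map[OF that(1)]]
    show ?thesis by (simp add: o_def)
  qed
  {
    case 0
    then show ?case
      using cont[of 0] by simp
  next
    case (Suc k)
    obtain f' where f': "\<And>i x. i < n \<Longrightarrow> x \<in> W \<Longrightarrow> ((\<lambda>t. f (x(i := t))) has_real_derivative f' i x) (at (x i))"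
      "\<And>i. i < n \<Longrightarrow> times_diff k n W (f' i)"
      using times_diff_SucD[OF Suc.prems(2)] by metis
    have "\<forall>j<n. \<exists>g. (\<forall>i<m. \<forall>x\<in>V. ((\<lambda>t. F (x(i := t)) j) has_real_derivative g i x) (at (x i))) \<and>
      (\<forall>i<m. times_diff k m V (g i))"
      using times_diff_SucD[OF Suc.prems(1)] by metis
    then obtain F' where F': "\<And>i j x. j < n \<Longrightarrow> i < m \<Longrightarrow> x \<in> V \<Longrightarrow>
        ((\<lambda>t. F (x(i := t)) j) has_real_derivative F' j i x) (at (x i))"
      "\<And>i j. j < n \<Longrightarrow> i < m \<Longrightarrow> times_diff k m V (F' j i)"
      by metis
    have D: "((\<lambda>t. f (F (x(i := t)))) has_real_derivative (\<Sum>j<n. f' j (F x) * F' j i x)) (at (x i))"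
      if "i < m" "x \<in> V" for i x
    proof -
      \<comment> \<open>This is the side condition of the chain rule along the curve which sends
        \<open>t\<close> to \<open>F (x(i := t))\<close>: close to \<open>x i\<close> the argument
        lies in \<open>V\<close>, hence the value in \<open>W\<close>.\<close>
      have "\<forall>\<^sub>F t in at (x i). F (x(i := t)) \<in> topspace (Euclidean_space n)"
        using eventually_fun_upd_in[OF assms(1) that(2,1)] assms(3) openin_subset[OF assms(2)]
        unfolding eventually_nhds_conv_at by (auto elim!: eventually_mono simp del: fun_upd_apply)
      from has_real_derivative_partials_compose[OF assms(2) _ f'(1) times_diff_continuous_map[OF f'(2)] _ this,
        where c = "\<lambda>j. F' j i x"]
      show ?thesis
        using that F'(1) assms(3) by auto
    qed
    show ?case
    proof (rule times_diff_SucI[OF cont[OF Suc.prems(2,1)] D])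
      fix i assume "i < m"
      then show "times_diff k m V (\<lambda>x. \<Sum>j<n. f' j (F x) * F' j i x)"
      proof (intro times_diff_sum times_diff_mult)
        fix j assume "j \<in> {..<n}"
        then show "times_diff k m V (\<lambda>x. f' j (F x))" "times_diff k m V (F' j i)"
          using Suc.IH[OF times_diff_Suc_imp[OF Suc.prems(1)] f'(2)] F'(2) \<open>i < m\<close> by simp_all
      qed
    qed auto
  }
qed

section \<open>Smooth manifolds\<close>

lemma smooth_euclidean_cong:
  assumes "smooth_euclidean m W n F" "\<And>x. x \<in> W \<Longrightarrow> F x = G x"
  shows "smooth_euclidean m W n G"
proof -
  have "times_diff k m W (\<lambda>x. G x j)" if "j < n" for k j
    using assms that times_diff_cong[of m W k "\<lambda>x. F x j" "\<lambda>x. G x j"] by (simp add: smooth_euclidean_def)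
  moreover have "G ` W = F ` W"
    using assms(2) by (intro image_cong) auto
  ultimately show ?thesis
    using assms(1) by (simp add: smooth_euclidean_def)
qed

lemma smooth_euclidean_subset:
  assumes "smooth_euclidean m W n F" "openin (Euclidean_space m) V" "V \<subseteq> W"
  shows "smooth_euclidean m V n F"
  using assms times_diff_subset[OF _ assms(3)] image_mono[OF assms(3), of F]
  unfolding smooth_euclidean_def by (meson subset_trans)

lemma smooth_euclidean_local:
  assumes "\<And>x. x \<in> W \<Longrightarrow> \<exists>V. x \<in> V \<and> V \<subseteq> W \<and> smooth_euclidean m V n F"
  shows "smooth_euclidean m W n F"
  unfolding smooth_euclidean_def
proof (intro conjI allI impI)
  show "openin (Euclidean_space m) W"
  proof (subst openin_subopen, intro ballI)
    fix x assume "x \<in> W"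
    from assms[OF this] obtain V where "x \<in> V" "V \<subseteq> W" "smooth_euclidean m V n F" by blast
    then show "\<exists>T. openin (Euclidean_space m) T \<and> x \<in> T \<and> T \<subseteq> W"
      by (auto simp: smooth_euclidean_def)
  qed
  show "F ` W \<subseteq> topspace (Euclidean_space n)"
    using assms by (fastforce simp: smooth_euclidean_def)
  fix j k assume "j < n"
  show "times_diff k m W (\<lambda>x. F x j)"
  proof (rule times_diff_local)
    fix x assume "x \<in> W"
    from assms[OF this] obtain V where "x \<in> V" "V \<subseteq> W" "smooth_euclidean m V n F" by blast
    then show "\<exists>V. openin (Euclidean_space m) V \<and> x \<in> V \<and> V \<subseteq> W \<and> times_diff k m V (\<lambda>x. F x j)"
      using \<open>j < n\<close> by (auto simp: smooth_euclidean_def)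
  qed
qed

lemma smooth_euclidean_compose:
  assumes "smooth_euclidean m V n F" "smooth_euclidean n W p G" "F ` V \<subseteq> W"
  shows "smooth_euclidean m V p (G \<circ> F)"
proof -
  have "times_diff k m V (\<lambda>x. G (F x) j)" if "j < p" for k j
    using assms that times_diff_compose[of m V n W F k "\<lambda>y. G y j"] by (auto simp: smooth_euclidean_def)
  moreover have "(G \<circ> F) ` V \<subseteq> topspace (Euclidean_space p)"
    using assms unfolding smooth_euclidean_def image_comp[symmetric] by blast
  ultimately show ?thesis
    using assms(1) by (simp add: smooth_euclidean_def)
qed

lemma smooth_euclidean_openin_preimage:
  assumes "smooth_euclidean m W n F" "openin (Euclidean_space n) T"
  shows "openin (Euclidean_space m) {x \<in> W. F x \<in> T}"
proof -
  have W: "openin (Euclidean_space m) W"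
    using assms(1) by (simp add: smooth_euclidean_def)
  then have top: "topspace (subtopology (Euclidean_space m) W) = W"
    by (simp add: openin_subset inf.absorb2)
  have "continuous_map (subtopology (Euclidean_space m) W) (Euclidean_space n) F"
    using assms(1) unfolding smooth_euclidean_def
    by (intro continuous_map_Euclidean_components) (auto simp: top intro: times_diff_continuous_map)
  from openin_continuous_map_preimage[OF this assms(2)]
  have "openin (subtopology (Euclidean_space m) W) {x \<in> W. F x \<in> T}"
    unfolding top .
  then show ?thesis
    by (simp add: openin_open_subtopology[OF W])
qed

lemma smooth_euclidean_id:
  "openin (Euclidean_space n) W \<Longrightarrow> smooth_euclidean n W n (\<lambda>x. x)"
  unfolding smooth_euclidean_def using openin_subset times_diff_coordinate by auto

section \<open>Charts, the manifold topology and open submanifolds\<close>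

lemma fst_atlasI: "(D, \<phi>) \<in> atlas M \<Longrightarrow> D \<in> fst ` atlas M"
  by (rule image_eqI[where x = "(D, \<phi>)"]) auto

lemma smooth_manifoldD:
  assumes "smooth_manifold M"
  shows "(D, \<phi>) \<in> atlas M \<Longrightarrow> D \<subseteq> points M"
    and "(D, \<phi>) \<in> atlas M \<Longrightarrow> \<phi> \<in> extensional D"
    and "(D, \<phi>) \<in> atlas M \<Longrightarrow> inj_on \<phi> D"
    and "(D, \<phi>) \<in> atlas M \<Longrightarrow> openin (Euclidean_space (mdim M)) (\<phi> ` D)"
    and "x \<in> points M \<Longrightarrow> \<exists>D \<phi>. (D, \<phi>) \<in> atlas M \<and> x \<in> D"
    and "(D, \<phi>) \<in> atlas M \<Longrightarrow> (E, \<psi>) \<in> atlas M \<Longrightarrow>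
      smooth_euclidean (mdim M) (\<phi> ` (D \<inter> E)) (mdim M) (\<psi> \<circ> inv_into D \<phi>)"
    and "topspace (mtop M) = points M"
    and "(D, \<phi>) \<in> atlas M \<Longrightarrow> openin (mtop M) D"
proof -
  have 1: "is_chart (points M) (mdim M) c" if "c \<in> atlas M" for c
    using assms that unfolding smooth_manifold_def by blast
  show "(D, \<phi>) \<in> atlas M \<Longrightarrow> D \<subseteq> points M" "(D, \<phi>) \<in> atlas M \<Longrightarrow> \<phi> \<in> extensional D"
    "(D, \<phi>) \<in> atlas M \<Longrightarrow> inj_on \<phi> D" "(D, \<phi>) \<in> atlas M \<Longrightarrow> openin (Euclidean_space (mdim M)) (\<phi> ` D)"
    using 1[of "(D, \<phi>)"] by (auto simp: is_chart_def)
  have 2: "\<Union> (fst ` atlas M) = points M"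
    using assms unfolding smooth_manifold_def by blast
  then show "x \<in> points M \<Longrightarrow> \<exists>D \<phi>. (D, \<phi>) \<in> atlas M \<and> x \<in> D"
    by (metis UN_E prod.collapse)
  show "topspace (mtop M) = points M"
    by (simp add: mtop_def 2)
  show "(D, \<phi>) \<in> atlas M \<Longrightarrow> openin (mtop M) D"
    unfolding mtop_def by (intro topology_generated_by_Basis fst_atlasI)
  have 3: "compatible (mdim M) c c'" if "c \<in> atlas M" "c' \<in> atlas M" for c c'
    using assms that unfolding smooth_manifold_def by blast
  show "(D, \<phi>) \<in> atlas M \<Longrightarrow> (E, \<psi>) \<in> atlas M \<Longrightarrow>
      smooth_euclidean (mdim M) (\<phi> ` (D \<inter> E)) (mdim M) (\<psi> \<circ> inv_into D \<phi>)"
    using 3[of "(D, \<phi>)" "(E, \<psi>)"] by (simp add: compatible_def)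
qed

text \<open>Induction over the generation of the topology by chart domains. Injectivity of the chart
  lets images commute with intersections, and for a chart domain the claim is the openness contained
  in compatibility.\<close>

lemma chart_image_openin:
  assumes M: "smooth_manifold M" and D: "(D, \<phi>) \<in> atlas M" and "openin (mtop M) V"
  shows "openin (Euclidean_space (mdim M)) (\<phi> ` (D \<inter> V))"
proof -
  have "generate_topology_on (fst ` atlas M) V"
    using assms(3) unfolding mtop_def by (rule openin_topology_generated_by)
  then show ?thesis
  proof induction
    case (Int a b)
    have "\<phi> ` (D \<inter> (a \<inter> b)) = \<phi> ` (D \<inter> a) \<inter> \<phi> ` (D \<inter> b)"
      using inj_on_image_Int[OF smooth_manifoldD(3)[OF M D], of "D \<inter> a" "D \<inter> b"]
      by (simp add: Int_ac)
    with Int show ?case by auto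
  next
    case (UN K)
    have "\<phi> ` (D \<inter> \<Union>K) = (\<Union>k\<in>K. \<phi> ` (D \<inter> k))" by auto
    with UN show ?case by auto
  next
    case (Basis s)
    then obtain \<psi> where "(s, \<psi>) \<in> atlas M" by auto
    from smooth_manifoldD(6)[OF M D this] show ?case
      by (simp add: smooth_euclidean_def)
  qed auto
qed

lemma inv_into_restrict_subset:
  assumes "inj_on f A" "B \<subseteq> A" "y \<in> f ` B"
  shows "inv_into B (restrict f B) y = inv_into A f y"
  using assms by (smt (verit) f_inv_into_f image_iff inj_on_def inv_into_into restrict_apply' subset_iff image_restrict_eq)

text \<open>Maximality of the atlas: the restricted chart is compatible with every chart of the
  atlas and hence belongs to it. The function is cut down by \<open>restrict\<close> because charts
  are extensional on their domains.\<close>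

lemma chart_restrict:
  assumes M: "smooth_manifold M" and D: "(D, \<phi>) \<in> atlas M" and V: "openin (mtop M) V"
  shows "(D \<inter> V, restrict \<phi> (D \<inter> V)) \<in> atlas M"
proof -
  note inj = smooth_manifoldD(3)[OF M D]
  let ?\<phi> = "restrict \<phi> (D \<inter> V)"
  have chart: "is_chart (points M) (mdim M) (D \<inter> V, ?\<phi>)"
    using smooth_manifoldD(1)[OF M D] inj chart_image_openin[OF M D V]
    by (auto simp: is_chart_def inj_on_def)
  have "compatible (mdim M) (D \<inter> V, ?\<phi>) c'" if c': "c' \<in> atlas M" for c'
  proof -
    obtain E \<psi> where c'_eq: "c' = (E, \<psi>)" by (cases c')
    note E = c'[unfolded c'_eq]
    have open_DE: "openin (mtop M) (E \<inter> V)" "openin (mtop M) (D \<inter> V)"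
      using smooth_manifoldD(8)[OF M D] smooth_manifoldD(8)[OF M E] V by auto
    have "smooth_euclidean (mdim M) (\<phi> ` (D \<inter> (E \<inter> V))) (mdim M) (\<psi> \<circ> inv_into D \<phi>)"
      by (rule smooth_euclidean_subset[OF smooth_manifoldD(6)[OF M D E] chart_image_openin[OF M D open_DE(1)]]) auto
    then have "smooth_euclidean (mdim M) (\<phi> ` (D \<inter> (E \<inter> V))) (mdim M) (\<psi> \<circ> inv_into (D \<inter> V) ?\<phi>)"
      by (rule smooth_euclidean_cong)
        (subst o_apply, subst o_apply, subst inv_into_restrict_subset[OF inj], auto)
    moreover have "?\<phi> ` (D \<inter> V \<inter> E) = \<phi> ` (D \<inter> (E \<inter> V))"
      by (auto intro!: image_cong)
    moreover have "smooth_euclidean (mdim M) (\<psi> ` (E \<inter> (D \<inter> V))) (mdim M) (\<phi> \<circ> inv_into E \<psi>)"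
      by (rule smooth_euclidean_subset[OF smooth_manifoldD(6)[OF M E D] chart_image_openin[OF M E open_DE(2)]]) auto
    then have "smooth_euclidean (mdim M) (\<psi> ` (E \<inter> (D \<inter> V))) (mdim M) (?\<phi> \<circ> inv_into E \<psi>)"
      by (rule smooth_euclidean_cong) (auto simp: inv_into_f_f[OF smooth_manifoldD(3)[OF M E]])
    ultimately show ?thesis
      by (simp add: compatible_def c'_eq Int_commute)
  qed
  with chart M show ?thesis
    unfolding smooth_manifold_def by blast
qed

lemma open_submanifold_simps [simp]:
  "points (open_submanifold M V) = V"
  "mdim (open_submanifold M V) = mdim M"
  "(D, \<phi>) \<in> atlas (open_submanifold M V) \<longleftrightarrow> (D, \<phi>) \<in> atlas M \<and> D \<subseteq> V"
  by (auto simp: open_submanifold_def)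

lemma open_submanifold_twice:
  "W \<subseteq> V \<Longrightarrow> open_submanifold (open_submanifold M V) W = open_submanifold M W"
  by (auto simp: open_submanifold_def)

lemma open_submanifold_points:
  "smooth_manifold M \<Longrightarrow> open_submanifold M (points M) = M"
  using smooth_manifoldD(1)[of M] by (intro manifold.equality) (auto simp: open_submanifold_def)

text \<open>The atlas of the submanifold keeps only the charts whose domain lies inside
  \<open>V\<close>. These still generate every open subset of \<open>V\<close>, because a chart
  around a point can be shrunk to any open set containing the point.\<close>

lemma mtop_open_submanifold:
  assumes M: "smooth_manifold M" and V: "openin (mtop M) V"
  shows "mtop (open_submanifold M V) = subtopology (mtop M) V"
  unfolding topology_eq openin_open_subtopology[OF V]
proof (intro allI iffI)
  fix S assume "openin (mtop (open_submanifold M V)) S"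
  then have "generate_topology_on (fst ` atlas (open_submanifold M V)) S"
    unfolding mtop_def by (rule openin_topology_generated_by)
  then show "openin (mtop M) S \<and> S \<subseteq> V"
    by induction (auto dest: smooth_manifoldD(8)[OF M])
next
  fix S assume S: "openin (mtop M) S \<and> S \<subseteq> V"
  show "openin (mtop (open_submanifold M V)) S"
  proof (subst openin_subopen, intro ballI)
    fix x assume "x \<in> S"
    then have "x \<in> points M"
      using S openin_subset smooth_manifoldD(7)[OF M] by blast
    then obtain D \<phi> where D: "(D, \<phi>) \<in> atlas M" "x \<in> D"
      using smooth_manifoldD(5)[OF M] by blast
    have "(D \<inter> S, restrict \<phi> (D \<inter> S)) \<in> atlas (open_submanifold M V)"
      using chart_restrict[OF M D(1)] S by auto
    then have "openin (mtop (open_submanifold M V)) (D \<inter> S)"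
      unfolding mtop_def by (intro topology_generated_by_Basis fst_atlasI)
    then show "\<exists>T. openin (mtop (open_submanifold M V)) T \<and> x \<in> T \<and> T \<subseteq> S"
      using D(2) \<open>x \<in> S\<close> by blast
  qed
qed

lemma smooth_manifold_open_submanifold:
  assumes M: "smooth_manifold M" and V: "openin (mtop M) V"
  shows "smooth_manifold (open_submanifold M V)"
  unfolding smooth_manifold_def
proof (intro conjI ballI allI impI)
  let ?S = "open_submanifold M V"
  show "is_chart (points ?S) (mdim ?S) c" if "c \<in> atlas ?S" for c
    using that smooth_manifoldD(2,3,4)[OF M] by (cases c) (auto simp: is_chart_def)
  show "\<Union> (fst ` atlas ?S) = points ?S"
  proof
    show "points ?S \<subseteq> \<Union> (fst ` atlas ?S)"
    proof
      fix x assume x: "x \<in> points ?S"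
      then have "x \<in> points M"
        using openin_subset[OF V] smooth_manifoldD(7)[OF M] by auto
      then obtain D \<phi> where D: "(D, \<phi>) \<in> atlas M" "x \<in> D"
        using smooth_manifoldD(5)[OF M] by blast
      have "(D \<inter> V, restrict \<phi> (D \<inter> V)) \<in> atlas ?S"
        using chart_restrict[OF M D(1) V] by auto
      from UnionI[OF fst_atlasI[OF this], of x] show "x \<in> \<Union> (fst ` atlas ?S)"
        using D(2) x by simp
    qed
  qed auto
  show "compatible (mdim ?S) c c'" if "c \<in> atlas ?S" "c' \<in> atlas ?S" for c c'
    using that M unfolding smooth_manifold_def by (cases c, cases c') simp
  show "Hausdorff_space (mtop ?S)"
    using M by (simp add: smooth_manifold_def mtop_open_submanifold[OF M V] Hausdorff_space_subtopology)
  show "second_countable (mtop ?S)"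
    using M by (simp add: smooth_manifold_def mtop_open_submanifold[OF M V] second_countable_subtopology)
  \<comment> \<open>Maximality of the smaller atlas is inherited. A candidate chart is known to be
    compatible only with charts inside \<open>V\<close>; since its own domain lies in
    \<open>V\<close>, its overlap with any chart of \<open>M\<close> is unchanged when that chart is
    cut down to \<open>V\<close>.\<close>
  show "c \<in> atlas ?S" if c: "is_chart (points ?S) (mdim ?S) c" and compat: "\<forall>c'\<in>atlas ?S. compatible (mdim ?S) c c'" for c
  proof -
    obtain D \<phi> where c_eq: "c = (D, \<phi>)" by (cases c)
    have "D \<subseteq> V" and injD: "inj_on \<phi> D" using c by (auto simp: c_eq is_chart_def)
    have "is_chart (points M) (mdim M) c"
      using c \<open>D \<subseteq> V\<close> openin_subset[OF V] smooth_manifoldD(7)[OF M] by (auto simp: c_eq is_chart_def)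
    moreover have "compatible (mdim M) c c'" if c': "c' \<in> atlas M" for c'
    proof -
      obtain E \<psi> where c'_eq: "c' = (E, \<psi>)" by (cases c')
      note E = c'[unfolded c'_eq]
      note inj = smooth_manifoldD(3)[OF M E]
      let ?\<psi> = "restrict \<psi> (E \<inter> V)"
      have mem: "(E \<inter> V, ?\<psi>) \<in> atlas ?S"
        using chart_restrict[OF M E V] by auto
      have DEV: "D \<inter> (E \<inter> V) = D \<inter> E" using \<open>D \<subseteq> V\<close> by blast
      have im: "?\<psi> ` (D \<inter> E) = \<psi> ` (D \<inter> E)"
        using \<open>D \<subseteq> V\<close> by (intro image_cong) auto
      have "smooth_euclidean (mdim M) (\<phi> ` (D \<inter> E)) (mdim M) (?\<psi> \<circ> inv_into D \<phi>)"
        "smooth_euclidean (mdim M) (\<psi> ` (D \<inter> E)) (mdim M) (\<phi> \<circ> inv_into (E \<inter> V) ?\<psi>)"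
        using bspec[OF compat mem] unfolding compatible_def c_eq case_prod_conv open_submanifold_simps DEV im by blast+
      moreover have "(?\<psi> \<circ> inv_into D \<phi>) y = (\<psi> \<circ> inv_into D \<phi>) y" if "y \<in> \<phi> ` (D \<inter> E)" for y
        using that \<open>D \<subseteq> V\<close> by (auto simp: inv_into_f_f[OF injD])
      moreover have "(\<phi> \<circ> inv_into (E \<inter> V) ?\<psi>) y = (\<phi> \<circ> inv_into E \<psi>) y" if "y \<in> \<psi> ` (D \<inter> E)" for y
      proof -
        have "y \<in> \<psi> ` (E \<inter> V)" using that \<open>D \<subseteq> V\<close> by blast
        then show ?thesis using inv_into_restrict_subset[OF inj, of "E \<inter> V" y] by simp
      qed
      ultimately have "smooth_euclidean (mdim M) (\<phi> ` (D \<inter> E)) (mdim M) (\<psi> \<circ> inv_into D \<phi>)"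
        "smooth_euclidean (mdim M) (\<psi> ` (D \<inter> E)) (mdim M) (\<phi> \<circ> inv_into E \<psi>)"
        by (blast intro: smooth_euclidean_cong)+
      then show ?thesis
        by (simp add: compatible_def c_eq c'_eq)
    qed
    ultimately have "c \<in> atlas M"
      using M unfolding smooth_manifold_def by blast
    then show ?thesis
      using \<open>D \<subseteq> V\<close> by (simp add: c_eq)
  qed
qed

section \<open>Smooth maps between manifolds\<close>

lemma smooth_mapsD:
  assumes "f \<in> smooth_maps M N"
  shows "f \<in> points M \<rightarrow>\<^sub>E points N" "continuous_map (mtop M) (mtop N) f"
    "(D, \<phi>) \<in> atlas M \<Longrightarrow> (E, \<psi>) \<in> atlas N \<Longrightarrow>
        smooth_euclidean (mdim M) (\<phi> ` {x \<in> D. f x \<in> E}) (mdim N) (\<psi> \<circ> f \<circ> inv_into D \<phi>)"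
  using assms by (auto simp: smooth_maps_def)

lemma smooth_mapsI:
  assumes "f \<in> points M \<rightarrow>\<^sub>E points N" "continuous_map (mtop M) (mtop N) f"
    "\<And>D \<phi> E \<psi>. (D, \<phi>) \<in> atlas M \<Longrightarrow> (E, \<psi>) \<in> atlas N \<Longrightarrow>
        smooth_euclidean (mdim M) (\<phi> ` {x \<in> D. f x \<in> E}) (mdim N) (\<psi> \<circ> f \<circ> inv_into D \<phi>)"
  shows "f \<in> smooth_maps M N"
  using assms unfolding smooth_maps_def by blast

text \<open>Being smooth in charts is local on the source, so near a given point an intermediate
  chart around its image in \<open>N\<close> may be inserted. The composite in charts is then a
  composite of two smooth maps of Euclidean open sets.\<close>

lemma smooth_maps_compose:
  assumes M: "smooth_manifold M" and N: "smooth_manifold N"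
    and f: "f \<in> smooth_maps M N" and g: "g \<in> smooth_maps N P"
  shows "compose (points M) g f \<in> smooth_maps M P"
proof -
  let ?h = "compose (points M) g f"
  note fD = smooth_mapsD[OF f] and gD = smooth_mapsD[OF g]
  have "smooth_euclidean (mdim M) (\<phi> ` {x \<in> D. ?h x \<in> G}) (mdim P) (\<psi> \<circ> ?h \<circ> inv_into D \<phi>)"
    if D: "(D, \<phi>) \<in> atlas M" and G: "(G, \<psi>) \<in> atlas P" for D \<phi> G \<psi>
  proof (rule smooth_euclidean_local)
    note DM = smooth_manifoldD(1)[OF M D] and injD = smooth_manifoldD(3)[OF M D]
    fix y assume "y \<in> \<phi> ` {x \<in> D. ?h x \<in> G}"
    then obtain x where x: "x \<in> D" "g (f x) \<in> G" "y = \<phi> x"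
      using DM by (auto simp: compose_def)
    have "f x \<in> points N" using fD(1) x(1) DM by auto
    then obtain E \<theta> where E: "(E, \<theta>) \<in> atlas N" and fx: "f x \<in> E"
      using smooth_manifoldD(5)[OF N] by blast
    note injE = smooth_manifoldD(3)[OF N E]
    let ?F = "\<theta> \<circ> f \<circ> inv_into D \<phi>" and ?G = "\<psi> \<circ> g \<circ> inv_into E \<theta>"
    let ?T = "\<theta> ` {z \<in> E. g z \<in> G}"
    \<comment> \<open>The set on which the two chart expressions can be composed: \<open>?F\<close>
      is defined there and lands in the domain \<open>?T\<close> of \<open>?G\<close>. It is open as
      a preimage under \<open>?F\<close>.\<close>
    define V where "V = {y \<in> \<phi> ` {x \<in> D. f x \<in> E}. ?F y \<in> ?T}"
    note sF = fD(3)[OF D E] and sG = gD(3)[OF E G]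
    have "openin (Euclidean_space (mdim M)) V"
      unfolding V_def using sG by (intro smooth_euclidean_openin_preimage[OF sF]) (simp add: smooth_euclidean_def)
    then have "smooth_euclidean (mdim M) V (mdim N) ?F"
      by (rule smooth_euclidean_subset[OF sF]) (auto simp: V_def)
    then have "smooth_euclidean (mdim M) V (mdim P) (?G \<circ> ?F)"
      by (rule smooth_euclidean_compose[OF _ sG]) (auto simp: V_def)
    moreover have V: "\<exists>x\<in>D. y = \<phi> x \<and> f x \<in> E \<and> g (f x) \<in> G" if "y \<in> V" for y
      using that injE by (fastforce simp: V_def inv_into_f_f[OF injD] inj_on_def)
    ultimately have "smooth_euclidean (mdim M) V (mdim P) (\<psi> \<circ> ?h \<circ> inv_into D \<phi>)"
      using DM by (elim smooth_euclidean_cong)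
        (auto dest!: V simp: inv_into_f_f[OF injD] inv_into_f_f[OF injE] compose_def)
    moreover have "y \<in> V"
      using x fx by (auto simp: V_def inv_into_f_f[OF injD])
    moreover have "V \<subseteq> \<phi> ` {x \<in> D. ?h x \<in> G}"
      using DM by (force dest!: V simp: compose_def)
    ultimately show "\<exists>V. y \<in> V \<and> V \<subseteq> \<phi> ` {x \<in> D. ?h x \<in> G} \<and> smooth_euclidean (mdim M) V (mdim P) (\<psi> \<circ> ?h \<circ> inv_into D \<phi>)"
      by blast
  qed
  moreover have "continuous_map (mtop M) (mtop P) ?h"
    using continuous_map_eq[OF continuous_map_compose[OF fD(2) gD(2)], of ?h]
    by (simp add: smooth_manifoldD(7)[OF M] compose_def)
  moreover have "?h \<in> points M \<rightarrow>\<^sub>E points P"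
    using fD(1) gD(1) by (auto simp: compose_def)
  ultimately show ?thesis
    by (intro smooth_mapsI) auto
qed

lemma smooth_maps_restrict:
  assumes M: "smooth_manifold M" and V: "openin (mtop M) V"
    and N: "smooth_manifold N" and W: "openin (mtop N) W"
    and f: "f \<in> smooth_maps M N" and "f ` V \<subseteq> W"
  shows "restrict f V \<in> smooth_maps (open_submanifold M V) (open_submanifold N W)"
proof -
  note fD = smooth_mapsD[OF f]
  have VM: "V \<subseteq> points M"
    using openin_subset[OF V] smooth_manifoldD(7)[OF M] by blast
  have "continuous_map (subtopology (mtop M) V) (subtopology (mtop N) W) f"
    unfolding continuous_map_in_subtopology using assms(6) continuous_map_from_subtopology[OF fD(2)] by auto
  then have "continuous_map (subtopology (mtop M) V) (subtopology (mtop N) W) (restrict f V)"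
    by (rule continuous_map_eq) simp
  moreover have "smooth_euclidean (mdim M) (\<phi> ` {x \<in> D. restrict f V x \<in> E}) (mdim N) (\<psi> \<circ> restrict f V \<circ> inv_into D \<phi>)"
    if D: "(D, \<phi>) \<in> atlas M" "D \<subseteq> V" and E: "(E, \<psi>) \<in> atlas N" for D \<phi> E \<psi>
  proof -
    have "{x \<in> D. restrict f V x \<in> E} = {x \<in> D. f x \<in> E}"
      using D(2) by auto
    moreover have "smooth_euclidean (mdim M) (\<phi> ` {x \<in> D. f x \<in> E}) (mdim N) (\<psi> \<circ> restrict f V \<circ> inv_into D \<phi>)"
      using D(2) by (intro smooth_euclidean_cong[OF fD(3)[OF D(1) E]])
        (auto simp: inv_into_f_f[OF smooth_manifoldD(3)[OF M D(1)]])
    ultimately show ?thesis by simp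
  qed
  ultimately show ?thesis
    using assms(6) unfolding mtop_open_submanifold[OF M V, symmetric] mtop_open_submanifold[OF N W, symmetric]
    by (intro smooth_mapsI) (simp_all only: open_submanifold_simps, auto)
qed

lemma smooth_maps_id:
  assumes M: "smooth_manifold M"
  shows "(\<lambda>x\<in>points M. x) \<in> smooth_maps M M"
proof -
  let ?i = "\<lambda>x\<in>points M. x"
  have "continuous_map (mtop M) (mtop M) ?i"
    by (rule continuous_map_eq[OF continuous_map_id[unfolded id_def]]) (simp add: smooth_manifoldD(7)[OF M])
  moreover have "smooth_euclidean (mdim M) (\<phi> ` {x \<in> D. ?i x \<in> E}) (mdim M) (\<psi> \<circ> ?i \<circ> inv_into D \<phi>)"
    if D: "(D, \<phi>) \<in> atlas M" and E: "(E, \<psi>) \<in> atlas M" for D \<phi> E \<psi>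
  proof -
    note DM = smooth_manifoldD(1)[OF M D]
    have "{x \<in> D. ?i x \<in> E} = D \<inter> E"
      using DM by auto
    moreover have "smooth_euclidean (mdim M) (\<phi> ` (D \<inter> E)) (mdim M) (\<psi> \<circ> ?i \<circ> inv_into D \<phi>)"
      using DM by (intro smooth_euclidean_cong[OF smooth_manifoldD(6)[OF M D E]])
        (auto simp: inv_into_f_f[OF smooth_manifoldD(3)[OF M D]])
    ultimately show ?thesis by simp
  qed
  ultimately show ?thesis
    by (intro smooth_mapsI) auto
qed

section \<open>The standard manifold \<open>\<real>\<^sup>n\<close> and criteria for being
  cartesian\<close>

lemma identity_chart:
  assumes "openin (Euclidean_space n) W"
  shows "(W, \<lambda>x\<in>W. x) \<in> atlas (euclid n)"
proof -
  let ?i = "\<lambda>x\<in>W. x"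
  have inj: "inj_on ?i W" and im: "?i ` W = W"
    by (auto simp: inj_on_def)
  have "inv_into W ?i x = x" if "x \<in> W" for x
    using inv_into_f_f[OF inj that] that by simp
  then have "smooth_euclidean n W n (inv_into W ?i)"
    using smooth_euclidean_cong[OF smooth_euclidean_id[OF assms], of "inv_into W ?i"] by simp
  moreover have "smooth_euclidean n W n ?i"
    using smooth_euclidean_cong[OF smooth_euclidean_id[OF assms], of ?i] by simp
  ultimately show ?thesis
    using inj im assms openin_subset[OF assms] by (simp add: euclid_def is_chart_def)
qed

lemma euclid_simps [simp]: "points (euclid n) = topspace (Euclidean_space n)" "mdim (euclid n) = n"
  by (auto simp: euclid_def)

lemma atlas_euclidD:
  assumes "(D, \<phi>) \<in> atlas (euclid n)"
  shows "is_chart (topspace (Euclidean_space n)) n (D, \<phi>)" "inj_on \<phi> D"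
    "smooth_euclidean n D n \<phi>" "smooth_euclidean n (\<phi> ` D) n (inv_into D \<phi>)"
    "openin (Euclidean_space n) D"
  using assms by (auto simp: euclid_def is_chart_def smooth_euclidean_def)

text \<open>Chart domains are open because the charts are smooth on them, and conversely the
  identity on any open set is a chart.\<close>

lemma mtop_euclid: "mtop (euclid n) = Euclidean_space n"
  unfolding topology_eq
proof (intro allI iffI)
  fix S assume "openin (mtop (euclid n)) S"
  then have "generate_topology_on (fst ` atlas (euclid n)) S"
    unfolding mtop_def by (rule openin_topology_generated_by)
  then show "openin (Euclidean_space n) S"
    by induction (auto dest: atlas_euclidD(5))
next
  fix S assume "openin (Euclidean_space n) S"
  then show "openin (mtop (euclid n)) S"
    unfolding mtop_def by (intro topology_generated_by_Basis fst_atlasI[OF identity_chart])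
qed

lemma compatible_euclid:
  assumes D: "(D, \<phi>) \<in> atlas (euclid n)" and E: "(E, \<psi>) \<in> atlas (euclid n)"
  shows "smooth_euclidean n (\<phi> ` (D \<inter> E)) n (\<psi> \<circ> inv_into D \<phi>)"
proof (rule smooth_euclidean_compose[OF _ atlas_euclidD(3)[OF E]])
  have eq: "\<phi> ` (D \<inter> E) = {x \<in> \<phi> ` D. inv_into D \<phi> x \<in> E}"
    by (auto simp: inv_into_f_f[OF atlas_euclidD(2)[OF D]])
  show "smooth_euclidean n (\<phi> ` (D \<inter> E)) n (inv_into D \<phi>)"
    unfolding eq
    by (rule smooth_euclidean_subset[OF atlas_euclidD(4)[OF D]
          smooth_euclidean_openin_preimage[OF atlas_euclidD(4)[OF D] atlas_euclidD(5)[OF E]]]) auto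
  show "inv_into D \<phi> ` \<phi> ` (D \<inter> E) \<subseteq> E"
    by (auto simp: inv_into_f_f[OF atlas_euclidD(2)[OF D]])
qed

lemma smooth_manifold_euclid: "smooth_manifold (euclid n)"
  unfolding smooth_manifold_def
proof (intro conjI ballI allI impI)
  let ?T = "topspace (Euclidean_space n)"
  have i: "(?T, \<lambda>x\<in>?T. x) \<in> atlas (euclid n)"
    by (rule identity_chart) simp
  show "is_chart (points (euclid n)) (mdim (euclid n)) c" if "c \<in> atlas (euclid n)" for c
    using that by (auto simp: euclid_def)
  then show "\<Union> (fst ` atlas (euclid n)) = points (euclid n)"
    using fst_atlasI[OF i] by (fastforce simp: is_chart_def)
  show "compatible (mdim (euclid n)) c c'" if "c \<in> atlas (euclid n)" "c' \<in> atlas (euclid n)" for c c'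
    using that compatible_euclid[of "fst c" "snd c" n "fst c'" "snd c'"]
      compatible_euclid[of "fst c'" "snd c'" n "fst c" "snd c"]
    by (cases c, cases c') (simp add: compatible_def Int_commute)
  show "Hausdorff_space (mtop (euclid n))"
    by (simp add: mtop_euclid Hausdorff_Euclidean_space)
  have "second_countable (euclidean :: pt topology)"
    unfolding second_countable_def open_openin[symmetric]
    using univ_second_countable[where 'a = pt] topological_basis_def by (metis topological_basisE topological_basis_open)
  then show "second_countable (mtop (euclid n))"
    by (simp add: mtop_euclid Euclidean_space_top_of_set second_countable_subtopology)
  show "c \<in> atlas (euclid n)" if c: "is_chart (points (euclid n)) (mdim (euclid n)) c"
    and compat: "\<forall>c'\<in>atlas (euclid n). compatible (mdim (euclid n)) c c'" for c
  proof -
    obtain D \<phi> where c_eq: "c = (D, \<phi>)" by (cases c)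
    have D: "D \<subseteq> ?T" "inj_on \<phi> D" using c by (auto simp: c_eq is_chart_def)
    have inv: "inv_into ?T (\<lambda>x\<in>?T. x) x = x" if "x \<in> ?T" for x
      using inv_into_f_f[of "\<lambda>x\<in>?T. x" ?T x] that by (auto simp: inj_on_def)
    have im: "(\<lambda>x\<in>?T. x) ` D = D" "D \<inter> ?T = D"
      using D(1) by (auto simp: image_def)
    \<comment> \<open>Compatibility with the global identity chart alone says that \<phi> and its
      inverse are smooth, which is the condition defining this atlas.\<close>
    have "smooth_euclidean n (\<phi> ` D) n ((\<lambda>x\<in>?T. x) \<circ> inv_into D \<phi>)"
      "smooth_euclidean n D n (\<phi> \<circ> inv_into ?T (\<lambda>x\<in>?T. x))"
      using bspec[OF compat i] unfolding compatible_def c_eq case_prod_conv euclid_simps im by blast+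
    then have "smooth_euclidean n (\<phi> ` D) n (inv_into D \<phi>)" "smooth_euclidean n D n \<phi>"
      using D(1) by (auto elim!: smooth_euclidean_cong simp: inv subset_iff inv_into_f_f[OF D(2)])
    then show ?thesis
      using c by (simp add: euclid_def c_eq)
  qed
qed

text \<open>The bridge from maps given by coordinate formulas to smooth maps of manifolds. Charts of
  the standard structure and their inverses are smooth in the Euclidean sense, so reading
  \<open>F\<close> in charts only composes it with such maps.\<close>

lemma smooth_maps_euclidI:
  assumes F: "smooth_euclidean n W m F" and W': "openin (Euclidean_space m) W'" and FW: "F ` W \<subseteq> W'"
  shows "restrict F W \<in> smooth_maps (open_submanifold (euclid n) W) (open_submanifold (euclid m) W')"
proof (rule smooth_mapsI)
  let ?F = "restrict F W"
  have W: "openin (Euclidean_space n) W"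
    using F by (simp add: smooth_euclidean_def)
  then have top: "topspace (subtopology (Euclidean_space n) W) = W"
    by (simp add: openin_subset inf.absorb2)
  have "continuous_map (subtopology (Euclidean_space n) W) (Euclidean_space m) F"
    using F unfolding smooth_euclidean_def
    by (intro continuous_map_Euclidean_components) (auto simp: top intro: times_diff_continuous_map)
  then have "continuous_map (subtopology (Euclidean_space n) W) (subtopology (Euclidean_space m) W') F"
    unfolding continuous_map_in_subtopology using FW top by auto
  then have "continuous_map (subtopology (Euclidean_space n) W) (subtopology (Euclidean_space m) W') ?F"
    by (rule continuous_map_eq) (simp add: top)
  then show "continuous_map (mtop (open_submanifold (euclid n) W)) (mtop (open_submanifold (euclid m) W')) ?F"
    using W W' by (simp add: mtop_open_submanifold smooth_manifold_euclid mtop_euclid)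
  show "?F \<in> points (open_submanifold (euclid n) W) \<rightarrow>\<^sub>E points (open_submanifold (euclid m) W')"
    using FW by auto
  fix D \<phi> E \<psi>
  assume "(D, \<phi>) \<in> atlas (open_submanifold (euclid n) W)" "(E, \<psi>) \<in> atlas (open_submanifold (euclid m) W')"
  then have D: "(D, \<phi>) \<in> atlas (euclid n)" "D \<subseteq> W" and E: "(E, \<psi>) \<in> atlas (euclid m)"
    by auto
  note inj = inv_into_f_f[OF atlas_euclidD(2)[OF D(1)]]
  have 1: "smooth_euclidean n (\<phi> ` D) m (F \<circ> inv_into D \<phi>)"
    by (rule smooth_euclidean_compose[OF atlas_euclidD(4)[OF D(1)] F]) (use D(2) inj in auto)
  have eq: "\<phi> ` {x \<in> D. ?F x \<in> E} = {x \<in> \<phi> ` D. (F \<circ> inv_into D \<phi>) x \<in> E}"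
    using D(2) inj by (auto simp: image_iff)
  have "smooth_euclidean n (\<phi> ` {x \<in> D. ?F x \<in> E}) m (F \<circ> inv_into D \<phi>)"
    unfolding eq
    by (rule smooth_euclidean_subset[OF 1 smooth_euclidean_openin_preimage[OF 1 atlas_euclidD(5)[OF E]]]) auto
  then have "smooth_euclidean n (\<phi> ` {x \<in> D. ?F x \<in> E}) m (\<psi> \<circ> (F \<circ> inv_into D \<phi>))"
    by (rule smooth_euclidean_compose[OF _ atlas_euclidD(3)[OF E]]) (unfold eq, auto)
  then have "smooth_euclidean n (\<phi> ` {x \<in> D. ?F x \<in> E}) m (\<psi> \<circ> ?F \<circ> inv_into D \<phi>)"
    by (rule smooth_euclidean_cong) (use D(2) inj in auto)
  then show "smooth_euclidean (mdim (open_submanifold (euclid n) W)) (\<phi> ` {x \<in> D. ?F x \<in> E})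
      (mdim (open_submanifold (euclid m) W')) (\<psi> \<circ> ?F \<circ> inv_into D \<phi>)"
    by simp
qed

lemma diffeomorphismsI:
  assumes "f \<in> smooth_maps M N" "g \<in> smooth_maps N M"
    and "\<And>x. x \<in> points M \<Longrightarrow> g (f x) = x" "\<And>y. y \<in> points N \<Longrightarrow> f (g y) = y"
  shows "f \<in> diffeomorphisms M N"
proof -
  note fD = smooth_mapsD(1)[OF assms(1)] and gD = smooth_mapsD(1)[OF assms(2)]
  have inj: "inj_on f (points M)"
    using assms(3) by (metis inj_onI)
  have bij: "bij_betw f (points M) (points N)"
    using fD gD assms(3,4) by (intro bij_betwI[where g = g]) auto
  have "restrict (inv_into (points M) f) (points N) = g"
  proof
    fix y
    show "restrict (inv_into (points M) f) (points N) y = g y"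
    proof (cases "y \<in> points N")
      case True
      then have "g y \<in> points M" using gD by auto
      then show ?thesis
        using inv_into_f_eq[OF inj, of "g y" y] assms(4)[OF True] True by simp
    qed (use gD in auto)
  qed
  then show ?thesis
    using assms(1,2) bij by (simp add: diffeomorphisms_def)
qed

text \<open>The given mutually inverse maps are composed with a diffeomorphism from \<open>N\<close>
  to some \<open>\<real>\<^sup>n\<close>. Below, \<open>N\<close> is either
  \<open>\<real>\<^sup>n\<close> itself or a coordinate box.\<close>

lemma cartesian_via_maps:
  assumes M: "smooth_manifold M" and N: "cartesian N"
    and f: "f \<in> smooth_maps M N" and g: "g \<in> smooth_maps N M"
    and gf: "\<And>x. x \<in> points M \<Longrightarrow> g (f x) = x" and fg: "\<And>y. y \<in> points N \<Longrightarrow> f (g y) = y"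
  shows "cartesian M"
proof -
  obtain n h where h: "h \<in> diffeomorphisms N (euclid n)" and sN: "smooth_manifold N"
    using N by (auto simp: cartesian_def)
  define k where "k = restrict (inv_into (points N) h) (points (euclid n))"
  have hs: "h \<in> smooth_maps N (euclid n)" and ks: "k \<in> smooth_maps (euclid n) N"
    and bij: "bij_betw h (points N) (points (euclid n))"
    using h by (auto simp: diffeomorphisms_def k_def)
  note fD = smooth_mapsD(1)[OF f] and gD = smooth_mapsD(1)[OF g]
    and hD = smooth_mapsD(1)[OF hs] and kD = smooth_mapsD(1)[OF ks]
  have kh: "k (h y) = y" if "y \<in> points N" for y
    using that hD inv_into_f_f[OF bij_betw_imp_inj_on[OF bij] that] by (auto simp: k_def)
  have hk: "h (k z) = z" if "z \<in> points (euclid n)" for z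
    using that f_inv_into_f[of z h "points N"] bij by (auto simp: k_def bij_betw_def)
  have "compose (points M) h f \<in> diffeomorphisms M (euclid n)"
  proof (rule diffeomorphismsI)
    show "compose (points M) h f \<in> smooth_maps M (euclid n)"
      by (rule smooth_maps_compose[OF M sN f hs])
    show "compose (points (euclid n)) g k \<in> smooth_maps (euclid n) M"
      by (rule smooth_maps_compose[OF smooth_manifold_euclid sN ks g])
    fix x assume x: "x \<in> points M"
    then have "f x \<in> points N" "h (f x) \<in> points (euclid n)" using fD hD by auto
    then show "compose (points (euclid n)) g k (compose (points M) h f x) = x"
      using x gf kh by (simp add: compose_def)
  next
    fix z assume z: "z \<in> points (euclid n)"
    then have "k z \<in> points N" "g (k z) \<in> points M" using kD gD by auto
    then show "compose (points M) h f (compose (points (euclid n)) g k z) = z"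
      using z fg hk by (simp add: compose_def)
  qed
  then show ?thesis
    using M by (auto simp: cartesian_def)
qed

lemma cartesian_euclid: "cartesian (euclid n)"
  unfolding cartesian_def
proof (intro conjI exI)
  show "diffeomorphisms (euclid n) (euclid n) \<noteq> {}"
    using diffeomorphismsI[OF smooth_maps_id smooth_maps_id, OF smooth_manifold_euclid smooth_manifold_euclid] by auto
qed (rule smooth_manifold_euclid)

section \<open>Good open covers by coordinate boxes\<close>

text \<open>Boxes are preferred to balls because the intersection of two boxes is again a box, so
  that finite intersections in a cover need no separate argument.\<close>

definition coord_box :: "nat \<Rightarrow> pt \<Rightarrow> pt \<Rightarrow> pt set" where
  "coord_box n a b = {y \<in> topspace (Euclidean_space n). \<forall>j<n. a j < y j \<and> y j < b j}"

text \<open>In each coordinate the diffeomorphism is \<open>t \<mapsto> ln ((t - a) / (b - t))\<close>, with inverse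
  \<open>s \<mapsto> (a + b e\<^sup>s) / (1 + e\<^sup>s)\<close>.\<close>

lemma cartesian_coord_box:
  assumes ab: "\<And>j. j < n \<Longrightarrow> a j < b j"
  shows "cartesian (open_submanifold (euclid n) (coord_box n a b))"
proof -
  let ?T = "topspace (Euclidean_space n)"
  define B where "B = coord_box n a b"
  have B: "openin (Euclidean_space n) B"
    unfolding B_def coord_box_def by (rule openin_Euclidean_space_box)
  have BD: "x \<in> ?T" "j < n \<Longrightarrow> a j < x j" "j < n \<Longrightarrow> x j < b j" if "x \<in> B" for x j
    using that by (auto simp: B_def coord_box_def)
  \<comment> \<open>Differences are spelled as sums with multiples by \<open>- 1\<close>, matching
    the closure rules for \<open>times_diff\<close>. The value 0 from \<open>n\<close> on keeps the
    image inside \<open>\<real>\<^sup>n\<close>; the same convention is used for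
    \<open>v\<close>.\<close>
  define u :: "pt \<Rightarrow> pt" where "u x = (\<lambda>j. if j < n then ln (x j + - a j) + - 1 * ln (b j + -1 * x j) else 0)" for x
  define v :: "pt \<Rightarrow> pt" where "v y = (\<lambda>j. if j < n then (a j + b j * exp (y j)) * inverse (1 + exp (y j)) else 0)" for y
  have su: "smooth_euclidean n B n u"
    unfolding smooth_euclidean_def
  proof (intro conjI allI impI)
    fix j k assume j: "j < n"
    have "times_diff k n B (\<lambda>x. ln (x j + - a j) + - 1 * ln (b j + -1 * x j))"
      using BD[OF _] j
      by (intro times_diff_add times_diff_mult times_diff_ln times_diff_const times_diff_coordinate) auto
    then show "times_diff k n B (\<lambda>x. u x j)"
      using j by (simp add: u_def)
  qed (use B in \<open>auto simp: u_def topspace_Euclidean_space\<close>)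
  have sv: "smooth_euclidean n ?T n v"
    unfolding smooth_euclidean_def
  proof (intro conjI allI impI)
    fix j k assume j: "j < n"
    have "1 + exp (x j) \<noteq> 0" for x :: pt
      using exp_gt_zero[of "x j"] by linarith
    then have "times_diff k n ?T (\<lambda>y. (a j + b j * exp (y j)) * inverse (1 + exp (y j)))"
      by (intro times_diff_add times_diff_mult times_diff_inverse times_diff_exp times_diff_const times_diff_coordinate)
    then show "times_diff k n ?T (\<lambda>x. v x j)"
      using j by (simp add: v_def)
  qed (simp, auto simp: v_def topspace_Euclidean_space)
  have uT: "u ` B \<subseteq> ?T"
    by (auto simp: u_def topspace_Euclidean_space)
  have vB: "v ` ?T \<subseteq> B"
  proof
    fix z assume "z \<in> v ` ?T"
    then obtain y where z: "z = v y" by blast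
    \<comment> \<open>The value is the weighted mean of \<open>a j\<close> and \<open>b j\<close>
      with positive weights 1 and \<open>exp (y j)\<close>, hence strictly between them.\<close>
    have "a j < v y j \<and> v y j < b j" if "j < n" for j
    proof -
      have e: "exp (y j) > 0" by simp
      have "a j * exp (y j) < b j * exp (y j)"
        using ab[OF that] by simp
      then have "a j * (1 + exp (y j)) < a j + b j * exp (y j)" "a j + b j * exp (y j) < b j * (1 + exp (y j))"
        using ab[OF that] by (simp_all add: distrib_left)
      then show ?thesis
        using that e by (simp add: v_def divide_inverse[symmetric] field_simps add_pos_pos)
    qed
    then show "z \<in> B"
      by (auto simp: z B_def coord_box_def v_def topspace_Euclidean_space)
  qed
  have vu: "v (u x) = x" if x: "x \<in> B" for x
  proof
    fix j
    show "v (u x) j = x j"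
    proof (cases "j < n")
      case True
      have p: "x j - a j > 0" "b j - x j > 0" "b j - a j > 0"
        using BD(2,3)[OF x True] by auto
      then have "u x j = ln ((x j - a j) / (b j - x j))"
        using True by (simp add: u_def ln_div)
      then have e: "exp (u x j) = (x j - a j) / (b j - x j)"
        using p by simp
      have "a j + b j * exp (u x j) = x j * (b j - a j) / (b j - x j)" "1 + exp (u x j) = (b j - a j) / (b j - x j)"
        unfolding e using p by (simp_all add: field_simps)
      then show ?thesis
        using True p by (simp add: v_def)
    qed (use BD(1)[OF x] in \<open>simp add: v_def topspace_Euclidean_space\<close>)
  qed
  have uv: "u (v y) = y" if y: "y \<in> ?T" for y
  proof
    fix j
    show "u (v y) j = y j"
    proof (cases "j < n")
      case True
      let ?e = "exp (y j)"
      have p: "?e > 0" "1 + ?e > 0" "b j - a j > 0"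
        using ab[OF True] by (auto intro: add_pos_pos)
      have v: "v y j = (a j + b j * ?e) / (1 + ?e)"
        using True by (simp add: v_def divide_inverse)
      have 1: "v y j + - a j = (b j - a j) * ?e / (1 + ?e)" "b j + - 1 * v y j = (b j - a j) / (1 + ?e)"
        unfolding v using p by (simp_all add: field_simps)
      have "u (v y) j = ln ((b j - a j) * ?e / (1 + ?e)) - ln ((b j - a j) / (1 + ?e))"
        using True by (simp add: u_def 1[simplified])
      also have "\<dots> = y j"
        using p by (simp add: ln_div ln_mult)
      finally show ?thesis .
    qed (use y in \<open>simp add: u_def topspace_Euclidean_space\<close>)
  qed
  let ?S = "open_submanifold (euclid n) B"
  have T: "open_submanifold (euclid n) ?T = euclid n"
    using open_submanifold_points[OF smooth_manifold_euclid, of n] by simp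
  have f: "restrict u B \<in> smooth_maps ?S (euclid n)"
    using smooth_maps_euclidI[OF su _ uT] by (simp add: T)
  have g: "restrict v ?T \<in> smooth_maps (euclid n) ?S"
    using smooth_maps_euclidI[OF sv B vB] by (simp add: T)
  have "cartesian ?S"
  proof (rule cartesian_via_maps[OF _ cartesian_euclid f g])
    show "smooth_manifold ?S"
      using smooth_manifold_open_submanifold[OF smooth_manifold_euclid, of n B] B by (simp add: mtop_euclid)
  qed (use uT vB uv vu in auto)
  then show ?thesis by (simp add: B_def)
qed

lemma coord_box_Int: "coord_box n a b \<inter> coord_box n a' b' = coord_box n (\<lambda>j. max (a j) (a' j)) (\<lambda>j. min (b j) (b' j))"
  by (auto simp: coord_box_def)

text \<open>A diffeomorphism to \<open>\<real>\<^sup>n\<close> turns the problem into one about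
  boxes: every point of an open set has a box around it inside the set, and a finite intersection of
  boxes is a box. Applied to the pairwise intersections of two good covers, this yields a common
  good refinement.\<close>

lemma good_open_cover_refinement:
  assumes U: "cartesian U" and op: "\<And>W. W \<in> \<W> \<Longrightarrow> openin (mtop U) W" and cover: "\<Union>\<W> = points U"
  obtains \<C> where "good_open_cover U \<C>" "\<And>V. V \<in> \<C> \<Longrightarrow> \<exists>W\<in>\<W>. V \<subseteq> W"
proof -
  obtain n h where h: "h \<in> diffeomorphisms U (euclid n)" and sU: "smooth_manifold U"
    using U by (auto simp: cartesian_def)
  let ?T = "topspace (Euclidean_space n)"
  define k where "k = restrict (inv_into (points U) h) ?T"
  have hs: "h \<in> smooth_maps U (euclid n)" and ks: "k \<in> smooth_maps (euclid n) U"
    and bij: "bij_betw h (points U) ?T"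
    using h by (auto simp: diffeomorphisms_def k_def)
  note hD = smooth_mapsD[OF hs] and kD = smooth_mapsD[OF ks]
  have hT: "h x \<in> ?T" if "x \<in> points U" for x
    using hD(1) that by auto
  have kU: "k y \<in> points U" if "y \<in> ?T" for y
    using kD(1) that by auto
  have kh: "k (h y) = y" if "y \<in> points U" for y
    using that hT inv_into_f_f[OF bij_betw_imp_inj_on[OF bij] that] by (auto simp: k_def)
  have hk: "h (k z) = z" if "z \<in> ?T" for z
    using that f_inv_into_f[of z h "points U"] bij by (auto simp: k_def bij_betw_def)
  define P where "P a b = {x \<in> points U. h x \<in> coord_box n a b}" for a b
  have P_open: "openin (mtop U) (P a b)" for a b
    using openin_continuous_map_preimage[OF hD(2), of "coord_box n a b"] openin_Euclidean_space_box[of n a b]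
    by (simp add: P_def smooth_manifoldD(7)[OF sU] mtop_euclid coord_box_def)
  have P_cart: "cartesian (open_submanifold U (P a b))" if ne: "P a b \<noteq> {}" for a b
  proof -
    let ?B = "coord_box n a b"
    have B: "openin (mtop (euclid n)) ?B"
      unfolding mtop_euclid coord_box_def by (rule openin_Euclidean_space_box)
    have f: "restrict h (P a b) \<in> smooth_maps (open_submanifold U (P a b)) (open_submanifold (euclid n) ?B)"
      by (rule smooth_maps_restrict[OF sU P_open smooth_manifold_euclid B hs]) (auto simp: P_def)
    have BT: "?B \<subseteq> ?T" by (auto simp: coord_box_def)
    have g: "restrict k ?B \<in> smooth_maps (open_submanifold (euclid n) ?B) (open_submanifold U (P a b))"
      by (rule smooth_maps_restrict[OF smooth_manifold_euclid B sU P_open ks]) (use BT hk kU in \<open>auto simp: P_def\<close>)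
    \<comment> \<open>A point in the preimage has its \<open>j\<close>-th coordinate strictly
      between the bounds, so the box is non-degenerate and therefore cartesian.\<close>
    have "a j < b j" if "j < n" for j
      using ne that unfolding P_def coord_box_def by force
    from cartesian_via_maps[OF smooth_manifold_open_submanifold[OF sU P_open] cartesian_coord_box[OF this] f g]
    show ?thesis
      using BT hk kh kU by (force simp: P_def)
  qed
  \<comment> \<open>Empty preimages are excluded, because members of a good cover are cartesian and
    cartesian spaces are non-empty.\<close>
  define \<C> where "\<C> = {V. V \<noteq> {} \<and> (\<exists>a b. V = P a b) \<and> (\<exists>W\<in>\<W>. V \<subseteq> W)}"
  have Inter: "\<exists>a b. \<Inter>\<F> = P a b" if "finite \<F>" "\<F> \<noteq> {}" "\<F> \<subseteq> \<C>" for \<F>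
    using that
  proof (induction rule: finite_ne_induct)
    case (singleton V)
    then show ?case by (auto simp: \<C>_def)
  next
    case (insert V \<F>)
    then obtain a b a' b' where "V = P a b" "\<Inter>\<F> = P a' b'"
      by (auto simp: \<C>_def)
    then have "\<Inter>(insert V \<F>) = P (\<lambda>j. max (a j) (a' j)) (\<lambda>j. min (b j) (b' j))"
      using coord_box_Int[of n a b a' b'] by (auto simp: P_def)
    then show ?case by blast
  qed
  have "x \<in> \<Union>\<C>" if x: "x \<in> points U" for x
  proof -
    obtain W where W: "W \<in> \<W>" "x \<in> W"
      using x cover by blast
    have "openin (Euclidean_space n) {y \<in> ?T. k y \<in> W}"
      using openin_continuous_map_preimage[OF kD(2) op[OF W(1)]] by (simp add: mtop_euclid)
    moreover have "h x \<in> {y \<in> ?T. k y \<in> W}"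
      using x W(2) kh hT by auto
    ultimately obtain d where d: "d > 0" "\<forall>y\<in>?T. (\<forall>j<n. \<bar>y j - h x j\<bar> < d) \<longrightarrow> y \<in> {y \<in> ?T. k y \<in> W}"
      unfolding openin_Euclidean_space_iff by blast
    \<comment> \<open>The box is the cube of radius \<open>d\<close> around \<open>h x\<close>,
      which is contained in the preimage of \<open>W\<close> under \<open>k\<close>.\<close>
    define a b where "a j = h x j - d" and "b j = h x j + d" for j
    have "x \<in> P a b"
      using x hT[OF x] d(1) by (auto simp: P_def coord_box_def a_def b_def)
    moreover have "P a b \<subseteq> W"
    proof
      fix z assume z: "z \<in> P a b"
      then have "h z \<in> ?T" "\<forall>j<n. \<bar>h z j - h x j\<bar> < d" "z \<in> points U"
        by (auto simp: P_def coord_box_def a_def b_def abs_less_iff algebra_simps)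
      then have "k (h z) \<in> W" using d(2) by blast
      then show "z \<in> W" using kh \<open>z \<in> points U\<close> by simp
    qed
    ultimately show ?thesis
      using W(1) unfolding \<C>_def by blast
  qed
  moreover have "\<Union>\<C> \<subseteq> points U"
    by (auto simp: \<C>_def P_def)
  ultimately have "\<Union>\<C> = points U" by blast
  moreover have "openin (mtop U) V \<and> cartesian (open_submanifold U V)" if "V \<in> \<C>" for V
    using that P_open P_cart unfolding \<C>_def by blast
  moreover have "cartesian (open_submanifold U (\<Inter>\<F>))" if "\<F> \<subseteq> \<C>" "finite \<F>" "\<F> \<noteq> {}" "\<Inter>\<F> \<noteq> {}" for \<F>
    using Inter[OF that(2,3,1)] P_cart that(4) by metis
  ultimately have "good_open_cover U \<C>"
    unfolding good_open_cover_def by blast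
  then show thesis
    by (rule that) (auto simp: \<C>_def)
qed

text \<open>The trivial cover satisfies the local lifting clause for a map that goes into a single
  summand of a coproduct as a whole.\<close>

lemma good_open_cover_self: "cartesian U \<Longrightarrow> good_open_cover U {points U}"
proof -
  assume U: "cartesian U"
  then have sU: "smooth_manifold U" by (simp add: cartesian_def)
  have "\<Inter>\<F> = points U" if "\<F> \<subseteq> {points U}" "\<F> \<noteq> {}" for \<F>
    using that by (metis cInf_singleton subset_singletonD)
  moreover have "openin (mtop U) (points U)"
    using openin_topspace[of "mtop U"] smooth_manifoldD(7)[OF sU] by simp
  ultimately show ?thesis
    using U by (simp add: good_open_cover_def open_submanifold_points[OF sU])
qed

section \<open>Diffeological spaces\<close>

text \<open>In charts the domain of a constant map is either the whole chart image or empty. The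
  lemma has two uses: from \<open>\<real>\<^sup>0\<close> it gives the maps that pick out a point of
  a plot, and into \<open>\<real>\<^sup>0\<close> it shows that constant functions are
  plots.\<close>

lemma smooth_maps_const:
  assumes M: "smooth_manifold M" and N: "smooth_manifold N" and y: "y \<in> points N"
  shows "(\<lambda>x\<in>points M. y) \<in> smooth_maps M N"
proof (rule smooth_mapsI)
  show "(\<lambda>x\<in>points M. y) \<in> points M \<rightarrow>\<^sub>E points N"
    using y by auto
  have "continuous_map (mtop M) (mtop N) (\<lambda>x. y)"
    using y smooth_manifoldD(7)[OF N] by simp
  then show "continuous_map (mtop M) (mtop N) (\<lambda>x\<in>points M. y)"
    by (rule continuous_map_eq) (simp add: smooth_manifoldD(7)[OF M])
  fix D \<phi> E \<psi> assume D: "(D, \<phi>) \<in> atlas M" and E: "(E, \<psi>) \<in> atlas N"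
  let ?W = "\<phi> ` {x \<in> D. (\<lambda>x\<in>points M. y) x \<in> E}"
  have "{x \<in> D. (\<lambda>x\<in>points M. y) x \<in> E} = (if y \<in> E then D else {})"
    using smooth_manifoldD(1)[OF M D] by auto
  then have "openin (Euclidean_space (mdim M)) ?W"
    using smooth_manifoldD(4)[OF M D] by simp
  moreover have "\<psi> y \<in> topspace (Euclidean_space (mdim N))" if "y \<in> E"
    using that openin_subset[OF smooth_manifoldD(4)[OF N E]] by blast
  ultimately have "smooth_euclidean (mdim M) ?W (mdim N) (\<lambda>_. \<psi> y)"
    using smooth_manifoldD(1)[OF M D] by (auto simp: smooth_euclidean_def times_diff_const)
  then show "smooth_euclidean (mdim M) ?W (mdim N) (\<psi> \<circ> (\<lambda>x\<in>points M. y) \<circ> inv_into D \<phi>)"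
    by (rule smooth_euclidean_cong)
      (use smooth_manifoldD(1)[OF M D] in \<open>auto simp: inv_into_f_f[OF smooth_manifoldD(3)[OF M D]]\<close>)
qed

lemma smooth_maps_shrink:
  assumes M: "smooth_manifold M" and N: "smooth_manifold N"
    and V: "openin (mtop M) V" and W: "openin (mtop M) W" "W \<subseteq> V"
    and f: "f \<in> smooth_maps (open_submanifold M V) N"
  shows "restrict f W \<in> smooth_maps (open_submanifold M W) N"
proof -
  have "openin (mtop (open_submanifold M V)) W"
    using W by (simp add: mtop_open_submanifold[OF M V] openin_open_subtopology[OF V])
  moreover have "openin (mtop N) (points N)"
    using openin_topspace[of "mtop N"] smooth_manifoldD(7)[OF N] by simp
  moreover have "f ` W \<subseteq> points N"
    using smooth_mapsD(1)[OF f] W(2) by auto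
  ultimately show ?thesis
    using smooth_maps_restrict[OF smooth_manifold_open_submanifold[OF M V] _ N _ f, of W "points N"]
    by (simp add: open_submanifold_twice[OF W(2)] open_submanifold_points[OF N])
qed

lemma diffeological_spaceD:
  assumes "diffeological_space X"
  shows "(U, p) \<in> plots X \<Longrightarrow> cartesian U"
    and "(U, p) \<in> plots X \<Longrightarrow> p \<in> points U \<rightarrow>\<^sub>E carrier X"
    and "q \<in> points (euclid 0) \<rightarrow>\<^sub>E carrier X \<Longrightarrow> (euclid 0, q) \<in> plots X"
    and "(U, p) \<in> plots X \<Longrightarrow> cartesian V \<Longrightarrow> f \<in> smooth_maps V U \<Longrightarrow> (V, compose (points V) p f) \<in> plots X"
    and "cartesian U \<Longrightarrow> p \<in> points U \<rightarrow>\<^sub>E carrier X \<Longrightarrow> good_open_cover U \<C> \<Longrightarrow>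
        (\<And>V. V \<in> \<C> \<Longrightarrow> (open_submanifold U V, restrict p V) \<in> plots X) \<Longrightarrow> (U, p) \<in> plots X"
proof -
  note X = assms[unfolded diffeological_space_def]
  show "(U, p) \<in> plots X \<Longrightarrow> cartesian U" "(U, p) \<in> plots X \<Longrightarrow> p \<in> points U \<rightarrow>\<^sub>E carrier X"
    using X by blast+
  show "q \<in> points (euclid 0) \<rightarrow>\<^sub>E carrier X \<Longrightarrow> (euclid 0, q) \<in> plots X"
    using X by blast
  show "(U, p) \<in> plots X \<Longrightarrow> cartesian V \<Longrightarrow> f \<in> smooth_maps V U \<Longrightarrow> (V, compose (points V) p f) \<in> plots X"
    using X by blast
  show "cartesian U \<Longrightarrow> p \<in> points U \<rightarrow>\<^sub>E carrier X \<Longrightarrow> good_open_cover U \<C> \<Longrightarrow>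
        (\<And>V. V \<in> \<C> \<Longrightarrow> (open_submanifold U V, restrict p V) \<in> plots X) \<Longrightarrow> (U, p) \<in> plots X"
    using X by blast
qed

lemma smooth_functionsD:
  assumes "f \<in> smooth_functions X Y"
  shows "f \<in> carrier X \<rightarrow>\<^sub>E carrier Y" "(U, p) \<in> plots X \<Longrightarrow> (U, compose (points U) f p) \<in> plots Y"
  using assms by (auto simp: smooth_functions_def)

lemma cartesian_smooth_manifold: "cartesian U \<Longrightarrow> smooth_manifold U"
  by (simp add: cartesian_def)

lemma compose_PiE:
  "p \<in> A \<rightarrow>\<^sub>E B \<Longrightarrow> f \<in> B \<rightarrow>\<^sub>E C \<Longrightarrow> compose A f p \<in> A \<rightarrow>\<^sub>E C"
  by (auto simp: compose_def)

section \<open>Smooth functions on coproducts of manifolds\<close>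

lemma coproduct_plotI:
  assumes "cartesian U" "i \<in> I" "q \<in> smooth_maps U (M i)"
  shows "(U, \<lambda>x\<in>points U. (i, q x)) \<in> plots (coproduct_space I (\<lambda>i. manifold_space (M i)))"
proof -
  have "good_open_cover U {points U}"
    by (rule good_open_cover_self[OF assms(1)])
  moreover have "open_submanifold U (points U) = U"
    by (rule open_submanifold_points[OF cartesian_smooth_manifold[OF assms(1)]])
  ultimately show ?thesis
    using assms smooth_mapsD(1)[OF assms(3)]
    unfolding coproduct_space_def manifold_space_def
    by (auto intro!: exI[of _ "{points U}"] bexI[of _ i] exI[of _ q])
qed

lemma coproduct_plotE:
  assumes "(U, p) \<in> plots (coproduct_space I (\<lambda>i. manifold_space (M i)))"
  obtains \<C> where "good_open_cover U \<C>"
    "\<And>V. V \<in> \<C> \<Longrightarrow> \<exists>i\<in>I. \<exists>q \<in> smooth_maps (open_submanifold U V) (M i). \<forall>x\<in>V. p x = (i, q x)"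
  using assms unfolding coproduct_space_def manifold_space_def by fastforce

lemma coproduct_plotD:
  assumes "(U, p) \<in> plots (coproduct_space I F)"
  shows "cartesian U" "p \<in> points U \<rightarrow>\<^sub>E carrier (coproduct_space I F)"
  using assms unfolding coproduct_space_def by auto

lemma good_open_coverD:
  assumes "good_open_cover U \<C>"
  shows "V \<in> \<C> \<Longrightarrow> openin (mtop U) V" "V \<in> \<C> \<Longrightarrow> cartesian (open_submanifold U V)"
    "V \<in> \<C> \<Longrightarrow> V \<subseteq> points U" "\<Union>\<C> = points U"
  using assms by (auto simp: good_open_cover_def)

lemma carrier_coproduct_manifolds [simp]:
  "carrier (coproduct_space I (\<lambda>i. manifold_space (M i))) = (SIGMA i:I. points (M i))"
  by (simp add: coproduct_space_def manifold_space_def)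

text \<open>The universal property of the coproduct. Forwards, \<open>f\<close> is tested on the
  inclusion of a summand, given by the identity of \<open>M i\<close>. Backwards, a plot lifts to
  single summands on a good cover, where \<open>f\<close> composed with it is a pullback of a plot
  of \<open>Y\<close>, and the gluing axiom of \<open>Y\<close> finishes.\<close>

lemma smooth_functions_coproduct:
  assumes Y: "diffeological_space Y" and M: "\<And>i. i \<in> I \<Longrightarrow> cartesian (M i)"
  shows "f \<in> smooth_functions (coproduct_space I (\<lambda>i. manifold_space (M i))) Y \<longleftrightarrow>
    f \<in> (SIGMA i:I. points (M i)) \<rightarrow>\<^sub>E carrier Y \<and> (\<forall>i\<in>I. (M i, \<lambda>y\<in>points (M i). f (i, y)) \<in> plots Y)"
  (is "?l \<longleftrightarrow> ?r")
proof
  assume l: ?l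
  have "(M i, \<lambda>y\<in>points (M i). f (i, y)) \<in> plots Y" if "i \<in> I" for i
  proof -
    have "(M i, \<lambda>x\<in>points (M i). (i, (\<lambda>y\<in>points (M i). y) x)) \<in> plots (coproduct_space I (\<lambda>i. manifold_space (M i)))"
      using that by (intro coproduct_plotI M smooth_maps_id cartesian_smooth_manifold)
    moreover have "compose (points (M i)) f (\<lambda>x\<in>points (M i). (i, (\<lambda>y\<in>points (M i). y) x)) = (\<lambda>y\<in>points (M i). f (i, y))"
      by (auto simp: compose_def)
    ultimately show ?thesis
      using smooth_functionsD(2)[OF l] by fastforce
  qed
  then show ?r
    using smooth_functionsD(1)[OF l] by simp
next
  assume r: ?r
  have "(U, compose (points U) f p) \<in> plots Y"
    if p: "(U, p) \<in> plots (coproduct_space I (\<lambda>i. manifold_space (M i)))" for U p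
  proof -
    obtain \<C> where C: "good_open_cover U \<C>"
      "\<And>V. V \<in> \<C> \<Longrightarrow> \<exists>i\<in>I. \<exists>q \<in> smooth_maps (open_submanifold U V) (M i). \<forall>x\<in>V. p x = (i, q x)"
      using coproduct_plotE[OF p] by metis
    note CD = good_open_coverD[OF C(1)]
    show ?thesis
    proof (rule diffeological_spaceD(5)[OF Y coproduct_plotD(1)[OF p] _ C(1)])
      show "compose (points U) f p \<in> points U \<rightarrow>\<^sub>E carrier Y"
        using coproduct_plotD(2)[OF p] r unfolding carrier_coproduct_manifolds by (intro compose_PiE) auto
      fix V assume V: "V \<in> \<C>"
      then obtain i q where iq: "i \<in> I" "q \<in> smooth_maps (open_submanifold U V) (M i)" "\<forall>x\<in>V. p x = (i, q x)"
        using C(2) by blast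
      have "(open_submanifold U V, compose (points (open_submanifold U V)) (\<lambda>y\<in>points (M i). f (i, y)) q) \<in> plots Y"
        by (rule diffeological_spaceD(4)[OF Y]) (use r iq CD(2)[OF V] in auto)
      moreover have "compose V (\<lambda>y\<in>points (M i). f (i, y)) q = restrict (compose (points U) f p) V"
        using iq(3) CD(3)[OF V] smooth_mapsD(1)[OF iq(2)] by (auto simp: compose_def fun_eq_iff)
      ultimately show "(open_submanifold U V, restrict (compose (points U) f p) V) \<in> plots Y"
        by simp
    qed
  qed
  then show ?l
    using r by (auto simp: smooth_functions_def)
qed

section \<open>Smooth functions on B and on its fibre square over X\<close>

lemma carrier_B_space: "carrier (B_space X) = (SIGMA p:plots X. points (fst p))"
  by (simp add: B_space_def)

lemma carrier_fiber_product:
  "bs \<in> carrier (fiber_product X k) \<longleftrightarrow> length bs = Suc k \<and> set bs \<subseteq> (SIGMA p:plots X. points (fst p)) \<and>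
     (\<forall>b\<in>set bs. \<forall>b'\<in>set bs. B_proj b = B_proj b')"
  by (simp add: fiber_product_def carrier_B_space Let_def)

lemma plots_fiber_product:
  "(U, P) \<in> plots (fiber_product X k) \<longleftrightarrow> cartesian U \<and> P \<in> points U \<rightarrow>\<^sub>E carrier (fiber_product X k) \<and>
     (\<forall>i\<le>k. (U, compose (points U) (\<lambda>bs. bs ! i) P) \<in> plots (B_space X))"
  by (auto simp: fiber_product_def Let_def)

lemma carrier_fiber_product_0:
  "bs \<in> carrier (fiber_product X 0) \<longleftrightarrow> (\<exists>p x. bs = [(p, x)] \<and> p \<in> plots X \<and> x \<in> points (fst p))"
  by (auto simp: carrier_fiber_product length_Suc_conv)

lemma carrier_fiber_product_1:
  "bs \<in> carrier (fiber_product X 1) \<longleftrightarrow> (\<exists>p x q y. bs = [(p, x), (q, y)] \<and> p \<in> plots X \<and> q \<in> plots X \<and>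
    x \<in> points (fst p) \<and> y \<in> points (fst q) \<and> snd p x = snd q y)"
  (is "?l \<longleftrightarrow> ?r")
proof
  assume l: ?l
  then obtain b\<^sub>0 b\<^sub>1 where bs: "bs = [b\<^sub>0, b\<^sub>1]"
    by (auto simp: carrier_fiber_product length_Suc_conv)
  obtain p x q y where b: "b\<^sub>0 = (p, x)" "b\<^sub>1 = (q, y)" by fastforce
  have "B_proj b\<^sub>0 = B_proj b\<^sub>1" "set bs \<subseteq> (SIGMA p:plots X. points (fst p))"
    using l unfolding carrier_fiber_product bs by (blast intro: list.set_intros)+
  then show ?r
    unfolding bs b by (simp add: B_proj_def)
next
  assume ?r
  then obtain p x q y where "bs = [(p, x), (q, y)]" "p \<in> plots X" "q \<in> plots X"
    "x \<in> points (fst p)" "y \<in> points (fst q)" and eq: "snd p x = snd q y"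
    by (elim exE conjE)
  then show ?l
    by (simp add: carrier_fiber_product B_proj_def)
qed

text \<open>The one-fold fibre product is B, written with one-element lists. The criterion thus
  becomes that of the coproduct once the list brackets are removed.\<close>

lemma smooth_functions_fiber_product_0:
  assumes X: "diffeological_space X" and Y: "diffeological_space Y"
  shows "f \<in> smooth_functions (fiber_product X 0) Y \<longleftrightarrow> f \<in> carrier (fiber_product X 0) \<rightarrow>\<^sub>E carrier Y \<and>
    (\<forall>p\<in>plots X. (fst p, \<lambda>x\<in>points (fst p). f [(p, x)]) \<in> plots Y)"
  (is "?l \<longleftrightarrow> ?r")
proof
  assume l: ?l
  have "(fst p, \<lambda>x\<in>points (fst p). f [(p, x)]) \<in> plots Y" if p: "p \<in> plots X" for p
  proof -
    have U: "cartesian (fst p)"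
      using diffeological_spaceD(1)[OF X, of "fst p" "snd p"] p by simp
    let ?P = "\<lambda>x\<in>points (fst p). [(p, x)]"
    have "(fst p, \<lambda>x\<in>points (fst p). (p, (\<lambda>y\<in>points (fst p). y) x)) \<in> plots (B_space X)"
      unfolding B_space_def using U by (intro coproduct_plotI p smooth_maps_id cartesian_smooth_manifold)
    moreover have "compose (points (fst p)) (\<lambda>bs. bs ! 0) ?P = (\<lambda>x\<in>points (fst p). (p, (\<lambda>y\<in>points (fst p). y) x))"
      by (auto simp: compose_def)
    moreover have "?P \<in> points (fst p) \<rightarrow>\<^sub>E carrier (fiber_product X 0)"
      using p by (auto simp: carrier_fiber_product_0)
    ultimately have "(fst p, ?P) \<in> plots (fiber_product X 0)"
      using U unfolding plots_fiber_product by simp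
    from smooth_functionsD(2)[OF l this] show ?thesis
      by (simp add: compose_def cong: restrict_cong)
  qed
  then show ?r
    using smooth_functionsD(1)[OF l] by simp
next
  assume r: ?r
  let ?g = "\<lambda>b\<in>(SIGMA p:plots X. points (fst p)). f [b]"
  have g: "?g \<in> smooth_functions (B_space X) Y"
    unfolding B_space_def
  proof (subst smooth_functions_coproduct[OF Y], goal_cases)
    case (1 p)
    then show ?case using diffeological_spaceD(1)[OF X, of "fst p" "snd p"] by simp
  next
    case 2
    have "(\<lambda>y\<in>points (fst p). ?g (p, y)) = (\<lambda>x\<in>points (fst p). f [(p, x)])" if "p \<in> plots X" for p
      using that by auto
    moreover have "?g \<in> (SIGMA p:plots X. points (fst p)) \<rightarrow>\<^sub>E carrier Y"
      using r by (force simp: carrier_fiber_product_0)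
    ultimately show ?case using r by simp
  qed
  have "(U, compose (points U) f P) \<in> plots Y" if P: "(U, P) \<in> plots (fiber_product X 0)" for U P
  proof -
    have "(U, compose (points U) ?g (compose (points U) (\<lambda>bs. bs ! 0) P)) \<in> plots Y"
      using P by (intro smooth_functionsD(2)[OF g]) (simp add: plots_fiber_product)
    moreover have "\<exists>p z. P x = [(p, z)] \<and> p \<in> plots X \<and> z \<in> points (fst p)" if "x \<in> points U" for x
      using P that unfolding plots_fiber_product carrier_fiber_product_0[symmetric] by blast
    then have "compose (points U) ?g (compose (points U) (\<lambda>bs. bs ! 0) P) = compose (points U) f P"
      by (fastforce simp: compose_def fun_eq_iff)
    ultimately show ?thesis by simp
  qed
  then show ?l
    using r by (auto simp: smooth_functions_def)
qed

text \<open>A plot of the fibre square has two components, each of which locally factors through a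
  single summand \<open>U\<^sub>p\<close>. Locally it is thus a pair of smooth maps
  \<open>g\<close>, \<open>h\<close> into two plots with equal composites to X, and smoothness of
  \<open>f\<close> need only be tested on such pairs.\<close>

lemma smooth_functions_fiber_product_1:
  assumes X: "diffeological_space X" and Y: "diffeological_space Y"
  shows "f \<in> smooth_functions (fiber_product X 1) Y \<longleftrightarrow> f \<in> carrier (fiber_product X 1) \<rightarrow>\<^sub>E carrier Y \<and>
    (\<forall>V p q g h. cartesian V \<longrightarrow> p \<in> plots X \<longrightarrow> q \<in> plots X \<longrightarrow>
       g \<in> smooth_maps V (fst p) \<longrightarrow> h \<in> smooth_maps V (fst q) \<longrightarrow>
       (\<forall>x\<in>points V. snd p (g x) = snd q (h x)) \<longrightarrow>
       (V, \<lambda>x\<in>points V. f [(p, g x), (q, h x)]) \<in> plots Y)"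
  (is "?l \<longleftrightarrow> ?r")
proof
  assume l: ?l
  have "(V, \<lambda>x\<in>points V. f [(p, g x), (q, h x)]) \<in> plots Y"
    if V: "cartesian V" and p: "p \<in> plots X" and q: "q \<in> plots X"
      and g: "g \<in> smooth_maps V (fst p)" and h: "h \<in> smooth_maps V (fst q)"
      and eq: "\<forall>x\<in>points V. snd p (g x) = snd q (h x)" for V p q g h
  proof -
    let ?P = "\<lambda>x\<in>points V. [(p, g x), (q, h x)]"
    have "(V, \<lambda>x\<in>points V. (p, g x)) \<in> plots (B_space X)" "(V, \<lambda>x\<in>points V. (q, h x)) \<in> plots (B_space X)"
      unfolding B_space_def by (intro coproduct_plotI V p q g h)+
    moreover have "compose (points V) (\<lambda>bs. bs ! 0) ?P = (\<lambda>x\<in>points V. (p, g x))"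
      "compose (points V) (\<lambda>bs. bs ! 1) ?P = (\<lambda>x\<in>points V. (q, h x))"
      by (auto simp: compose_def)
    ultimately have "(V, compose (points V) (\<lambda>bs. bs ! i) ?P) \<in> plots (B_space X)" if "i \<le> 1" for i
      using that by (cases "i = 0") (auto simp: le_Suc_eq)
    moreover have "?P \<in> points V \<rightarrow>\<^sub>E carrier (fiber_product X 1)"
      using p q eq smooth_mapsD(1)[OF g] smooth_mapsD(1)[OF h]
      unfolding PiE_iff carrier_fiber_product_1 by auto
    ultimately have "(V, ?P) \<in> plots (fiber_product X 1)"
      using V unfolding plots_fiber_product by simp
    from smooth_functionsD(2)[OF l this] show ?thesis
      by (simp add: compose_def cong: restrict_cong)
  qed
  then show ?r
    using smooth_functionsD(1)[OF l] by blast
next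
  assume r: ?r
  have "(U, compose (points U) f P) \<in> plots Y" if P: "(U, P) \<in> plots (fiber_product X 1)" for U P
  proof -
    have U: "cartesian U" and PU: "P \<in> points U \<rightarrow>\<^sub>E carrier (fiber_product X 1)"
      and P01: "(U, compose (points U) (\<lambda>bs. bs ! 0) P) \<in> plots (B_space X)"
        "(U, compose (points U) (\<lambda>bs. bs ! 1) P) \<in> plots (B_space X)"
      using P unfolding plots_fiber_product by auto
    note sU = cartesian_smooth_manifold[OF U]
    obtain \<C>\<^sub>0 where C0: "good_open_cover U \<C>\<^sub>0"
      "\<And>V. V \<in> \<C>\<^sub>0 \<Longrightarrow> \<exists>p\<in>plots X. \<exists>g \<in> smooth_maps (open_submanifold U V) (fst p).
        \<forall>x\<in>V. compose (points U) (\<lambda>bs. bs ! 0) P x = (p, g x)"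
      using coproduct_plotE[OF P01(1)[unfolded B_space_def]] by metis
    obtain \<C>\<^sub>1 where C1: "good_open_cover U \<C>\<^sub>1"
      "\<And>V. V \<in> \<C>\<^sub>1 \<Longrightarrow> \<exists>p\<in>plots X. \<exists>g \<in> smooth_maps (open_submanifold U V) (fst p).
        \<forall>x\<in>V. compose (points U) (\<lambda>bs. bs ! 1) P x = (p, g x)"
      using coproduct_plotE[OF P01(2)[unfolded B_space_def]] by metis
    note CD0 = good_open_coverD[OF C0(1)] and CD1 = good_open_coverD[OF C1(1)]
    \<comment> \<open>The members of \<W> carry lifts of both components, but they need not be
      cartesian, so a good refinement of this open cover takes its place.\<close>
    define \<W> where "\<W> = {V\<^sub>0 \<inter> V\<^sub>1 | V\<^sub>0 V\<^sub>1. V\<^sub>0 \<in> \<C>\<^sub>0 \<and> V\<^sub>1 \<in> \<C>\<^sub>1}"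
    have "openin (mtop U) W" if "W \<in> \<W>" for W
      using that CD0(1) CD1(1) by (auto simp: \<W>_def)
    moreover have "\<Union>\<W> = points U"
    proof -
      have "\<Union>\<W> = \<Union>\<C>\<^sub>0 \<inter> \<Union>\<C>\<^sub>1" unfolding \<W>_def by blast
      then show ?thesis using CD0(4) CD1(4) by simp
    qed
    ultimately obtain \<C> where C: "good_open_cover U \<C>" "\<And>V. V \<in> \<C> \<Longrightarrow> \<exists>W\<in>\<W>. V \<subseteq> W"
      using good_open_cover_refinement[OF U] by metis
    note CD = good_open_coverD[OF C(1)]
    show ?thesis
    proof (rule diffeological_spaceD(5)[OF Y U _ C(1)])
      show "compose (points U) f P \<in> points U \<rightarrow>\<^sub>E carrier Y"
        using r by (intro compose_PiE[OF PU]) auto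
      fix V assume V: "V \<in> \<C>"
      then obtain V\<^sub>0 V\<^sub>1 where V01: "V\<^sub>0 \<in> \<C>\<^sub>0" "V\<^sub>1 \<in> \<C>\<^sub>1" and sub: "V \<subseteq> V\<^sub>0" "V \<subseteq> V\<^sub>1"
        using C(2)[OF V] unfolding \<W>_def by blast
      obtain p g where pg: "p \<in> plots X" "g \<in> smooth_maps (open_submanifold U V\<^sub>0) (fst p)"
        "\<forall>x\<in>V\<^sub>0. compose (points U) (\<lambda>bs. bs ! 0) P x = (p, g x)"
        using C0(2)[OF V01(1)] by blast
      obtain q h where qh: "q \<in> plots X" "h \<in> smooth_maps (open_submanifold U V\<^sub>1) (fst q)"
        "\<forall>x\<in>V\<^sub>1. compose (points U) (\<lambda>bs. bs ! 1) P x = (q, h x)"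
        using C1(2)[OF V01(2)] by blast
      have pq: "smooth_manifold (fst p)" "smooth_manifold (fst q)"
        using diffeological_spaceD(1)[OF X, of "fst p" "snd p"] diffeological_spaceD(1)[OF X, of "fst q" "snd q"]
          pg(1) qh(1) by (auto intro: cartesian_smooth_manifold)
      have g: "restrict g V \<in> smooth_maps (open_submanifold U V) (fst p)"
        by (rule smooth_maps_shrink[OF sU pq(1) CD0(1)[OF V01(1)] CD(1)[OF V] sub(1) pg(2)])
      have h: "restrict h V \<in> smooth_maps (open_submanifold U V) (fst q)"
        by (rule smooth_maps_shrink[OF sU pq(2) CD1(1)[OF V01(2)] CD(1)[OF V] sub(2) qh(2)])
      have Px: "P x = [(p, g x), (q, h x)] \<and> snd p (g x) = snd q (h x)" if x: "x \<in> V" for x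
      proof -
        have xU: "x \<in> points U" using CD(3)[OF V] x by blast
        then have "P x \<in> carrier (fiber_product X 1)" using PU by blast
        moreover have "P x ! 0 = (p, g x)" "P x ! 1 = (q, h x)"
          using bspec[OF pg(3), of x] bspec[OF qh(3), of x] sub x xU by (auto simp: compose_def)
        ultimately show ?thesis
          unfolding carrier_fiber_product_1 by auto
      qed
      then have "\<forall>x\<in>points (open_submanifold U V). snd p (restrict g V x) = snd q (restrict h V x)"
        by simp
      then have "(open_submanifold U V, \<lambda>x\<in>points (open_submanifold U V).
          f [(p, restrict g V x), (q, restrict h V x)]) \<in> plots Y"
        using r CD(2)[OF V] pg(1) qh(1) g h by blast
      moreover have "(\<lambda>x\<in>V. f [(p, restrict g V x), (q, restrict h V x)]) = restrict (compose (points U) f P) V"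
        using Px CD(3)[OF V] by (auto simp: compose_def fun_eq_iff)
      ultimately show "(open_submanifold U V, restrict (compose (points U) f P) V) \<in> plots Y"
        by simp
    qed
  qed
  then show ?l
    using r by (auto simp: smooth_functions_def)
qed

section \<open>Cochains with coefficients in an abelian diffeological group\<close>

text \<open>An isomorphism carrying \<open>H\<close> onto \<open>H'\<close> descends to the
  quotients. The induced map is written as a union of cosets to match the definition of
  \<open>phi\<close>; the first claim says that all cosets in this union coincide. That
  \<open>H'\<close> is a subgroup follows from its being the image of \<open>H\<close>.\<close>

lemma iso_Mod:
  assumes G: "comm_group G" and G': "comm_group G'" and h: "h \<in> iso G G'"
    and H: "subgroup H G" and hH: "h ` H = H'"
  shows "\<And>\<tau>. \<tau> \<in> carrier G \<Longrightarrow> (\<Union>\<sigma>\<in>H #>\<^bsub>G\<^esub> \<tau>. H' #>\<^bsub>G'\<^esub> h \<sigma>) = H' #>\<^bsub>G'\<^esub> h \<tau>"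
    and "(\<lambda>c. \<Union>\<sigma>\<in>c. H' #>\<^bsub>G'\<^esub> h \<sigma>) \<in> iso (G Mod H) (G' Mod H')"
proof -
  interpret G: comm_group G by fact
  interpret G': comm_group G' by fact
  interpret group_hom G G' h
    using h by (unfold_locales) (simp add: iso_def)
  have inj: "inj_on h (carrier G)" and surj: "h ` carrier G = carrier G'"
    using h by (auto simp: iso_def bij_betw_def)
  have H': "subgroup H' G'"
    using subgroup_img_is_subgroup[OF H] hH by simp
  interpret H: normal H G by (rule G.subgroup_imp_normal[OF H])
  interpret H': normal H' G' by (rule G'.subgroup_imp_normal[OF H'])
  have mem: "h \<sigma> \<in> H' #>\<^bsub>G'\<^esub> h \<tau>" if "\<sigma> \<in> H #>\<^bsub>G\<^esub> \<tau>" "\<tau> \<in> carrier G" for \<sigma> \<tau>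
    using that hH by (auto simp: r_coset_def)
  show cl: "(\<Union>\<sigma>\<in>H #>\<^bsub>G\<^esub> \<tau>. H' #>\<^bsub>G'\<^esub> h \<sigma>) = H' #>\<^bsub>G'\<^esub> h \<tau>" if \<tau>: "\<tau> \<in> carrier G" for \<tau>
  proof -
    have "H' #>\<^bsub>G'\<^esub> h \<sigma> = H' #>\<^bsub>G'\<^esub> h \<tau>" if "\<sigma> \<in> H #>\<^bsub>G\<^esub> \<tau>" for \<sigma>
      using G'.repr_independence[OF mem[OF that \<tau>] _ H'] \<tau> by simp
    then show ?thesis
      using G.rcos_self[OF \<tau> H] by blast
  qed
  let ?\<Phi> = "\<lambda>c. \<Union>\<sigma>\<in>c. H' #>\<^bsub>G'\<^esub> h \<sigma>"
  show "?\<Phi> \<in> iso (G Mod H) (G' Mod H')"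
    unfolding iso_def bij_betw_def
  proof (intro CollectI conjI)
    show "?\<Phi> \<in> hom (G Mod H) (G' Mod H')"
    proof (rule homI)
      fix c assume "c \<in> carrier (G Mod H)"
      then show "?\<Phi> c \<in> carrier (G' Mod H')"
        using cl by (force simp: carrier_FactGroup)
      fix c' assume "c' \<in> carrier (G Mod H)"
      with \<open>c \<in> carrier (G Mod H)\<close> obtain a b where "a \<in> carrier G" "b \<in> carrier G" "c = H #>\<^bsub>G\<^esub> a" "c' = H #>\<^bsub>G\<^esub> b"
        by (auto simp: carrier_FactGroup)
      then show "?\<Phi> (c \<otimes>\<^bsub>G Mod H\<^esub> c') = ?\<Phi> c \<otimes>\<^bsub>G' Mod H'\<^esub> ?\<Phi> c'"
        by (simp add: H.rcos_sum H'.rcos_sum cl del: UN_simps)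
    qed
    show "inj_on ?\<Phi> (carrier (G Mod H))"
    proof (rule inj_onI)
      fix c c' assume "c \<in> carrier (G Mod H)" "c' \<in> carrier (G Mod H)" and eq: "?\<Phi> c = ?\<Phi> c'"
      then obtain a b where ab: "a \<in> carrier G" "b \<in> carrier G" "c = H #>\<^bsub>G\<^esub> a" "c' = H #>\<^bsub>G\<^esub> b"
        by (auto simp: carrier_FactGroup)
      then have "H' #>\<^bsub>G'\<^esub> h a = H' #>\<^bsub>G'\<^esub> h b"
        using eq cl by simp
      then have "h a \<in> H' #>\<^bsub>G'\<^esub> h b"
        using G'.rcos_self[OF _ H', of "h a"] ab(1) by simp
      \<comment> \<open>The factor from \<open>H'\<close> is taken in the form \<open>h x\<close>
        with \<open>x\<close> in \<open>H\<close>; injectivity of \<open>h\<close> then moves the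
        coset relation back to \<open>G\<close>.\<close>
      then obtain x where x: "x \<in> H" "h a = h x \<otimes>\<^bsub>G'\<^esub> h b"
        unfolding r_coset_def hH[symmetric] by auto
      then have "h a = h (x \<otimes>\<^bsub>G\<^esub> b)"
        using ab(2) H.subset by auto
      then have "a = x \<otimes>\<^bsub>G\<^esub> b"
        using inj ab(1,2) x(1) H.subset by (auto simp: inj_on_def)
      then have "a \<in> H #>\<^bsub>G\<^esub> b"
        using x(1) by (auto simp: r_coset_def)
      then show "c = c'"
        using G.repr_independence[OF _ ab(2) H] ab(3,4) by simp
    qed
    have "?\<Phi> ` carrier (G Mod H) = (\<lambda>\<tau>. H' #>\<^bsub>G'\<^esub> h \<tau>) ` carrier G"
      using cl by (simp add: carrier_FactGroup image_image)
    also have "\<dots> = carrier (G' Mod H')"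
      unfolding carrier_FactGroup surj[symmetric] by (simp add: image_image)
    finally show "?\<Phi> ` carrier (G Mod H) = carrier (G' Mod H')" .
  qed
qed

text \<open>These are the facts about plots that let pointwise products, inverses and constants of
  smooth functions be smooth again. Both simplicial spaces have them by the way their plots are
  built.\<close>

definition well_formed_plots :: "'s diffeological \<Rightarrow> bool" where
  "well_formed_plots Y \<longleftrightarrow> (\<forall>(U, p)\<in>plots Y. cartesian U \<and> p \<in> points U \<rightarrow>\<^sub>E carrier Y)"

lemma well_formed_plotsD:
  "well_formed_plots Y \<Longrightarrow> (U, p) \<in> plots Y \<Longrightarrow> cartesian U"
  "well_formed_plots Y \<Longrightarrow> (U, p) \<in> plots Y \<Longrightarrow> p \<in> points U \<rightarrow>\<^sub>E carrier Y"
  by (auto simp: well_formed_plots_def)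

locale abelian_coefficients =
  fixes A :: "'a diffeological_group" (structure)
  assumes coefficients: "abelian_diffeological_group A"
begin

sublocale comm_group A
  using coefficients by (simp add: abelian_diffeological_group_def)

lemma dspace: "diffeological_space (group_space A)"
  using coefficients by (simp add: abelian_diffeological_group_def)

lemma group_space_simps [simp]: "carrier (group_space A) = carrier A" "plots (group_space A) = group_plots A"
  by (simp_all add: group_space_def)

lemma smooth_functions_PiE:
  "f \<in> smooth_functions Y (group_space A) \<Longrightarrow> f \<in> carrier Y \<rightarrow>\<^sub>E carrier A"
  using smooth_functionsD(1)[of f Y "group_space A"] by simp

lemma smooth_functions_closed:
  "f \<in> smooth_functions Y (group_space A) \<Longrightarrow> s \<in> carrier Y \<Longrightarrow> f s \<in> carrier A"
  using smooth_functions_PiE[of f Y] by auto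

lemma plot_mult:
  assumes f: "(U, f) \<in> group_plots A" and g: "(U, g) \<in> group_plots A"
  shows "(U, \<lambda>x\<in>points U. f x \<otimes> g x) \<in> group_plots A"
proof -
  have fg: "f \<in> points U \<rightarrow>\<^sub>E carrier A" "g \<in> points U \<rightarrow>\<^sub>E carrier A" "cartesian U"
    using diffeological_spaceD(1,2)[OF dspace] f g by auto
  let ?P = "\<lambda>x\<in>points U. (f x, g x)"
  have "compose (points U) fst ?P = f" "compose (points U) snd ?P = g"
    using fg by (auto simp: compose_def fun_eq_iff PiE_def extensional_def)
  moreover have "?P \<in> points U \<rightarrow>\<^sub>E carrier A \<times> carrier A"
    using fg by auto
  ultimately have P: "(U, ?P) \<in> plots (product_space (group_space A) (group_space A))"
    using f g fg(3) by (simp add: product_space_def)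
  have m: "(\<lambda>(a, b)\<in>carrier A \<times> carrier A. a \<otimes> b) \<in> smooth_functions (product_space (group_space A) (group_space A)) (group_space A)"
    using coefficients by (simp add: abelian_diffeological_group_def)
  have "compose (points U) (\<lambda>(a, b)\<in>carrier A \<times> carrier A. a \<otimes> b) ?P = (\<lambda>x\<in>points U. f x \<otimes> g x)"
    using fg by (auto simp: compose_def fun_eq_iff)
  then show ?thesis
    using smooth_functionsD(2)[OF m P] by simp
qed

lemma plot_inv:
  assumes f: "(U, f) \<in> group_plots A"
  shows "(U, \<lambda>x\<in>points U. inv (f x)) \<in> group_plots A"
proof -
  have i: "(\<lambda>a\<in>carrier A. inv a) \<in> smooth_functions (group_space A) (group_space A)"
    using coefficients by (simp add: abelian_diffeological_group_def)
  have "compose (points U) (\<lambda>a\<in>carrier A. inv a) f = (\<lambda>x\<in>points U. inv (f x))"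
    using diffeological_spaceD(2)[OF dspace, of U f] f by (auto simp: compose_def fun_eq_iff)
  then show ?thesis
    using smooth_functionsD(2)[OF i, of U f] f by simp
qed

text \<open>A constant map factors through \<open>\<real>\<^sup>0\<close>, and every map from
  \<open>\<real>\<^sup>0\<close> into the carrier is a plot.\<close>

lemma plot_const:
  assumes U: "cartesian U" and a: "a \<in> carrier A"
  shows "(U, \<lambda>x\<in>points U. a) \<in> group_plots A"
proof -
  let ?e = "euclid 0"
  have e: "(\<lambda>_. 0) \<in> points ?e"
    by (simp add: topspace_Euclidean_space)
  have "(?e, \<lambda>x\<in>points ?e. a) \<in> plots (group_space A)"
    using a by (intro diffeological_spaceD(3)[OF dspace]) auto
  moreover have "(\<lambda>x\<in>points U. (\<lambda>_. 0)) \<in> smooth_maps U ?e"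
    by (rule smooth_maps_const[OF cartesian_smooth_manifold[OF U] smooth_manifold_euclid e])
  moreover have "compose (points U) (\<lambda>x\<in>points ?e. a) (\<lambda>x\<in>points U. (\<lambda>_. 0)) = (\<lambda>x\<in>points U. a)"
    using e by (auto simp: compose_def fun_eq_iff)
  ultimately show ?thesis
    using diffeological_spaceD(4)[OF dspace _ U, of ?e "\<lambda>x\<in>points ?e. a"] by fastforce
qed

lemma plot_compose:
  assumes "(U, f) \<in> group_plots A" "cartesian V" "g \<in> smooth_maps V U"
  shows "(V, \<lambda>x\<in>points V. f (g x)) \<in> group_plots A"
  using diffeological_spaceD(4)[OF dspace, of U f V g] assms by (simp add: compose_def)

text \<open>Formulated for an arbitrary set \<open>K\<close> closed under the pointwise operations,
  so that one proof serves all cochains as well as the 1-cocycles.\<close>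

lemma pointwise_comm_group:
  assumes K: "\<And>\<sigma>. \<sigma> \<in> K \<Longrightarrow> \<sigma> \<in> D \<rightarrow>\<^sub>E carrier A"
    and m: "\<And>\<sigma> \<tau>. \<sigma> \<in> K \<Longrightarrow> \<tau> \<in> K \<Longrightarrow> (\<lambda>s\<in>D. \<sigma> s \<otimes> \<tau> s) \<in> K"
    and o: "(\<lambda>s\<in>D. \<one>) \<in> K"
    and i: "\<And>\<sigma>. \<sigma> \<in> K \<Longrightarrow> (\<lambda>s\<in>D. inv (\<sigma> s)) \<in> K"
  shows "comm_group \<lparr>carrier = K, mult = (\<lambda>\<sigma> \<tau>. \<lambda>s\<in>D. \<sigma> s \<otimes> \<tau> s), one = (\<lambda>s\<in>D. \<one>)\<rparr>"
proof -
  let ?G = "\<lparr>carrier = K, mult = (\<lambda>\<sigma> \<tau>. \<lambda>s\<in>D. \<sigma> s \<otimes> \<tau> s), one = (\<lambda>s\<in>D. \<one>)\<rparr>"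
  have mem: "\<sigma> s \<in> carrier A" if "\<sigma> \<in> K" "s \<in> D" for \<sigma> s
    using K[OF that(1)] that(2) by auto
  show ?thesis
  proof (rule comm_groupI)
    show "\<one>\<^bsub>?G\<^esub> \<in> carrier ?G"
      using o by simp
    fix \<sigma> assume "\<sigma> \<in> carrier ?G"
    then have \<sigma>: "\<sigma> \<in> K" by simp
    show "\<one>\<^bsub>?G\<^esub> \<otimes>\<^bsub>?G\<^esub> \<sigma> = \<sigma>"
      using K[OF \<sigma>] mem[OF \<sigma>] by (auto simp: fun_eq_iff PiE_def extensional_def)
    show "\<exists>\<tau>\<in>carrier ?G. \<tau> \<otimes>\<^bsub>?G\<^esub> \<sigma> = \<one>\<^bsub>?G\<^esub>"
      using i[OF \<sigma>] mem[OF \<sigma>] by (intro bexI[of _ "\<lambda>s\<in>D. inv (\<sigma> s)"]) auto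
    fix \<tau> assume "\<tau> \<in> carrier ?G"
    then have \<tau>: "\<tau> \<in> K" by simp
    show "\<sigma> \<otimes>\<^bsub>?G\<^esub> \<tau> \<in> carrier ?G"
      using m[OF \<sigma> \<tau>] by simp
    show "\<sigma> \<otimes>\<^bsub>?G\<^esub> \<tau> = \<tau> \<otimes>\<^bsub>?G\<^esub> \<sigma>"
      using mem[OF \<sigma>] mem[OF \<tau>] by (auto simp: fun_eq_iff m_comm)
    fix \<rho> assume "\<rho> \<in> carrier ?G"
    then have \<rho>: "\<rho> \<in> K" by simp
    show "\<sigma> \<otimes>\<^bsub>?G\<^esub> \<tau> \<otimes>\<^bsub>?G\<^esub> \<rho> = \<sigma> \<otimes>\<^bsub>?G\<^esub> (\<tau> \<otimes>\<^bsub>?G\<^esub> \<rho>)"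
      using mem[OF \<sigma>] mem[OF \<tau>] mem[OF \<rho>] by (auto simp: fun_eq_iff m_assoc)
  qed
qed

lemma smooth_functions_mult:
  assumes Y: "well_formed_plots Y" and f: "f \<in> smooth_functions Y (group_space A)"
    and g: "g \<in> smooth_functions Y (group_space A)"
  shows "(\<lambda>s\<in>carrier Y. f s \<otimes> g s) \<in> smooth_functions Y (group_space A)"
proof -
  have "(U, compose (points U) (\<lambda>s\<in>carrier Y. f s \<otimes> g s) p) \<in> group_plots A" if p: "(U, p) \<in> plots Y" for U p
  proof -
    have "compose (points U) (\<lambda>s\<in>carrier Y. f s \<otimes> g s) p =
        (\<lambda>x\<in>points U. compose (points U) f p x \<otimes> compose (points U) g p x)"
      using well_formed_plotsD(2)[OF Y p] by (auto simp: compose_def fun_eq_iff)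
    then show ?thesis
      using plot_mult[of U "compose (points U) f p" "compose (points U) g p"]
        smooth_functionsD(2)[OF f p] smooth_functionsD(2)[OF g p] by simp
  qed
  then show ?thesis
    using smooth_functionsD(1)[OF f] smooth_functionsD(1)[OF g] by (auto simp: smooth_functions_def)
qed

lemma smooth_functions_inv:
  assumes Y: "well_formed_plots Y" and f: "f \<in> smooth_functions Y (group_space A)"
  shows "(\<lambda>s\<in>carrier Y. inv (f s)) \<in> smooth_functions Y (group_space A)"
proof -
  have "(U, compose (points U) (\<lambda>s\<in>carrier Y. inv (f s)) p) \<in> group_plots A" if p: "(U, p) \<in> plots Y" for U p
  proof -
    have "compose (points U) (\<lambda>s\<in>carrier Y. inv (f s)) p = (\<lambda>x\<in>points U. inv (compose (points U) f p x))"
      using well_formed_plotsD(2)[OF Y p] by (auto simp: compose_def fun_eq_iff)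
    then show ?thesis
      using plot_inv[of U "compose (points U) f p"] smooth_functionsD(2)[OF f p] by simp
  qed
  then show ?thesis
    using smooth_functionsD(1)[OF f] by (auto simp: smooth_functions_def)
qed

lemma smooth_functions_one:
  assumes Y: "well_formed_plots Y"
  shows "(\<lambda>s\<in>carrier Y. \<one>) \<in> smooth_functions Y (group_space A)"
proof -
  have "(U, compose (points U) (\<lambda>s\<in>carrier Y. \<one>) p) \<in> group_plots A" if p: "(U, p) \<in> plots Y" for U p
  proof -
    have "compose (points U) (\<lambda>s\<in>carrier Y. \<one>) p = (\<lambda>x\<in>points U. \<one>)"
      using well_formed_plotsD(2)[OF Y p] by (auto simp: compose_def fun_eq_iff)
    then show ?thesis
      using plot_const[OF well_formed_plotsD(1)[OF Y p]] by simp
  qed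
  then show ?thesis
    by (auto simp: smooth_functions_def)
qed

lemma comm_group_cochains:
  assumes "well_formed_plots (level S n)"
  shows "comm_group (cochains S A n)"
  unfolding cochains_def
  by (rule pointwise_comm_group)
    (simp_all add: assms smooth_functions_PiE smooth_functions_mult smooth_functions_inv smooth_functions_one)

lemma differential_0:
  assumes "\<sigma> \<in> smooth_functions (level S 0) (group_space A)" "s \<in> carrier (level S 1)"
    and "\<forall>i\<le>1. face S 1 i s \<in> carrier (level S 0)"
  shows "differential S A 0 \<sigma> s = \<sigma> (face S 1 0 s) \<otimes> inv (\<sigma> (face S 1 1 s))"
proof -
  have "\<sigma> (face S 1 i s) \<in> carrier A" if "i \<le> 1" for i
    using smooth_functions_closed[OF assms(1)] assms(3) that by auto
  moreover have "{..Suc 0} = {0, Suc 0}" by auto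
  ultimately show ?thesis
    using assms(2) by (simp add: differential_def int_pow_neg int_pow_1)
qed

lemma differential_1:
  assumes "\<tau> \<in> smooth_functions (level S 1) (group_space A)" "s \<in> carrier (level S 2)"
    and "\<forall>i\<le>2. face S 2 i s \<in> carrier (level S 1)"
  shows "differential S A 1 \<tau> s = \<tau> (face S 2 0 s) \<otimes> \<tau> (face S 2 2 s) \<otimes> inv (\<tau> (face S 2 1 s))"
proof -
  have "\<tau> (face S 2 i s) \<in> carrier A" if "i \<le> 2" for i
    using smooth_functions_closed[OF assms(1)] assms(3) that by auto
  moreover have "{..Suc (Suc 0)} = {0, Suc 0, Suc (Suc 0)}" by auto
  ultimately show ?thesis
    using assms(2) by (simp add: differential_def int_pow_neg m_ac int_pow_1 numeral_2_eq_2)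
qed

lemma mult_inv_eq_one: "a \<in> carrier A \<Longrightarrow> b \<in> carrier A \<Longrightarrow> a \<otimes> inv b = \<one> \<longleftrightarrow> b = a"
  by (metis inv_closed inv_equality inv_inv r_inv)

text \<open>Additively, (a - c) - (b - c) = a - b. In the construction of \<tau>, \<open>c\<close>
  is the value at the common source plot through which two points vary.\<close>

lemma mult_inv_cancel_right:
  assumes "a \<in> carrier A" "b \<in> carrier A" "c \<in> carrier A"
  shows "(a \<otimes> inv c) \<otimes> inv (b \<otimes> inv c) = a \<otimes> inv b"
proof -
  have "inv c \<otimes> (c \<otimes> inv b) = inv b"
    using assms m_assoc[of "inv c" c "inv b"] by simp
  then show ?thesis
    using assms by (simp add: inv_mult_group m_assoc)
qed

text \<open>The kernel condition, additively \<open>\<tau>(d\<^sub>0 s) - \<tau>(d\<^sub>1 s) +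
  \<tau>(d\<^sub>2 s) = 0\<close>, is rearranged so that no inverse occurs. The assumption on faces
  keeps the three values in the carrier of A, where the group laws hold.\<close>

lemma carrier_cocycles_1:
  assumes faces: "\<forall>s\<in>carrier (level S 2). \<forall>i\<le>2. face S 2 i s \<in> carrier (level S 1)"
  shows "\<tau> \<in> carrier (cocycles S A 1) \<longleftrightarrow> \<tau> \<in> smooth_functions (level S 1) (group_space A) \<and>
    (\<forall>s\<in>carrier (level S 2). \<tau> (face S 2 1 s) = \<tau> (face S 2 0 s) \<otimes> \<tau> (face S 2 2 s))"
proof -
  have "differential S A 1 \<tau> = (\<lambda>s\<in>carrier (level S 2). \<one>) \<longleftrightarrow>
     (\<forall>s\<in>carrier (level S 2). \<tau> (face S 2 1 s) = \<tau> (face S 2 0 s) \<otimes> \<tau> (face S 2 2 s))"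
    if \<tau>: "\<tau> \<in> smooth_functions (level S 1) (group_space A)"
  proof -
    have mem: "\<tau> (face S 2 i s) \<in> carrier A" if "s \<in> carrier (level S 2)" "i \<le> 2" for i s
      using smooth_functions_closed[OF \<tau>] faces that by auto
    have "differential S A 1 \<tau> s = \<one> \<longleftrightarrow> \<tau> (face S 2 1 s) = \<tau> (face S 2 0 s) \<otimes> \<tau> (face S 2 2 s)"
      if s: "s \<in> carrier (level S 2)" for s
      unfolding differential_1[OF \<tau> s bspec[OF faces s]]
      by (rule mult_inv_eq_one) (simp_all add: mem s)
    then have "(\<forall>s\<in>carrier (level S 2). differential S A 1 \<tau> s = \<one>) \<longleftrightarrow>
        (\<forall>s\<in>carrier (level S 2). \<tau> (face S 2 1 s) = \<tau> (face S 2 0 s) \<otimes> \<tau> (face S 2 2 s))"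
      by (intro ball_cong refl)
    moreover have "differential S A 1 \<tau> \<in> extensional (carrier (level S 2))"
      by (simp add: differential_def numeral_2_eq_2)
    then have "differential S A 1 \<tau> = (\<lambda>s\<in>carrier (level S 2). \<one>) \<longleftrightarrow>
        (\<forall>s\<in>carrier (level S 2). differential S A 1 \<tau> s = \<one>)"
      by (metis (no_types, lifting) extensionalityI restrict_apply' restrict_extensional)
    ultimately show ?thesis
      by blast
  qed
  moreover have "cocycles S A 1 = (cochains S A 1)\<lparr>carrier := kernel (cochains S A 1) (cochains S A 2) (differential S A 1)\<rparr>"
    by (simp add: cocycles_def numeral_2_eq_2)
  ultimately show ?thesis
    by (auto simp: kernel_def cochains_def)
qed

text \<open>The cocycle identity is preserved by pointwise products and inverses because A is
  commutative.\<close>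

lemma comm_group_cocycles_1:
  assumes S: "well_formed_plots (level S 1)"
    and f: "\<forall>s\<in>carrier (level S 2). \<forall>i\<le>2. face S 2 i s \<in> carrier (level S 1)"
  shows "comm_group (cocycles S A 1)"
proof -
  note iff = carrier_cocycles_1[OF f]
  let ?D = "carrier (level S 1)"
  have "comm_group \<lparr>carrier = carrier (cocycles S A 1), mult = (\<lambda>\<sigma> \<tau>. \<lambda>s\<in>?D. \<sigma> s \<otimes> \<tau> s), one = (\<lambda>s\<in>?D. \<one>)\<rparr>"
  proof (rule pointwise_comm_group)
    have mem: "\<sigma> (face S 2 i s) \<in> carrier A" if "\<sigma> \<in> carrier (cocycles S A 1)" "s \<in> carrier (level S 2)" "i \<le> 2" for \<sigma> i s
    proof (rule smooth_functions_closed[where Y = "level S 1"])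
      show "\<sigma> \<in> smooth_functions (level S 1) (group_space A)"
        using that(1) unfolding iff by blast
      show "face S 2 i s \<in> ?D"
        using f that by blast
    qed
    have eq: "\<sigma> (face S 2 1 s) = \<sigma> (face S 2 0 s) \<otimes> \<sigma> (face S 2 2 s)"
      if "\<sigma> \<in> carrier (cocycles S A 1)" "s \<in> carrier (level S 2)" for \<sigma> s
      using that unfolding iff by blast
    have face: "face S 2 i s \<in> ?D" if "s \<in> carrier (level S 2)" "i \<le> 2" for s i
      using f that by blast
    fix \<sigma> assume \<sigma>: "\<sigma> \<in> carrier (cocycles S A 1)"
    then have s\<sigma>: "\<sigma> \<in> smooth_functions (level S 1) (group_space A)"
      unfolding iff by blast
    then show "\<sigma> \<in> ?D \<rightarrow>\<^sub>E carrier A"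
      by (rule smooth_functions_PiE)
    show "(\<lambda>s\<in>?D. inv (\<sigma> s)) \<in> carrier (cocycles S A 1)"
      unfolding iff
    proof (intro conjI ballI smooth_functions_inv[OF S s\<sigma>])
      fix s assume s: "s \<in> carrier (level S 2)"
      show "(\<lambda>s\<in>?D. inv (\<sigma> s)) (face S 2 1 s) = (\<lambda>s\<in>?D. inv (\<sigma> s)) (face S 2 0 s) \<otimes> (\<lambda>s\<in>?D. inv (\<sigma> s)) (face S 2 2 s)"
        using inv_mult[OF mem[OF \<sigma> s, of 0] mem[OF \<sigma> s, of 2]] face[OF s, of 0] face[OF s, of 1] face[OF s, of 2]
        by (simp only: restrict_apply' eq[OF \<sigma> s] le_refl zero_le one_le_numeral)
    qed
    fix \<tau> assume \<tau>: "\<tau> \<in> carrier (cocycles S A 1)"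
    then have s\<tau>: "\<tau> \<in> smooth_functions (level S 1) (group_space A)"
      unfolding iff by blast
    show "(\<lambda>s\<in>?D. \<sigma> s \<otimes> \<tau> s) \<in> carrier (cocycles S A 1)"
      unfolding iff
    proof (intro conjI ballI smooth_functions_mult[OF S s\<sigma> s\<tau>])
      fix s assume s: "s \<in> carrier (level S 2)"
      show "(\<lambda>s\<in>?D. \<sigma> s \<otimes> \<tau> s) (face S 2 1 s) = (\<lambda>s\<in>?D. \<sigma> s \<otimes> \<tau> s) (face S 2 0 s) \<otimes> (\<lambda>s\<in>?D. \<sigma> s \<otimes> \<tau> s) (face S 2 2 s)"
        using mem[OF \<sigma> s, of 0] mem[OF \<sigma> s, of 2] mem[OF \<tau> s, of 0] mem[OF \<tau> s, of 2]
          face[OF s, of 0] face[OF s, of 1] face[OF s, of 2]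
        by (simp only: restrict_apply' eq[OF \<sigma> s] eq[OF \<tau> s] le_refl zero_le one_le_numeral m_ac m_closed)
    qed
  next
    show "(\<lambda>s\<in>?D. \<one>) \<in> carrier (cocycles S A 1)"
      unfolding iff
    proof (intro conjI ballI smooth_functions_one[OF S])
      fix s assume "s \<in> carrier (level S 2)"
      then have "face S 2 i s \<in> ?D" if "i \<le> 2" for i
        using f that by blast
      then show "(\<lambda>s\<in>?D. \<one>) (face S 2 1 s) = (\<lambda>s\<in>?D. \<one>) (face S 2 0 s) \<otimes> (\<lambda>s\<in>?D. \<one>) (face S 2 2 s)"
        by simp
    qed
  qed
  also have "\<lparr>carrier = carrier (cocycles S A 1), mult = (\<lambda>\<sigma> \<tau>. \<lambda>s\<in>?D. \<sigma> s \<otimes> \<tau> s), one = (\<lambda>s\<in>?D. \<one>)\<rparr> = cocycles S A 1"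
    by (simp add: cocycles_def cochains_def)
  finally show ?thesis .
qed

lemma mult_cocycles [simp]:
  "\<sigma> \<otimes>\<^bsub>cocycles S A n\<^esub> \<tau> = (\<lambda>s\<in>carrier (level S n). \<sigma> s \<otimes> \<tau> s)"
  by (simp add: cocycles_def cochains_def)

end

section \<open>The comparison map on cocycles\<close>

lemma Cech_nerve_simps [simp]:
  "level (Cech_nerve X) = fiber_product X" "face (Cech_nerve X) k i = omit i"
  by (simp_all add: Cech_nerve_def)

lemma level_Q: "level (Q X) k = coproduct_space (plot_chains X k) (\<lambda>c. manifold_space (fst (hd (fst c))))"
  by (simp add: Q_def case_prod_unfold)

lemma face_Q [simp]: "face (Q X) = Q_face"
  by (simp add: Q_def)

lemma well_formed_plots_Cech: "well_formed_plots (level (Cech_nerve X) k)"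
  by (auto simp: well_formed_plots_def plots_fiber_product)

lemma well_formed_plots_Q: "well_formed_plots (level (Q X) k)"
  unfolding well_formed_plots_def level_Q using coproduct_plotD by blast

lemma plot_mapsD:
  assumes "f \<in> plot_maps p q"
  shows "f \<in> smooth_maps (fst p) (fst q)" "x \<in> points (fst p) \<Longrightarrow> snd q (f x) = snd p x"
    "x \<in> points (fst p) \<Longrightarrow> f x \<in> points (fst q)"
proof -
  show f: "f \<in> smooth_maps (fst p) (fst q)"
    using assms by (simp add: plot_maps_def)
  show "x \<in> points (fst p) \<Longrightarrow> f x \<in> points (fst q)"
    using smooth_mapsD(1)[OF f] by auto
  have "compose (points (fst p)) (snd q) f = snd p"
    using assms by (simp add: plot_maps_def)
  then show "x \<in> points (fst p) \<Longrightarrow> snd q (f x) = snd p x"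
    by (metis compose_eq)
qed

lemma plot_chains_0: "c \<in> plot_chains X 0 \<longleftrightarrow> (\<exists>p. c = ([p], []) \<and> p \<in> plots X)"
  by (cases c) (auto simp: plot_chains_def length_Suc_conv)

lemma plot_chains_1:
  "c \<in> plot_chains X 1 \<longleftrightarrow> (\<exists>p\<^sub>1 p\<^sub>0 f. c = ([p\<^sub>1, p\<^sub>0], [f]) \<and> p\<^sub>1 \<in> plots X \<and> p\<^sub>0 \<in> plots X \<and> f \<in> plot_maps p\<^sub>1 p\<^sub>0)"
  by (cases c) (auto simp: plot_chains_def length_Suc_conv)

lemma plot_chains_2:
  "c \<in> plot_chains X 2 \<longleftrightarrow> (\<exists>p\<^sub>2 p\<^sub>1 p\<^sub>0 f\<^sub>1 f\<^sub>0. c = ([p\<^sub>2, p\<^sub>1, p\<^sub>0], [f\<^sub>1, f\<^sub>0]) \<and>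
     p\<^sub>2 \<in> plots X \<and> p\<^sub>1 \<in> plots X \<and> p\<^sub>0 \<in> plots X \<and> f\<^sub>1 \<in> plot_maps p\<^sub>2 p\<^sub>1 \<and> f\<^sub>0 \<in> plot_maps p\<^sub>1 p\<^sub>0)"
  by (cases c) (auto simp: plot_chains_def length_Suc_conv numeral_2_eq_2 All_less_Suc2)

lemma carrier_level_Q:
  "(c, x) \<in> carrier (level (Q X) k) \<longleftrightarrow> c \<in> plot_chains X k \<and> x \<in> points (fst (hd (fst c)))"
  by (simp add: level_Q)

lemma carrier_level_Q_0 [simp]:
  "(([p], []), x) \<in> carrier (level (Q X) 0) \<longleftrightarrow> p \<in> plots X \<and> x \<in> points (fst p)"
  by (simp add: carrier_level_Q plot_chains_0)

lemma carrier_level_Q_1 [simp]: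
  "(([p\<^sub>1, p\<^sub>0], [f]), x) \<in> carrier (level (Q X) 1) \<longleftrightarrow> p\<^sub>1 \<in> plots X \<and> p\<^sub>0 \<in> plots X \<and>
     f \<in> plot_maps p\<^sub>1 p\<^sub>0 \<and> x \<in> points (fst p\<^sub>1)"
  unfolding carrier_level_Q plot_chains_1 by simp

lemma carrier_level_Q_0E:
  assumes "s \<in> carrier (level (Q X) 0)"
  obtains p x where "s = (([p], []), x)" "p \<in> plots X" "x \<in> points (fst p)"
  using assms by (cases s) (auto simp: carrier_level_Q plot_chains_0)

lemma carrier_level_Q_1E:
  assumes "s \<in> carrier (level (Q X) 1)"
  obtains p\<^sub>1 p\<^sub>0 f x where "s = (([p\<^sub>1, p\<^sub>0], [f]), x)" "p\<^sub>1 \<in> plots X" "p\<^sub>0 \<in> plots X"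
    "f \<in> plot_maps p\<^sub>1 p\<^sub>0" "x \<in> points (fst p\<^sub>1)"
  using assms unfolding carrier_level_Q[of "fst s" "snd s", simplified] plot_chains_1 by (cases s) auto

lemma carrier_level_Q_2E:
  assumes "s \<in> carrier (level (Q X) 2)"
  obtains p\<^sub>2 p\<^sub>1 p\<^sub>0 f\<^sub>1 f\<^sub>0 x where "s = (([p\<^sub>2, p\<^sub>1, p\<^sub>0], [f\<^sub>1, f\<^sub>0]), x)"
    "p\<^sub>2 \<in> plots X" "p\<^sub>1 \<in> plots X" "p\<^sub>0 \<in> plots X" "f\<^sub>1 \<in> plot_maps p\<^sub>2 p\<^sub>1" "f\<^sub>0 \<in> plot_maps p\<^sub>1 p\<^sub>0"
    "x \<in> points (fst p\<^sub>2)"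
  using assms unfolding carrier_level_Q[of "fst s" "snd s", simplified] plot_chains_2 by (cases s) auto

lemma carrier_level_Q_2I:
  assumes "p\<^sub>2 \<in> plots X" "p\<^sub>1 \<in> plots X" "p\<^sub>0 \<in> plots X" "f\<^sub>1 \<in> plot_maps p\<^sub>2 p\<^sub>1" "f\<^sub>0 \<in> plot_maps p\<^sub>1 p\<^sub>0"
    "x \<in> points (fst p\<^sub>2)"
  shows "(([p\<^sub>2, p\<^sub>1, p\<^sub>0], [f\<^sub>1, f\<^sub>0]), x) \<in> carrier (level (Q X) 2)"
  using assms by (simp add: carrier_level_Q plot_chains_2)

lemma Q_face_1 [simp]:
  "Q_face 1 0 (([p\<^sub>1, p\<^sub>0], [f]), x) = (([p\<^sub>0], []), f x)"
  "Q_face 1 1 (([p\<^sub>1, p\<^sub>0], [f]), x) = (([p\<^sub>1], []), x)"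
  by (simp_all add: Q_face_def omit_def)

lemma Q_face_2 [simp]:
  "Q_face 2 0 (([p\<^sub>2, p\<^sub>1, p\<^sub>0], [f\<^sub>1, f\<^sub>0]), x) = (([p\<^sub>1, p\<^sub>0], [f\<^sub>0]), f\<^sub>1 x)"
  "Q_face 2 1 (([p\<^sub>2, p\<^sub>1, p\<^sub>0], [f\<^sub>1, f\<^sub>0]), x) = (([p\<^sub>2, p\<^sub>0], [compose (points (fst p\<^sub>2)) f\<^sub>0 f\<^sub>1]), x)"
  "Q_face 2 2 (([p\<^sub>2, p\<^sub>1, p\<^sub>0], [f\<^sub>1, f\<^sub>0]), x) = (([p\<^sub>2, p\<^sub>1], [f\<^sub>1]), x)"
  by (simp_all add: Q_face_def omit_def numeral_2_eq_2)

lemma omit_fiber_product: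
  assumes "bs \<in> carrier (fiber_product X (Suc k))" "i \<le> Suc k"
  shows "omit i bs \<in> carrier (fiber_product X k)"
proof -
  have "set (omit i bs) \<subseteq> set bs"
    using set_take_subset[of i bs] set_drop_subset[of "Suc i" bs] by (auto simp: omit_def)
  moreover have "length (omit i bs) = Suc k"
    using assms by (simp add: omit_def carrier_fiber_product)
  ultimately show ?thesis
    using assms unfolding carrier_fiber_product by blast
qed

text \<open>Naming the common value in X replaces the pairwise condition by one on each entry
  separately, so that two lists sharing an entry can be glued.\<close>

lemma carrier_fiber_product_common_value:
  "bs \<in> carrier (fiber_product X k) \<longleftrightarrow> length bs = Suc k \<and> set bs \<subseteq> (SIGMA p:plots X. points (fst p)) \<and>
     (\<exists>a. \<forall>b\<in>set bs. B_proj b = a)"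
proof -
  have "(\<forall>b\<in>set bs. \<forall>b'\<in>set bs. B_proj b = B_proj b') \<longleftrightarrow> (\<exists>a. \<forall>b\<in>set bs. B_proj b = a)"
    (is "?l \<longleftrightarrow> ?r")
  proof
    assume l: ?l
    have "B_proj b = B_proj (hd bs)" if "b \<in> set bs" for b
      using l that by (cases bs) auto
    then show ?r by blast
  qed auto
  then show ?thesis
    unfolding carrier_fiber_product by (simp only:)
qed

lemma omit_triple:
  "omit 0 [a, b, c] = [b, c]" "omit 1 [a, b, c] = [a, c]" "omit 2 [a, b, c] = [a, b]"
  by (simp_all add: omit_def)

text \<open>In this form the Cech cocycle condition ranges over composable pairs of morphisms of the
  groupoid.\<close>

lemma carrier_fiber_product_2:
  "bs \<in> carrier (fiber_product X 2) \<longleftrightarrow> (\<exists>b\<^sub>0 b\<^sub>1 b\<^sub>2. bs = [b\<^sub>0, b\<^sub>1, b\<^sub>2] \<and>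
     [b\<^sub>0, b\<^sub>1] \<in> carrier (fiber_product X 1) \<and> [b\<^sub>1, b\<^sub>2] \<in> carrier (fiber_product X 1))"
  (is "?l \<longleftrightarrow> ?r")
proof
  assume l: ?l
  then obtain b\<^sub>0 b\<^sub>1 b\<^sub>2 where bs: "bs = [b\<^sub>0, b\<^sub>1, b\<^sub>2]"
    by (auto simp: carrier_fiber_product length_Suc_conv numeral_2_eq_2)
  have "omit 2 bs \<in> carrier (fiber_product X 1)" "omit 0 bs \<in> carrier (fiber_product X 1)"
    using omit_fiber_product[of bs X 1] l by (simp_all add: numeral_2_eq_2)
  then show ?r
    unfolding bs by (simp add: omit_def)
next
  assume ?r
  then obtain b\<^sub>0 b\<^sub>1 b\<^sub>2 where "bs = [b\<^sub>0, b\<^sub>1, b\<^sub>2]" "[b\<^sub>0, b\<^sub>1] \<in> carrier (fiber_product X 1)"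
    "[b\<^sub>1, b\<^sub>2] \<in> carrier (fiber_product X 1)"
    by blast
  then show ?l
    by (auto simp: carrier_fiber_product_common_value)
qed

lemma fiber_product_1_trans:
  assumes "[b\<^sub>0, b\<^sub>1] \<in> carrier (fiber_product X 1)" "[b\<^sub>1, b\<^sub>2] \<in> carrier (fiber_product X 1)"
  shows "[b\<^sub>0, b\<^sub>2] \<in> carrier (fiber_product X 1)"
  using assms by (auto simp: carrier_fiber_product_common_value)

lemma pair_fiber_product_1 [simp]:
  "[(p, x), (q, y)] \<in> carrier (fiber_product X 1) \<longleftrightarrow> p \<in> plots X \<and> q \<in> plots X \<and>
    x \<in> points (fst p) \<and> y \<in> points (fst q) \<and> snd p x = snd q y"
  unfolding carrier_fiber_product_1 by auto

lemma phi_cochain_1: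
  assumes "(([p\<^sub>1, p\<^sub>0], [f]), x) \<in> carrier (level (Q X) 1)"
  shows "phi_cochain X 1 \<tau> (([p\<^sub>1, p\<^sub>0], [f]), x) = \<tau> [(p\<^sub>1, x), (p\<^sub>0, f x)]"
  using assms by (simp add: phi_cochain_def compose_eq Q_to_Cech_def del: One_nat_def)

lemma phi_cochain_0:
  assumes "(([p], []), x) \<in> carrier (level (Q X) 0)"
  shows "phi_cochain X 0 \<tau> (([p], []), x) = \<tau> [(p, x)]"
  using assms by (simp add: phi_cochain_def compose_eq Q_to_Cech_def)

text \<open>The constant plot \<open>\<real>\<^sup>0 \<rightarrow> X\<close> at the point below \<open>x\<close>, with its map to the plot \<open>p\<close> that picks out \<open>x\<close>.\<close>

definition const_plot :: "'x \<Rightarrow> 'x plot" where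
  "const_plot a = (euclid 0, \<lambda>_\<in>points (euclid 0). a)"

definition base_arrow :: "'x plot \<times> pt \<Rightarrow> 'x chain \<times> pt" where
  "base_arrow = (\<lambda>(p, x). (([const_plot (snd p x), p], [\<lambda>_\<in>points (euclid 0). x]), \<lambda>_. 0))"

lemma zero_in_Euclidean_space [simp]: "(\<lambda>_. 0) \<in> topspace (Euclidean_space n)"
  by (simp add: topspace_Euclidean_space)

lemma const_plot_simps [simp]: "fst (const_plot a) = euclid 0" "snd (const_plot a) (\<lambda>_. 0) = a"
  by (simp_all add: const_plot_def)

locale comparison = abelian_coefficients A for A :: "'a diffeological_group" (structure) +
  fixes X :: "'x diffeological"
  assumes X: "diffeological_space X"
begin

lemma plot_cartesian: "p \<in> plots X \<Longrightarrow> cartesian (fst p)"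
  using diffeological_spaceD(1)[OF X, of "fst p" "snd p"] by simp

lemma plot_in_carrier: "p \<in> plots X \<Longrightarrow> x \<in> points (fst p) \<Longrightarrow> snd p x \<in> carrier X"
  using diffeological_spaceD(2)[OF X, of "fst p" "snd p"] by auto

lemma plot_manifold: "p \<in> plots X \<Longrightarrow> smooth_manifold (fst p)"
  by (rule cartesian_smooth_manifold[OF plot_cartesian])

lemma plot_maps_compose:
  assumes "p\<^sub>2 \<in> plots X" "p\<^sub>1 \<in> plots X" "f\<^sub>1 \<in> plot_maps p\<^sub>2 p\<^sub>1" "f\<^sub>0 \<in> plot_maps p\<^sub>1 p\<^sub>0"
  shows "compose (points (fst p\<^sub>2)) f\<^sub>0 f\<^sub>1 \<in> plot_maps p\<^sub>2 p\<^sub>0"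
proof -
  have "compose (points (fst p\<^sub>2)) f\<^sub>0 f\<^sub>1 \<in> smooth_maps (fst p\<^sub>2) (fst p\<^sub>0)"
    using assms by (intro smooth_maps_compose[of _ "fst p\<^sub>1"] plot_manifold plot_mapsD(1))
  moreover have "compose (points (fst p\<^sub>2)) (snd p\<^sub>0) (compose (points (fst p\<^sub>2)) f\<^sub>0 f\<^sub>1) = snd p\<^sub>2"
  proof
    fix x
    show "compose (points (fst p\<^sub>2)) (snd p\<^sub>0) (compose (points (fst p\<^sub>2)) f\<^sub>0 f\<^sub>1) x = snd p\<^sub>2 x"
    proof (cases "x \<in> points (fst p\<^sub>2)")
      case True
      then show ?thesis
        using plot_mapsD[OF assms(3)] plot_mapsD[OF assms(4)] by (simp add: compose_eq)
    next
      case False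
      then show ?thesis
        using diffeological_spaceD(2)[OF X, of "fst p\<^sub>2" "snd p\<^sub>2"] assms(1)
        by (simp add: compose_def PiE_def extensional_def)
    qed
  qed
  ultimately show ?thesis
    by (simp add: plot_maps_def)
qed

lemma const_plot_in_plots: "a \<in> carrier X \<Longrightarrow> const_plot a \<in> plots X"
  unfolding const_plot_def by (rule diffeological_spaceD(3)[OF X]) auto

lemma const_plot_map:
  assumes "p \<in> plots X" "x \<in> points (fst p)"
  shows "(\<lambda>_\<in>points (euclid 0). x) \<in> plot_maps (const_plot (snd p x)) p"
  using smooth_maps_const[OF smooth_manifold_euclid plot_manifold[OF assms(1)] assms(2), of 0]
  by (auto simp: plot_maps_def const_plot_def compose_def fun_eq_iff)

lemma base_arrow_closed:
  assumes "p \<in> plots X" "x \<in> points (fst p)"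
  shows "base_arrow (p, x) \<in> carrier (level (Q X) 1)"
  unfolding base_arrow_def case_prod_conv carrier_level_Q_1
  using assms const_plot_map const_plot_in_plots plot_in_carrier by simp

lemma smooth_Q_0:
  "\<sigma> \<in> smooth_functions (level (Q X) 0) (group_space A) \<longleftrightarrow> \<sigma> \<in> carrier (level (Q X) 0) \<rightarrow>\<^sub>E carrier A \<and>
    (\<forall>p\<in>plots X. (fst p, \<lambda>x\<in>points (fst p). \<sigma> (([p], []), x)) \<in> group_plots A)"
proof -
  have "(\<forall>c\<in>plot_chains X 0. P c) \<longleftrightarrow> (\<forall>p\<in>plots X. P ([p], []))" for P
    unfolding Ball_def plot_chains_0 by blast
  moreover have "cartesian (fst (hd (fst c)))" if "c \<in> plot_chains X 0" for c
    using that plot_cartesian unfolding plot_chains_0 by auto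
  ultimately show ?thesis
    unfolding level_Q by (subst smooth_functions_coproduct[OF dspace]) auto
qed

lemma smooth_Q_1:
  "\<rho> \<in> smooth_functions (level (Q X) 1) (group_space A) \<longleftrightarrow> \<rho> \<in> carrier (level (Q X) 1) \<rightarrow>\<^sub>E carrier A \<and>
    (\<forall>p\<^sub>1\<in>plots X. \<forall>p\<^sub>0\<in>plots X. \<forall>f\<in>plot_maps p\<^sub>1 p\<^sub>0.
       (fst p\<^sub>1, \<lambda>x\<in>points (fst p\<^sub>1). \<rho> (([p\<^sub>1, p\<^sub>0], [f]), x)) \<in> group_plots A)"
proof -
  have "(\<forall>c\<in>plot_chains X 1. P c) \<longleftrightarrow>
      (\<forall>p\<^sub>1\<in>plots X. \<forall>p\<^sub>0\<in>plots X. \<forall>f\<in>plot_maps p\<^sub>1 p\<^sub>0. P ([p\<^sub>1, p\<^sub>0], [f]))" for P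
    unfolding Ball_def plot_chains_1 by blast
  moreover have "cartesian (fst (hd (fst c)))" if "c \<in> plot_chains X 1" for c
    using that plot_cartesian unfolding plot_chains_1 by auto
  ultimately show ?thesis
    unfolding level_Q by (subst smooth_functions_coproduct[OF dspace]) auto
qed

lemma faces_Cech: "\<forall>s\<in>carrier (level (Cech_nerve X) 2). \<forall>i\<le>2. face (Cech_nerve X) 2 i s \<in> carrier (level (Cech_nerve X) 1)"
  using omit_fiber_product[of _ X 1] by (simp add: numeral_2_eq_2)

lemma faces_Q: "\<forall>s\<in>carrier (level (Q X) 2). \<forall>i\<le>2. face (Q X) 2 i s \<in> carrier (level (Q X) 1)"
proof (intro ballI allI impI)
  fix s and i :: nat assume s: "s \<in> carrier (level (Q X) 2)" and i: "i \<le> 2"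
  obtain p\<^sub>2 p\<^sub>1 p\<^sub>0 f\<^sub>1 f\<^sub>0 x where s: "s = (([p\<^sub>2, p\<^sub>1, p\<^sub>0], [f\<^sub>1, f\<^sub>0]), x)"
    and p: "p\<^sub>2 \<in> plots X" "p\<^sub>1 \<in> plots X" "p\<^sub>0 \<in> plots X" and f: "f\<^sub>1 \<in> plot_maps p\<^sub>2 p\<^sub>1" "f\<^sub>0 \<in> plot_maps p\<^sub>1 p\<^sub>0"
    and x: "x \<in> points (fst p\<^sub>2)"
    using s by (rule carrier_level_Q_2E)
  from i consider "i = 0" | "i = 1" | "i = 2" by linarith
  then show "face (Q X) 2 i s \<in> carrier (level (Q X) 1)"
    by cases (simp_all only: face_Q s Q_face_2 carrier_level_Q_1, use p f x in \<open>auto intro: plot_maps_compose plot_mapsD(3)\<close>)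
qed

lemma Cech_cocycle_iff:
  "\<tau> \<in> carrier (cocycles (Cech_nerve X) A 1) \<longleftrightarrow> \<tau> \<in> smooth_functions (fiber_product X 1) (group_space A) \<and>
    (\<forall>b\<^sub>0 b\<^sub>1 b\<^sub>2. [b\<^sub>0, b\<^sub>1] \<in> carrier (fiber_product X 1) \<longrightarrow> [b\<^sub>1, b\<^sub>2] \<in> carrier (fiber_product X 1) \<longrightarrow>
       \<tau> [b\<^sub>0, b\<^sub>2] = \<tau> [b\<^sub>1, b\<^sub>2] \<otimes> \<tau> [b\<^sub>0, b\<^sub>1])"
proof -
  have eq: "(\<forall>s\<in>carrier (fiber_product X 2). P s) \<longleftrightarrow>
    (\<forall>b\<^sub>0 b\<^sub>1 b\<^sub>2. [b\<^sub>0, b\<^sub>1] \<in> carrier (fiber_product X 1) \<longrightarrow> [b\<^sub>1, b\<^sub>2] \<in> carrier (fiber_product X 1) \<longrightarrow> P [b\<^sub>0, b\<^sub>1, b\<^sub>2])" for P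
    unfolding Ball_def carrier_fiber_product_2 by blast
  show ?thesis
    unfolding carrier_cocycles_1[OF faces_Cech] Cech_nerve_simps eq omit_triple ..
qed

lemma Q_cocycle_iff:
  "\<rho> \<in> carrier (cocycles (Q X) A 1) \<longleftrightarrow> \<rho> \<in> smooth_functions (level (Q X) 1) (group_space A) \<and>
    (\<forall>p\<^sub>2\<in>plots X. \<forall>p\<^sub>1\<in>plots X. \<forall>p\<^sub>0\<in>plots X. \<forall>f\<^sub>1\<in>plot_maps p\<^sub>2 p\<^sub>1. \<forall>f\<^sub>0\<in>plot_maps p\<^sub>1 p\<^sub>0. \<forall>x\<in>points (fst p\<^sub>2).
       \<rho> (([p\<^sub>2, p\<^sub>0], [compose (points (fst p\<^sub>2)) f\<^sub>0 f\<^sub>1]), x) = \<rho> (([p\<^sub>1, p\<^sub>0], [f\<^sub>0]), f\<^sub>1 x) \<otimes> \<rho> (([p\<^sub>2, p\<^sub>1], [f\<^sub>1]), x))"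
proof -
  have eq: "(\<forall>s\<in>carrier (level (Q X) 2). P s) \<longleftrightarrow>
    (\<forall>p\<^sub>2\<in>plots X. \<forall>p\<^sub>1\<in>plots X. \<forall>p\<^sub>0\<in>plots X. \<forall>f\<^sub>1\<in>plot_maps p\<^sub>2 p\<^sub>1. \<forall>f\<^sub>0\<in>plot_maps p\<^sub>1 p\<^sub>0. \<forall>x\<in>points (fst p\<^sub>2).
      P (([p\<^sub>2, p\<^sub>1, p\<^sub>0], [f\<^sub>1, f\<^sub>0]), x))" for P
  proof (intro iffI ballI)
    fix s assume all: "\<forall>p\<^sub>2\<in>plots X. \<forall>p\<^sub>1\<in>plots X. \<forall>p\<^sub>0\<in>plots X. \<forall>f\<^sub>1\<in>plot_maps p\<^sub>2 p\<^sub>1. \<forall>f\<^sub>0\<in>plot_maps p\<^sub>1 p\<^sub>0.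
        \<forall>x\<in>points (fst p\<^sub>2). P (([p\<^sub>2, p\<^sub>1, p\<^sub>0], [f\<^sub>1, f\<^sub>0]), x)"
      and "s \<in> carrier (level (Q X) 2)"
    from this(2) show "P s"
      by (rule carrier_level_Q_2E) (use all in simp)
  qed (blast intro: carrier_level_Q_2I)
  show ?thesis
    unfolding carrier_cocycles_1[OF faces_Q] face_Q eq Q_face_2 ..
qed

section \<open>Transfer of 1-cocycles between the Cech groupoid and QX\<close>

lemma Q_to_Cech_closed:
  assumes "s \<in> carrier (level (Q X) 1)"
  shows "Q_to_Cech s \<in> carrier (fiber_product X 1)"
proof -
  obtain p\<^sub>1 p\<^sub>0 f x where s: "s = (([p\<^sub>1, p\<^sub>0], [f]), x)" and p: "p\<^sub>1 \<in> plots X" "p\<^sub>0 \<in> plots X"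
    and f: "f \<in> plot_maps p\<^sub>1 p\<^sub>0" and x: "x \<in> points (fst p\<^sub>1)"
    using assms by (rule carrier_level_Q_1E)
  have "Q_to_Cech s = [(p\<^sub>1, x), (p\<^sub>0, f x)]"
    by (simp add: s Q_to_Cech_def)
  then show ?thesis
    using p x plot_mapsD(2,3)[OF f x] by (simp only: pair_fiber_product_1)
qed

lemma smooth_fiber_product_1D:
  assumes "\<tau> \<in> smooth_functions (fiber_product X 1) (group_space A)" "cartesian V" "p \<in> plots X" "q \<in> plots X"
    "g \<in> smooth_maps V (fst p)" "h \<in> smooth_maps V (fst q)" "\<And>x. x \<in> points V \<Longrightarrow> snd p (g x) = snd q (h x)"
  shows "(V, \<lambda>x\<in>points V. \<tau> [(p, g x), (q, h x)]) \<in> group_plots A"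
  using assms unfolding smooth_functions_fiber_product_1[OF X dspace] group_space_simps by blast

lemma Q_cocycleD:
  assumes "\<rho> \<in> carrier (cocycles (Q X) A 1)" "p\<^sub>2 \<in> plots X" "p\<^sub>1 \<in> plots X" "p\<^sub>0 \<in> plots X"
    "f\<^sub>1 \<in> plot_maps p\<^sub>2 p\<^sub>1" "f\<^sub>0 \<in> plot_maps p\<^sub>1 p\<^sub>0" "x \<in> points (fst p\<^sub>2)"
  shows "\<rho> (([p\<^sub>2, p\<^sub>0], [compose (points (fst p\<^sub>2)) f\<^sub>0 f\<^sub>1]), x) = \<rho> (([p\<^sub>1, p\<^sub>0], [f\<^sub>0]), f\<^sub>1 x) \<otimes> \<rho> (([p\<^sub>2, p\<^sub>1], [f\<^sub>1]), x)"
  using assms unfolding Q_cocycle_iff by blast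

text \<open>On the summand of a map of plots \<open>f\<close>, the comparison is the pair consisting
  of the identity and \<open>f\<close>. This pair lies over X because \<open>f\<close> is a map of
  plots, so the criterion for the fibre square applies.\<close>

lemma phi_cochain_smooth:
  assumes \<tau>: "\<tau> \<in> smooth_functions (fiber_product X 1) (group_space A)"
  shows "phi_cochain X 1 \<tau> \<in> smooth_functions (level (Q X) 1) (group_space A)"
  unfolding smooth_Q_1
proof (intro conjI ballI)
  show "phi_cochain X 1 \<tau> \<in> carrier (level (Q X) 1) \<rightarrow>\<^sub>E carrier A"
    using Q_to_Cech_closed smooth_functions_closed[OF \<tau>] by (auto simp: phi_cochain_def compose_def)
  fix p\<^sub>1 p\<^sub>0 f assume p: "p\<^sub>1 \<in> plots X" "p\<^sub>0 \<in> plots X" and f: "f \<in> plot_maps p\<^sub>1 p\<^sub>0"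
  have "(fst p\<^sub>1, \<lambda>x\<in>points (fst p\<^sub>1). \<tau> [(p\<^sub>1, (\<lambda>x\<in>points (fst p\<^sub>1). x) x), (p\<^sub>0, f x)]) \<in> group_plots A"
    by (rule smooth_fiber_product_1D[OF \<tau> plot_cartesian[OF p(1)] p smooth_maps_id[OF plot_manifold[OF p(1)]] plot_mapsD(1)[OF f]])
      (simp add: plot_mapsD(2)[OF f])
  moreover have "(\<lambda>x\<in>points (fst p\<^sub>1). \<tau> [(p\<^sub>1, (\<lambda>x\<in>points (fst p\<^sub>1). x) x), (p\<^sub>0, f x)]) =
      (\<lambda>x\<in>points (fst p\<^sub>1). phi_cochain X 1 \<tau> (([p\<^sub>1, p\<^sub>0], [f]), x))"
    using p f phi_cochain_1[of p\<^sub>1 p\<^sub>0 f _ X \<tau>] by (simp only: carrier_level_Q_1) (simp cong: restrict_cong)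
  ultimately show "(fst p\<^sub>1, \<lambda>x\<in>points (fst p\<^sub>1). phi_cochain X 1 \<tau> (([p\<^sub>1, p\<^sub>0], [f]), x)) \<in> group_plots A"
    by simp
qed

text \<open>The three successive images of \<open>x\<close> along a chain of length 2 form a
  composable pair in the groupoid, and its Cech identity is the identity required on the
  chain.\<close>

lemma phi_cochain_cocycle:
  assumes \<tau>: "\<tau> \<in> carrier (cocycles (Cech_nerve X) A 1)"
  shows "phi_cochain X 1 \<tau> \<in> carrier (cocycles (Q X) A 1)"
  unfolding Q_cocycle_iff
proof (intro conjI ballI)
  show "phi_cochain X 1 \<tau> \<in> smooth_functions (level (Q X) 1) (group_space A)"
    using \<tau> unfolding Cech_cocycle_iff by (blast intro: phi_cochain_smooth)
  fix p\<^sub>2 p\<^sub>1 p\<^sub>0 f\<^sub>1 f\<^sub>0 x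
  assume p: "p\<^sub>2 \<in> plots X" "p\<^sub>1 \<in> plots X" "p\<^sub>0 \<in> plots X" and f: "f\<^sub>1 \<in> plot_maps p\<^sub>2 p\<^sub>1" "f\<^sub>0 \<in> plot_maps p\<^sub>1 p\<^sub>0"
    and x: "x \<in> points (fst p\<^sub>2)"
  note f1 = plot_mapsD(2,3)[OF f(1) x] and f0 = plot_mapsD(2,3)[OF f(2) plot_mapsD(3)[OF f(1) x]]
  let ?f = "compose (points (fst p\<^sub>2)) f\<^sub>0 f\<^sub>1"
  have fx: "?f x = f\<^sub>0 (f\<^sub>1 x)"
    using x by (simp add: compose_eq)
  have "(([p\<^sub>2, p\<^sub>0], [?f]), x) \<in> carrier (level (Q X) 1)" "(([p\<^sub>1, p\<^sub>0], [f\<^sub>0]), f\<^sub>1 x) \<in> carrier (level (Q X) 1)"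
    "(([p\<^sub>2, p\<^sub>1], [f\<^sub>1]), x) \<in> carrier (level (Q X) 1)"
    unfolding carrier_level_Q_1 using p f x f1 plot_maps_compose[OF p(1,2) f] by auto
  then have vals: "phi_cochain X 1 \<tau> (([p\<^sub>2, p\<^sub>0], [?f]), x) = \<tau> [(p\<^sub>2, x), (p\<^sub>0, f\<^sub>0 (f\<^sub>1 x))]"
    "phi_cochain X 1 \<tau> (([p\<^sub>1, p\<^sub>0], [f\<^sub>0]), f\<^sub>1 x) = \<tau> [(p\<^sub>1, f\<^sub>1 x), (p\<^sub>0, f\<^sub>0 (f\<^sub>1 x))]"
    "phi_cochain X 1 \<tau> (([p\<^sub>2, p\<^sub>1], [f\<^sub>1]), x) = \<tau> [(p\<^sub>2, x), (p\<^sub>1, f\<^sub>1 x)]"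
    by (simp_all only: phi_cochain_1 fx)
  have "[(p\<^sub>2, x), (p\<^sub>1, f\<^sub>1 x)] \<in> carrier (fiber_product X 1)"
    "[(p\<^sub>1, f\<^sub>1 x), (p\<^sub>0, f\<^sub>0 (f\<^sub>1 x))] \<in> carrier (fiber_product X 1)"
    unfolding pair_fiber_product_1 using p x f1 f0 by auto
  then show "phi_cochain X 1 \<tau> (([p\<^sub>2, p\<^sub>0], [?f]), x) =
      phi_cochain X 1 \<tau> (([p\<^sub>1, p\<^sub>0], [f\<^sub>0]), f\<^sub>1 x) \<otimes> phi_cochain X 1 \<tau> (([p\<^sub>2, p\<^sub>1], [f\<^sub>1]), x)"
    using \<tau> unfolding vals Cech_cocycle_iff by blast
qed

text \<open>The cocycle identity at the point of \<open>\<real>\<^sup>0\<close> for the chain from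
  the constant plot below \<open>x\<close> through \<open>r\<close> to \<open>p\<close>. Its
  composite is again a base arrow, since \<open>f x\<close> and \<open>x\<close> have the same value
  in X and thus the same constant plot below them.\<close>

lemma Q_cocycle_base_arrow:
  assumes \<rho>: "\<rho> \<in> carrier (cocycles (Q X) A 1)"
    and r: "r \<in> plots X" "p \<in> plots X" "f \<in> plot_maps r p" "x \<in> points (fst r)"
  shows "\<rho> (base_arrow (p, f x)) = \<rho> (([r, p], [f]), x) \<otimes> \<rho> (base_arrow (r, x))"
proof -
  note fx = plot_mapsD(2,3)[OF r(3,4)]
  let ?c = "const_plot (snd r x)" and ?g = "\<lambda>_\<in>points (euclid 0). x"
  have c: "?c \<in> plots X" "?g \<in> plot_maps ?c r"
    using r(1,4) const_plot_in_plots plot_in_carrier const_plot_map by auto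
  have "\<rho> (([?c, p], [compose (points (fst ?c)) f ?g]), \<lambda>_. 0) =
      \<rho> (([r, p], [f]), ?g (\<lambda>_. 0)) \<otimes> \<rho> (([?c, r], [?g]), \<lambda>_. 0)"
    by (rule Q_cocycleD[OF \<rho> c(1) r(1,2) c(2) r(3)]) simp
  moreover have "compose (points (fst ?c)) f ?g = (\<lambda>_\<in>points (euclid 0). f x)"
    by (auto simp: compose_def)
  moreover have "?g (\<lambda>_. 0) = x"
    by simp
  ultimately show ?thesis
    by (simp only: base_arrow_def case_prod_conv fx)
qed

text \<open>The Cech identity for the triple \<open>?c\<close>, \<open>(p, x)\<close>,
  \<open>(q, y)\<close>. Because both points lie over the same point of X, the one constant plot
  \<open>?c\<close> is the source of both base arrows. Hence a Cech cocycle can be recovered from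
  its image, which gives injectivity.\<close>

lemma Cech_cocycle_eq:
  assumes \<tau>: "\<tau> \<in> carrier (cocycles (Cech_nerve X) A 1)"
    and b: "[(p, x), (q, y)] \<in> carrier (fiber_product X 1)"
  shows "\<tau> [(p, x), (q, y)] = phi_cochain X 1 \<tau> (base_arrow (q, y)) \<otimes> inv (phi_cochain X 1 \<tau> (base_arrow (p, x)))"
proof -
  have pq: "p \<in> plots X" "q \<in> plots X" "x \<in> points (fst p)" "y \<in> points (fst q)" and eq: "snd p x = snd q y"
    using b unfolding pair_fiber_product_1 by auto
  let ?c = "(const_plot (snd p x), \<lambda>_. 0)"
  have c: "[?c, (p, x)] \<in> carrier (fiber_product X 1)"
    unfolding pair_fiber_product_1 using pq const_plot_in_plots plot_in_carrier by auto
  have *: "phi_cochain X 1 \<tau> (base_arrow (p', x')) = \<tau> [(const_plot (snd p' x'), \<lambda>_. 0), (p', x')]"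
    if "p' \<in> plots X" "x' \<in> points (fst p')" for p' x'
    using phi_cochain_1[of "const_plot (snd p' x')" p' "\<lambda>_\<in>points (euclid 0). x'" "\<lambda>_. 0" X \<tau>]
      base_arrow_closed[OF that] restrict_apply'[of "\<lambda>_. 0" "points (euclid 0)" "\<lambda>_. x'"]
    unfolding base_arrow_def case_prod_conv by simp
  have "\<tau> [?c, (q, y)] = \<tau> [(p, x), (q, y)] \<otimes> \<tau> [?c, (p, x)]"
    using \<tau> b c unfolding Cech_cocycle_iff by blast
  moreover have s: "\<tau> \<in> smooth_functions (fiber_product X 1) (group_space A)"
    using \<tau> unfolding Cech_cocycle_iff by blast
  ultimately show ?thesis
    using *[OF pq(1,3)] *[OF pq(2,4)] eq smooth_functions_closed[OF s b] smooth_functions_closed[OF s c]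
    by (simp add: m_assoc)
qed

text \<open>\<open>Cech_cocycle_eq\<close> leaves no choice for \<tau>; what remains is that this
  candidate is smooth, is a cocycle and maps to \<rho>.\<close>

lemma phi_cochain_surj:
  assumes \<rho>: "\<rho> \<in> carrier (cocycles (Q X) A 1)"
  obtains \<tau> where "\<tau> \<in> carrier (cocycles (Cech_nerve X) A 1)" "phi_cochain X 1 \<tau> = \<rho>"
proof -
  let ?C = "carrier (fiber_product X 1)"
  have s: "\<rho> \<in> smooth_functions (level (Q X) 1) (group_space A)"
    using \<rho> unfolding Q_cocycle_iff by blast
  have ba: "\<rho> (base_arrow (p, x)) \<in> carrier A" if "p \<in> plots X" "x \<in> points (fst p)" for p x
    by (rule smooth_functions_closed[OF s base_arrow_closed[OF that]])
  define \<tau> where "\<tau> = (\<lambda>bs\<in>?C. \<rho> (base_arrow (bs ! 1)) \<otimes> inv (\<rho> (base_arrow (bs ! 0))))"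
  have \<tau>: "\<tau> [b, b'] = \<rho> (base_arrow b') \<otimes> inv (\<rho> (base_arrow b))" if "[b, b'] \<in> ?C" for b b'
    using that by (simp add: \<tau>_def)
  \<comment> \<open>On every map of plots, \<rho> is the difference of the values of one function on
    B, which is not claimed to be smooth.\<close>
  have arrow: "\<rho> (([r, p], [f]), x) = \<rho> (base_arrow (p, f x)) \<otimes> inv (\<rho> (base_arrow (r, x)))"
    if r: "r \<in> plots X" "p \<in> plots X" "f \<in> plot_maps r p" "x \<in> points (fst r)" for r p f x
  proof -
    have "(([r, p], [f]), x) \<in> carrier (level (Q X) 1)"
      unfolding carrier_level_Q_1 using r by auto
    then show ?thesis
      using Q_cocycle_base_arrow[OF \<rho> r] ba[OF r(1,4)] smooth_functions_closed[OF s] by (simp add: m_assoc)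
  qed
  have "\<tau> \<in> smooth_functions (fiber_product X 1) (group_space A)"
    unfolding smooth_functions_fiber_product_1[OF X dspace]
  proof (intro conjI allI impI)
    have "\<rho> (base_arrow (bs ! 1)) \<otimes> inv (\<rho> (base_arrow (bs ! 0))) \<in> carrier A" if "bs \<in> ?C" for bs
      using that ba unfolding carrier_fiber_product_1 by auto
    then show "\<tau> \<in> ?C \<rightarrow>\<^sub>E carrier (group_space A)"
      unfolding \<tau>_def by auto
    fix V p q g h
    assume V: "cartesian V" and p: "p \<in> plots X" and q: "q \<in> plots X"
      and g: "g \<in> smooth_maps V (fst p)" and h: "h \<in> smooth_maps V (fst q)"
      and eq: "\<forall>x\<in>points V. snd p (g x) = snd q (h x)"
    \<comment> \<open>The pullback of \<open>p\<close> along \<open>g\<close>. It agrees with the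
      pullback of \<open>q\<close> along \<open>h\<close>, so both maps have the same source
      plot.\<close>
    define r where "r = (V, compose (points V) (snd p) g)"
    have r: "r \<in> plots X"
      unfolding r_def using p by (intro diffeological_spaceD(4)[OF X _ V g]) simp
    have gr: "g \<in> plot_maps r p" and hr: "h \<in> plot_maps r q"
      using g h eq by (auto simp: plot_maps_def r_def compose_def cong: restrict_cong)
    have "(V, \<lambda>x\<in>points V. \<rho> (([r, p], [g]), x)) \<in> group_plots A" "(V, \<lambda>x\<in>points V. \<rho> (([r, q], [h]), x)) \<in> group_plots A"
      using s[unfolded smooth_Q_1] r p q gr hr by (auto simp: r_def)
    from plot_mult[OF this(2) plot_inv[OF this(1)]]
    have "(V, \<lambda>x\<in>points V. \<rho> (([r, q], [h]), x) \<otimes> inv (\<rho> (([r, p], [g]), x))) \<in> group_plots A"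
      by (simp cong: restrict_cong)
    \<comment> \<open>Both values are taken relative to the base arrow of \<open>(r, x)\<close>,
      whose contribution cancels.\<close>
    moreover have "\<rho> (([r, q], [h]), x) \<otimes> inv (\<rho> (([r, p], [g]), x)) = \<tau> [(p, g x), (q, h x)]" if x: "x \<in> points V" for x
    proof -
      have xr: "x \<in> points (fst r)" using x by (simp add: r_def)
      have "[(p, g x), (q, h x)] \<in> ?C"
        unfolding pair_fiber_product_1 using p q eq x plot_mapsD(3)[OF gr xr] plot_mapsD(3)[OF hr xr] by auto
      then show ?thesis
        using ba[OF r xr] ba[OF p plot_mapsD(3)[OF gr xr]] ba[OF q plot_mapsD(3)[OF hr xr]]
        by (simp only: \<tau> arrow[OF r p gr xr] arrow[OF r q hr xr] mult_inv_cancel_right)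
    qed
    ultimately show "(V, \<lambda>x\<in>points V. \<tau> [(p, g x), (q, h x)]) \<in> plots (group_space A)"
      by (simp cong: restrict_cong)
  qed
  moreover have "\<tau> [b\<^sub>0, b\<^sub>2] = \<tau> [b\<^sub>1, b\<^sub>2] \<otimes> \<tau> [b\<^sub>0, b\<^sub>1]"
    if b: "[b\<^sub>0, b\<^sub>1] \<in> ?C" "[b\<^sub>1, b\<^sub>2] \<in> ?C" for b\<^sub>0 b\<^sub>1 b\<^sub>2
  proof -
    have "\<rho> (base_arrow b\<^sub>0) \<in> carrier A" "\<rho> (base_arrow b\<^sub>1) \<in> carrier A" "\<rho> (base_arrow b\<^sub>2) \<in> carrier A"
      using b ba unfolding carrier_fiber_product_1 by auto
    then show ?thesis
      unfolding \<tau>[OF b(1)] \<tau>[OF b(2)] \<tau>[OF fiber_product_1_trans[OF b]]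
      by (metis inv_closed l_inv m_assoc m_closed r_one)
  qed
  ultimately have \<tau>Z: "\<tau> \<in> carrier (cocycles (Cech_nerve X) A 1)"
    unfolding Cech_cocycle_iff by blast
  moreover have "phi_cochain X 1 \<tau> = \<rho>"
  proof (rule extensionalityI[of _ "carrier (level (Q X) 1)"])
    show "phi_cochain X 1 \<tau> \<in> extensional (carrier (level (Q X) 1))"
      by (simp add: phi_cochain_def compose_def)
    show "\<rho> \<in> extensional (carrier (level (Q X) 1))"
      using smooth_functions_PiE[OF s] by (simp add: PiE_def)
    fix s assume "s \<in> carrier (level (Q X) 1)"
    then obtain p\<^sub>1 p\<^sub>0 f x where s: "s = (([p\<^sub>1, p\<^sub>0], [f]), x)" and p: "p\<^sub>1 \<in> plots X" "p\<^sub>0 \<in> plots X"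
      and f: "f \<in> plot_maps p\<^sub>1 p\<^sub>0" and x: "x \<in> points (fst p\<^sub>1)"
      by (rule carrier_level_Q_1E)
    have "[(p\<^sub>1, x), (p\<^sub>0, f x)] \<in> ?C"
      unfolding pair_fiber_product_1 using p x plot_mapsD(2,3)[OF f x] by auto
    moreover have "(([p\<^sub>1, p\<^sub>0], [f]), x) \<in> carrier (level (Q X) 1)"
      unfolding carrier_level_Q_1 using p f x by auto
    ultimately show "phi_cochain X 1 \<tau> s = \<rho> s"
      by (simp only: s phi_cochain_1 \<tau> arrow[OF p f x])
  qed
  ultimately show thesis
    by (rule that)
qed

lemma phi_cochain_iso: "phi_cochain X 1 \<in> iso (cocycles (Cech_nerve X) A 1) (cocycles (Q X) A 1)"
  unfolding iso_def bij_betw_def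
proof (intro CollectI conjI)
  show "phi_cochain X 1 \<in> hom (cocycles (Cech_nerve X) A 1) (cocycles (Q X) A 1)"
  proof (rule homI)
    show "phi_cochain X 1 \<tau> \<in> carrier (cocycles (Q X) A 1)" if "\<tau> \<in> carrier (cocycles (Cech_nerve X) A 1)" for \<tau>
      by (rule phi_cochain_cocycle[OF that])
    show "phi_cochain X 1 (\<sigma> \<otimes>\<^bsub>cocycles (Cech_nerve X) A 1\<^esub> \<tau>) = phi_cochain X 1 \<sigma> \<otimes>\<^bsub>cocycles (Q X) A 1\<^esub> phi_cochain X 1 \<tau>" for \<sigma> \<tau>
      using Q_to_Cech_closed by (auto simp: phi_cochain_def compose_def fun_eq_iff)
  qed
  \<comment> \<open>Each value of a Cech cocycle is determined by the image cochain on base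
    arrows.\<close>
  show "inj_on (phi_cochain X 1) (carrier (cocycles (Cech_nerve X) A 1))"
  proof (rule inj_onI)
    fix \<sigma> \<tau> assume \<sigma>: "\<sigma> \<in> carrier (cocycles (Cech_nerve X) A 1)" and \<tau>: "\<tau> \<in> carrier (cocycles (Cech_nerve X) A 1)"
      and eq: "phi_cochain X 1 \<sigma> = phi_cochain X 1 \<tau>"
    show "\<sigma> = \<tau>"
    proof (rule extensionalityI[of _ "carrier (fiber_product X 1)"])
      show "\<sigma> \<in> extensional (carrier (fiber_product X 1))" "\<tau> \<in> extensional (carrier (fiber_product X 1))"
        using \<sigma> \<tau> smooth_functions_PiE unfolding Cech_cocycle_iff PiE_def by blast+
      fix bs assume bs: "bs \<in> carrier (fiber_product X 1)"
      then obtain p x q y where "bs = [(p, x), (q, y)]"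
        unfolding carrier_fiber_product_1 by blast
      with bs show "\<sigma> bs = \<tau> bs"
        using Cech_cocycle_eq[OF \<sigma>, of p x q y] Cech_cocycle_eq[OF \<tau>, of p x q y] eq by simp
    qed
  qed
  show "phi_cochain X 1 ` carrier (cocycles (Cech_nerve X) A 1) = carrier (cocycles (Q X) A 1)"
    using phi_cochain_cocycle phi_cochain_surj by (auto simp: image_iff) metis
qed

end

section \<open>The comparison map on cohomology\<close>

context comparison
begin

lemma carrier_cochains [simp]: "carrier (cochains S A n) = smooth_functions (level S n) (group_space A)"
  by (simp add: cochains_def)

section \<open>Coboundaries in degree 1 and their comparison\<close>

lemma differential_Cech_0:
  assumes \<sigma>: "\<sigma> \<in> smooth_functions (fiber_product X 0) (group_space A)"
    and b: "[b, b'] \<in> carrier (fiber_product X 1)"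
  shows "differential (Cech_nerve X) A 0 \<sigma> [b, b'] = \<sigma> [b'] \<otimes> inv (\<sigma> [b])"
    and "\<sigma> [b] \<in> carrier A" "\<sigma> [b'] \<in> carrier A"
proof -
  have f: "\<forall>i\<le>1. face (Cech_nerve X) 1 i [b, b'] \<in> carrier (level (Cech_nerve X) 0)"
    using omit_fiber_product[of "[b, b']" X 0] b by simp
  have o: "omit 0 [b, b'] = [b']" "omit 1 [b, b'] = [b]"
    by (simp_all add: omit_def)
  show "differential (Cech_nerve X) A 0 \<sigma> [b, b'] = \<sigma> [b'] \<otimes> inv (\<sigma> [b])"
    using differential_0[of \<sigma> "Cech_nerve X" "[b, b']"] \<sigma> b f by (simp only: Cech_nerve_simps o)
  have "[b] \<in> carrier (fiber_product X 0)" "[b'] \<in> carrier (fiber_product X 0)"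
    using f o by (metis Cech_nerve_simps le_refl zero_le)+
  then show "\<sigma> [b] \<in> carrier A" "\<sigma> [b'] \<in> carrier A"
    using smooth_functions_closed[OF \<sigma>] by auto
qed

lemma differential_Q_0:
  assumes \<sigma>: "\<sigma> \<in> smooth_functions (level (Q X) 0) (group_space A)"
    and p: "p\<^sub>1 \<in> plots X" "p\<^sub>0 \<in> plots X" "f \<in> plot_maps p\<^sub>1 p\<^sub>0" "x \<in> points (fst p\<^sub>1)"
  shows "differential (Q X) A 0 \<sigma> (([p\<^sub>1, p\<^sub>0], [f]), x) = \<sigma> (([p\<^sub>0], []), f x) \<otimes> inv (\<sigma> (([p\<^sub>1], []), x))"
proof -
  have s: "(([p\<^sub>1, p\<^sub>0], [f]), x) \<in> carrier (level (Q X) 1)"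
    unfolding carrier_level_Q_1 using p by auto
  have "Q_face 1 i (([p\<^sub>1, p\<^sub>0], [f]), x) \<in> carrier (level (Q X) 0)" if "i \<le> 1" for i
  proof -
    from that consider "i = 0" | "i = 1" by linarith
    then show ?thesis
      by cases (simp_all only: Q_face_1 carrier_level_Q_0 p plot_mapsD(3)[OF p(3,4)])
  qed
  then show ?thesis
    using differential_0[OF \<sigma> s] by (simp only: face_Q Q_face_1) simp
qed

text \<open>Over a pair \<open>(g, h)\<close> the differential is the difference of the pullbacks of
  \<sigma> along \<open>h\<close> and along \<open>g\<close>, both plots of A. The cocycle identity
  is the telescoping of such differences.\<close>

lemma differential_Cech_cocycle:
  assumes \<sigma>: "\<sigma> \<in> smooth_functions (fiber_product X 0) (group_space A)"
  shows "differential (Cech_nerve X) A 0 \<sigma> \<in> carrier (cocycles (Cech_nerve X) A 1)"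
  unfolding Cech_cocycle_iff
proof (intro conjI allI impI)
  let ?d = "differential (Cech_nerve X) A 0 \<sigma>"
  note d = differential_Cech_0[OF \<sigma>]
  show "?d \<in> smooth_functions (fiber_product X 1) (group_space A)"
    unfolding smooth_functions_fiber_product_1[OF X dspace]
  proof (intro conjI allI impI)
    have "?d bs \<in> carrier A" if "bs \<in> carrier (fiber_product X 1)" for bs
    proof -
      obtain b b' where "bs = [b, b']"
        using \<open>bs \<in> carrier (fiber_product X 1)\<close> unfolding carrier_fiber_product_1 by blast
      then show ?thesis using d[of b b'] that by simp
    qed
    moreover have "?d \<in> extensional (carrier (fiber_product X 1))"
      by (simp add: differential_def)
    ultimately show "?d \<in> carrier (fiber_product X 1) \<rightarrow>\<^sub>E carrier (group_space A)"
      by (auto simp: PiE_def)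
    fix V p q g h
    assume V: "cartesian V" and p: "p \<in> plots X" and q: "q \<in> plots X"
      and g: "g \<in> smooth_maps V (fst p)" and h: "h \<in> smooth_maps V (fst q)"
      and eq: "\<forall>x\<in>points V. snd p (g x) = snd q (h x)"
    have gh: "g x \<in> points (fst p)" "h x \<in> points (fst q)" if "x \<in> points V" for x
      using smooth_mapsD(1)[OF g] smooth_mapsD(1)[OF h] that by auto
    have \<sigma>p: "(V, \<lambda>x\<in>points V. \<sigma> [(r, k x)]) \<in> group_plots A" if r: "r \<in> plots X" and k: "k \<in> smooth_maps V (fst r)" for r k
    proof -
      have "(fst r, \<lambda>x\<in>points (fst r). \<sigma> [(r, x)]) \<in> group_plots A"
        using \<sigma> r unfolding smooth_functions_fiber_product_0[OF X dspace] by simp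
      from plot_compose[OF this V k] show ?thesis
        using PiE_mem[OF smooth_mapsD(1)[OF k]] by (simp cong: restrict_cong)
    qed
    have "(V, \<lambda>x\<in>points V. \<sigma> [(q, h x)] \<otimes> inv (\<sigma> [(p, g x)])) \<in> group_plots A"
      using plot_mult[OF \<sigma>p[OF q h] plot_inv[OF \<sigma>p[OF p g]]] by (simp cong: restrict_cong)
    moreover have "?d [(p, g x), (q, h x)] = \<sigma> [(q, h x)] \<otimes> inv (\<sigma> [(p, g x)])" if "x \<in> points V" for x
      using p q eq gh[OF that] that by (intro d(1)) (simp only: pair_fiber_product_1)
    ultimately show "(V, \<lambda>x\<in>points V. ?d [(p, g x), (q, h x)]) \<in> plots (group_space A)"
      by (simp cong: restrict_cong)
  qed
  fix b\<^sub>0 b\<^sub>1 b\<^sub>2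
  assume b: "[b\<^sub>0, b\<^sub>1] \<in> carrier (fiber_product X 1)" "[b\<^sub>1, b\<^sub>2] \<in> carrier (fiber_product X 1)"
  show "?d [b\<^sub>0, b\<^sub>2] = ?d [b\<^sub>1, b\<^sub>2] \<otimes> ?d [b\<^sub>0, b\<^sub>1]"
    unfolding d(1)[OF b(1)] d(1)[OF b(2)] d(1)[OF fiber_product_1_trans[OF b]]
    using d(2,3)[OF b(1)] d(2,3)[OF b(2)]
    by (metis inv_closed l_inv m_assoc m_closed r_one)
qed

text \<open>This makes the Cech coboundaries a subgroup, being the image of a homomorphism. The
  coboundaries of QX inherit the property as the image of these under the isomorphism of cocycle
  groups.\<close>

lemma differential_Cech_hom:
  "differential (Cech_nerve X) A 0 \<in> hom (cochains (Cech_nerve X) A 0) (cocycles (Cech_nerve X) A 1)"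
proof (rule homI)
  show "differential (Cech_nerve X) A 0 \<sigma> \<in> carrier (cocycles (Cech_nerve X) A 1)"
    if "\<sigma> \<in> carrier (cochains (Cech_nerve X) A 0)" for \<sigma>
    using that by (intro differential_Cech_cocycle) simp
  fix \<sigma> \<tau> assume st: "\<sigma> \<in> carrier (cochains (Cech_nerve X) A 0)" "\<tau> \<in> carrier (cochains (Cech_nerve X) A 0)"
  then have \<sigma>: "\<sigma> \<in> smooth_functions (fiber_product X 0) (group_space A)"
    and \<tau>: "\<tau> \<in> smooth_functions (fiber_product X 0) (group_space A)"
    by simp_all
  let ?m = "\<lambda>s\<in>carrier (fiber_product X 0). \<sigma> s \<otimes> \<tau> s"
  have m: "?m \<in> smooth_functions (fiber_product X 0) (group_space A)"
    using smooth_functions_mult[OF well_formed_plots_Cech[of X 0]] \<sigma> \<tau> by simp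
  have "differential (Cech_nerve X) A 0 ?m bs =
      differential (Cech_nerve X) A 0 \<sigma> bs \<otimes> differential (Cech_nerve X) A 0 \<tau> bs"
    if bs: "bs \<in> carrier (fiber_product X 1)" for bs
  proof -
    obtain b b' where eq: "bs = [b, b']"
      using bs unfolding carrier_fiber_product_1 by blast
    note b = bs[unfolded eq]
    have "[b] \<in> carrier (fiber_product X 0)" "[b'] \<in> carrier (fiber_product X 0)"
      using omit_fiber_product[of "[b, b']" X 0 0] omit_fiber_product[of "[b, b']" X 0 1] b by (simp_all add: omit_def)
    then show ?thesis
      unfolding eq differential_Cech_0(1)[OF m b] differential_Cech_0(1)[OF \<sigma> b] differential_Cech_0(1)[OF \<tau> b]
      using differential_Cech_0(2,3)[OF \<sigma> b] differential_Cech_0(2,3)[OF \<tau> b]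
      by (simp add: inv_mult m_ac)
  qed
  moreover have "differential (Cech_nerve X) A 0 ?m \<in> extensional (carrier (fiber_product X 1))"
    by (simp add: differential_def)
  ultimately show "differential (Cech_nerve X) A 0 (\<sigma> \<otimes>\<^bsub>cochains (Cech_nerve X) A 0\<^esub> \<tau>) =
      differential (Cech_nerve X) A 0 \<sigma> \<otimes>\<^bsub>cocycles (Cech_nerve X) A 1\<^esub> differential (Cech_nerve X) A 0 \<tau>"
    unfolding mult_cocycles by (intro extensionalityI[of _ "carrier (fiber_product X 1)"]) (simp_all add: cochains_def)
qed

lemma comm_group_Cech: "comm_group (cocycles (Cech_nerve X) A 1)"
  by (rule comm_group_cocycles_1[OF well_formed_plots_Cech faces_Cech])

lemma comm_group_Q: "comm_group (cocycles (Q X) A 1)"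
  by (rule comm_group_cocycles_1[OF well_formed_plots_Q faces_Q])

lemma coboundaries_1: "coboundaries S A 1 = differential S A 0 ` smooth_functions (level S 0) (group_space A)"
  by (simp add: coboundaries_def)

lemma coboundaries_Cech_subgroup: "subgroup (coboundaries (Cech_nerve X) A 1) (cocycles (Cech_nerve X) A 1)"
proof -
  interpret group_hom "cochains (Cech_nerve X) A 0" "cocycles (Cech_nerve X) A 1" "differential (Cech_nerve X) A 0"
    using comm_group_cochains[OF well_formed_plots_Cech, of X 0] comm_group_Cech differential_Cech_hom
    by (auto simp: group_hom_def group_hom_axioms_def comm_group_def)
  show ?thesis
    using img_is_subgroup by (simp only: coboundaries_1 carrier_cochains)
qed

text \<open>Degree 0 is B on both sides, with a point written as \<open>[(p, x)]\<close> or as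
  \<open>(([p], []), x)\<close>. In either notation, smoothness means being a plot of A on each
  \<open>U\<^sub>p\<close>.\<close>

lemma phi_cochain_0_image:
  "phi_cochain X 0 ` smooth_functions (fiber_product X 0) (group_space A) =
    smooth_functions (level (Q X) 0) (group_space A)"
proof (intro equalityI subsetI)
  fix \<rho> assume "\<rho> \<in> phi_cochain X 0 ` smooth_functions (fiber_product X 0) (group_space A)"
  then obtain \<sigma> where \<sigma>: "\<sigma> \<in> smooth_functions (fiber_product X 0) (group_space A)" and \<rho>: "\<rho> = phi_cochain X 0 \<sigma>"
    by blast
  have val: "\<rho> (([p], []), x) = \<sigma> [(p, x)]" if "p \<in> plots X" "x \<in> points (fst p)" for p x
    unfolding \<rho> using that by (intro phi_cochain_0) simp
  show "\<rho> \<in> smooth_functions (level (Q X) 0) (group_space A)"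
    unfolding smooth_Q_0
  proof (intro conjI ballI)
    have "\<rho> s \<in> carrier A" if s: "s \<in> carrier (level (Q X) 0)" for s
    proof (rule carrier_level_Q_0E[OF s])
      fix p x assume "s = (([p], []), x)" "p \<in> plots X" "x \<in> points (fst p)"
      then show ?thesis
        using val smooth_functions_closed[OF \<sigma>, of "[(p, x)]"] carrier_fiber_product_0[of "[(p, x)]" X] by simp
    qed
    then show "\<rho> \<in> carrier (level (Q X) 0) \<rightarrow>\<^sub>E carrier A"
      by (auto simp: \<rho> phi_cochain_def compose_def)
    fix p assume p: "p \<in> plots X"
    have "(fst p, \<lambda>x\<in>points (fst p). \<sigma> [(p, x)]) \<in> group_plots A"
      using \<sigma> p unfolding smooth_functions_fiber_product_0[OF X dspace] by simp
    then show "(fst p, \<lambda>x\<in>points (fst p). \<rho> (([p], []), x)) \<in> group_plots A"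
      using val[OF p] by (simp cong: restrict_cong)
  qed
next
  fix \<rho> assume \<rho>: "\<rho> \<in> smooth_functions (level (Q X) 0) (group_space A)"
  define \<sigma> where "\<sigma> = (\<lambda>bs\<in>carrier (fiber_product X 0). \<rho> (([fst (hd bs)], []), snd (hd bs)))"
  have val: "\<sigma> [(p, x)] = \<rho> (([p], []), x)" if "p \<in> plots X" "x \<in> points (fst p)" for p x
    using that carrier_fiber_product_0[of "[(p, x)]" X] by (auto simp: \<sigma>_def)
  have "\<sigma> \<in> smooth_functions (fiber_product X 0) (group_space A)"
    unfolding smooth_functions_fiber_product_0[OF X dspace]
  proof (intro conjI ballI)
    have "\<rho> (([fst (hd bs)], []), snd (hd bs)) \<in> carrier A" if "bs \<in> carrier (fiber_product X 0)" for bs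
      using that unfolding carrier_fiber_product_0 by (auto intro!: smooth_functions_closed[OF \<rho>])
    then show "\<sigma> \<in> carrier (fiber_product X 0) \<rightarrow>\<^sub>E carrier (group_space A)"
      by (auto simp: \<sigma>_def)
    fix p assume p: "p \<in> plots X"
    have "(fst p, \<lambda>x\<in>points (fst p). \<rho> (([p], []), x)) \<in> group_plots A"
      using \<rho> p unfolding smooth_Q_0 by simp
    then show "(fst p, \<lambda>x\<in>points (fst p). \<sigma> [(p, x)]) \<in> plots (group_space A)"
      using val[OF p] by (simp cong: restrict_cong)
  qed
  moreover have "phi_cochain X 0 \<sigma> = \<rho>"
  proof (rule extensionalityI[of _ "carrier (level (Q X) 0)"])
    show "phi_cochain X 0 \<sigma> \<in> extensional (carrier (level (Q X) 0))"
      by (simp add: phi_cochain_def compose_def)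
    show "\<rho> \<in> extensional (carrier (level (Q X) 0))"
      using smooth_functions_PiE[OF \<rho>] by (simp add: PiE_def)
    fix s assume "s \<in> carrier (level (Q X) 0)"
    then show "phi_cochain X 0 \<sigma> s = \<rho> s"
      by (rule carrier_level_Q_0E) (simp add: phi_cochain_0 val)
  qed
  ultimately show "\<rho> \<in> phi_cochain X 0 ` smooth_functions (fiber_product X 0) (group_space A)"
    by blast
qed

text \<open>The comparison comes from a functor and so respects faces: source and target of the
  morphism assigned to \<open>(x, f)\<close> are \<open>(p\<^sub>1, x)\<close> and
  \<open>(p\<^sub>0, f x)\<close>, the objects given by the two faces of the chain.\<close>

lemma phi_cochain_differential:
  assumes \<sigma>: "\<sigma> \<in> smooth_functions (fiber_product X 0) (group_space A)"
  shows "phi_cochain X 1 (differential (Cech_nerve X) A 0 \<sigma>) = differential (Q X) A 0 (phi_cochain X 0 \<sigma>)"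
proof (rule extensionalityI[of _ "carrier (level (Q X) 1)"])
  show "phi_cochain X 1 (differential (Cech_nerve X) A 0 \<sigma>) \<in> extensional (carrier (level (Q X) 1))"
    by (simp add: phi_cochain_def compose_def)
  show "differential (Q X) A 0 (phi_cochain X 0 \<sigma>) \<in> extensional (carrier (level (Q X) 1))"
    by (simp add: differential_def)
  have \<rho>: "phi_cochain X 0 \<sigma> \<in> smooth_functions (level (Q X) 0) (group_space A)"
    using phi_cochain_0_image \<sigma> by blast
  fix s assume "s \<in> carrier (level (Q X) 1)"
  then obtain p\<^sub>1 p\<^sub>0 f x where s: "s = (([p\<^sub>1, p\<^sub>0], [f]), x)" and p: "p\<^sub>1 \<in> plots X" "p\<^sub>0 \<in> plots X"
    "f \<in> plot_maps p\<^sub>1 p\<^sub>0" "x \<in> points (fst p\<^sub>1)"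
    by (rule carrier_level_Q_1E)
  note fx = plot_mapsD(2,3)[OF p(3,4)]
  have C: "[(p\<^sub>1, x), (p\<^sub>0, f x)] \<in> carrier (fiber_product X 1)"
    unfolding pair_fiber_product_1 using p fx by auto
  have "phi_cochain X 1 (differential (Cech_nerve X) A 0 \<sigma>) s = differential (Cech_nerve X) A 0 \<sigma> [(p\<^sub>1, x), (p\<^sub>0, f x)]"
    unfolding s by (rule phi_cochain_1) (use p in \<open>simp only: carrier_level_Q_1\<close>)
  also have "\<dots> = \<sigma> [(p\<^sub>0, f x)] \<otimes> inv (\<sigma> [(p\<^sub>1, x)])"
    by (rule differential_Cech_0(1)[OF \<sigma> C])
  also have "\<dots> = differential (Q X) A 0 (phi_cochain X 0 \<sigma>) s"
    unfolding s differential_Q_0[OF \<rho> p] using p fx by (simp add: phi_cochain_0)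
  finally show "phi_cochain X 1 (differential (Cech_nerve X) A 0 \<sigma>) s = differential (Q X) A 0 (phi_cochain X 0 \<sigma>) s" .
qed

lemma phi_cochain_coboundaries:
  "phi_cochain X 1 ` coboundaries (Cech_nerve X) A 1 = coboundaries (Q X) A 1"
  unfolding coboundaries_1 Cech_nerve_simps phi_cochain_0_image[symmetric] image_image
  by (intro image_cong refl phi_cochain_differential)

lemmas phi_properties = iso_Mod[OF comm_group_Cech comm_group_Q phi_cochain_iso coboundaries_Cech_subgroup
  phi_cochain_coboundaries]

end

theorem proposition5p39:
  fixes X :: "'x diffeological" and A :: "'a diffeological_group"
  assumes "diffeological_space X" and "abelian_diffeological_group A"
  shows "(\<forall>\<tau> \<in> carrier (cocycles (Cech_nerve X) A 1).
            \<exists>\<rho> \<in> carrier (cocycles (Q X) A 1).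
              (\<forall>p\<^sub>1 p\<^sub>0 f\<^sub>0 x. (([p\<^sub>1, p\<^sub>0], [f\<^sub>0]), x) \<in> carrier (level (Q X) 1) \<longrightarrow>
                 \<rho> (([p\<^sub>1, p\<^sub>0], [f\<^sub>0]), x) = \<tau> [(p\<^sub>1, x), (p\<^sub>0, f\<^sub>0 x)]) \<and>
              phi X A 1 (cohomology_class (Cech_nerve X) A 1 \<tau>) = cohomology_class (Q X) A 1 \<rho>) \<and>
         phi X A 1 \<in> iso (H_KWW X A 1) (H_infinity X A 1)"
proof -
  interpret comparison A X
    using assms by unfold_locales
  \<comment> \<open>In this form \<open>phi\<close> is literally the induced map of
    \<open>iso_Mod\<close>, so well-definedness and bijectivity are read off from
    \<open>phi_properties\<close>.\<close>
  have phi: "phi X A 1 = (\<lambda>c. \<Union>\<sigma>\<in>c. coboundaries (Q X) A 1 #>\<^bsub>cocycles (Q X) A 1\<^esub> phi_cochain X 1 \<sigma>)"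
    by (simp add: fun_eq_iff phi_def cohomology_class_def)
  show ?thesis
  proof (intro conjI ballI)
    fix \<tau> assume \<tau>: "\<tau> \<in> carrier (cocycles (Cech_nerve X) A 1)"
    show "\<exists>\<rho> \<in> carrier (cocycles (Q X) A 1).
        (\<forall>p\<^sub>1 p\<^sub>0 f\<^sub>0 x. (([p\<^sub>1, p\<^sub>0], [f\<^sub>0]), x) \<in> carrier (level (Q X) 1) \<longrightarrow>
           \<rho> (([p\<^sub>1, p\<^sub>0], [f\<^sub>0]), x) = \<tau> [(p\<^sub>1, x), (p\<^sub>0, f\<^sub>0 x)]) \<and>
        phi X A 1 (cohomology_class (Cech_nerve X) A 1 \<tau>) = cohomology_class (Q X) A 1 \<rho>"
      \<comment> \<open>The witness is \<open>phi_cochain X 1 \<tau>\<close>; the class formula is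
        the first part of \<open>phi_properties\<close>.\<close>
      using phi_cochain_cocycle[OF \<tau>] phi_cochain_1 phi_properties(1)[OF \<tau>]
      unfolding phi cohomology_class_def by blast
  next
    show "phi X A 1 \<in> iso (H_KWW X A 1) (H_infinity X A 1)"
      using phi_properties(2) unfolding phi H_KWW_def H_infinity_def cohomology_def .
  qed
qed

end
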